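(* Let $(a_j)_{j=0}^\infty$ be a sequence of independent real-valued random variables on a probability space $(\Omega,\Sigma,\mathbb P)$ with $\mathbb E[a_j]=0$, $\mathbb E[a_j^2]=1$, and, for some constant $K$, $\mathcal L(a_j,\varepsilon)\le K\varepsilon$ for all $\varepsilon>0$ and all $j$. Let $f_\omega(z)=\sum_{j=0}^\infty a_j(\omega)z^j$, and let $R_m(f_\omega)$ be the radius of the largest open disc centered at the origin that contains no more than $m$ zeros of $f_\omega$. Then for almost all $\omega$ one has $R_m(f_\omega)<1$ for every $m$, and, for each fixed $m$, the zeros of the Padé denominators $Q_{mn}^{(f_\omega)}$ cluster uniformly, up to passing to a subsequence as $n\to\infty$, around the circle $|z|=R_m(f_\omega)$; moreover $1-R_m(f_\omega)=O(\log m/m)$ as $m\to\infty$.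
   Context: Lévy concentration function: for a real random variable $\xi$ and $\delta>0$, $\mathcal L(\xi,\delta)=\sup_{t\in\mathbb R}\mathbb P(|\xi-t|<\delta)$. Zeros of $f_\omega$ are counted with multiplicity, and $f_\omega$ is regarded as a function on the open unit disc (almost surely the series has radius of convergence $1$, so the radii considered are at most $1$). Padé approximant: for a power series $f(z)=\sum_{j\ge0}a_jz^j$, the $[m,n]$-Padé approximant is the rational function $P_{mn}^{(f)}/Q_{mn}^{(f)}$, where $P_{mn}^{(f)}$, $Q_{mn}^{(f)}$ are polynomials of degree at most $m$ and $n$ respectively, $Q_{mn}^{(f)}\not\equiv0$, and $f(z)Q_{mn}^{(f)}(z)-P_{mn}^{(f)}(z)=\sum_{j\ge m+n+1}c_jz^j$ for some $c_j$. Under the present hypotheses, almost surely for all $m,n$ the pair is unique up to a common nonzero constant factor and $Q_{mn}^{(f)}$ has degree exactly $n$. Clustering: for a polynomial $P$ of degree $d\ge1$ with roots $z_1,\dots,z_d$ (with multiplicity), $\nu_P=\frac1d\sum_{j=1}^d\delta_{z_j}$. The zeros of a sequence of polynomials $P_l$, of degrees tending to infinity, cluster uniformly around the circle of radius $r$ if, as $l\to\infty$, both (a) for every $\rho>0$, $\nu_{P_l}(\{z:(1-\rho)r<|z|<(1+\rho)r\})\to1$, and (b) for all $0\le\theta<\phi<2\pi$, $\nu_{P_l}(\{z:\theta<\operatorname{Arg}z\le\phi\})\to\frac{\phi-\theta}{2\pi}$. "Up to subsequence as $n\to\infty$" means there is a sequence $n_1<n_2<\cdots$ (depending on $m$ and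 $\omega$) such that the zeros of $Q_{mn_l}^{(f_\omega)}$ cluster uniformly as $l\to\infty$. *)

theory Defs
  imports "HOL-Probability.Probability" "HOL-Complex_Analysis.Complex_Analysis"
begin

definition levy_conc :: "'w measure \<Rightarrow> ('w \<Rightarrow> real) \<Rightarrow> real \<Rightarrow> real" where
  "levy_conc M X \<delta> = (SUP t. measure M {\<omega> \<in> space M. \<bar>X \<omega> - t\<bar> < \<delta>})"

definition random_series :: "(nat \<Rightarrow> 'w \<Rightarrow> real) \<Rightarrow> 'w \<Rightarrow> complex fps" where
  "random_series a \<omega> = Abs_fps (\<lambda>j. complex_of_real (a j \<omega>))"

definition at_most_zeros_in :: "(complex \<Rightarrow> complex) \<Rightarrow> complex set \<Rightarrow> nat \<Rightarrow> bool" where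
  "at_most_zeros_in f S m \<longleftrightarrow>
     finite {z \<in> S. f z = 0} \<and> (\<Sum>z | z \<in> S \<and> f z = 0. zorder f z) \<le> int m"

text \<open>The series is regarded as a function on the open unit disc, so only radii up to 1 are
  considered. The supremum is attained when the series converges on the unit disc and is not zero:
  an increasing union of discs with at most \<open>m\<close> zeros has at most \<open>m\<close> zeros. The radius 0,
  i.e. the empty disc, makes the set nonempty.\<close>

definition zero_radius :: "nat \<Rightarrow> complex fps \<Rightarrow> real" where
  "zero_radius m F = Sup {r \<in> {0..1}. at_most_zeros_in (eval_fps F) (ball 0 r) m}"

definition is_pade :: "complex fps \<Rightarrow> nat \<Rightarrow> nat \<Rightarrow> complex poly \<Rightarrow> complex poly \<Rightarrow> bool" where
  "is_pade F m n P Q \<longleftrightarrow>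
     degree P \<le> m \<and> degree Q \<le> n \<and> Q \<noteq> 0 \<and>
     (\<forall>j < m + n + 1. fps_nth (F * fps_of_poly Q - fps_of_poly P) j = 0)"

definition pade_denominator :: "complex fps \<Rightarrow> nat \<Rightarrow> nat \<Rightarrow> complex poly \<Rightarrow> bool" where
  "pade_denominator F m n Q \<longleftrightarrow> (\<exists>P. is_pade F m n P Q)"

text \<open>The root counting measure, normalised by the degree (meaningful for nonconstant \<open>P\<close> only).\<close>

definition root_measure :: "complex poly \<Rightarrow> complex set \<Rightarrow> real" where
  "root_measure P A = real (size (filter_mset (\<lambda>z. z \<in> A) (proots P))) / real (degree P)"

text \<open>The principal argument used here is the one with values in \<open>[0, 2\<pi>)\<close>.\<close>

definition zeros_cluster :: "(nat \<Rightarrow> complex poly) \<Rightarrow> real \<Rightarrow> bool" where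
  "zeros_cluster P r \<longleftrightarrow>
     filterlim (\<lambda>l. degree (P l)) at_top sequentially \<and>
     (\<forall>\<rho>>0. (\<lambda>l. root_measure (P l) {z. (1 - \<rho>) * r < cmod z \<and> cmod z < (1 + \<rho>) * r})
        \<longlonglongrightarrow> 1) \<and>
     (\<forall>\<theta> \<phi>. 0 \<le> \<theta> \<and> \<theta> < \<phi> \<and> \<phi> < 2 * pi \<longrightarrow>
        (\<lambda>l. root_measure (P l) {z. \<theta> < Arg2pi z \<and> Arg2pi z \<le> \<phi>})
        \<longlonglongrightarrow> (\<phi> - \<theta>) / (2 * pi))"

end

(*
The Pade denominators Q_n, with numerators normalised to have coefficient norm 1, satisfy
the conditions of a Jentzsch-Szego theorem on the circle |z| = R, R = R_m(f).

Upper bound: if B has the zeros of f in |z| < R as roots, then deg B <= m and B Q_n is the Taylor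
polynomial of degree m + n of (B/f) P_n, which is holomorphic in |z| < R. Lower bound inside the disc:
P_n is the Taylor polynomial of degree m of f Q_n. Leading coefficient: the cross product
P_{n+1} Q_n - P_n Q_{n+1} is a monomial whose coefficient contains the leading coefficient of Q_{n+1}; if these
were small from some n on, telescoping would show that f Q_n - P_n tends to 0 on a disc
that contains more than m zeros of f, which is impossible. Hence they are large along a subsequence.

For the Jentzsch-Szego theorem itself, Blaschke factors show that few zeros lie off the circle. For |z| > R,
log |prod (1 - w/z)| over the remaining zeros w is bounded by a small multiple of n, so by
Borel-Caratheodory the power sums of the w are small, and Weyl's criterion gives equidistribution
of the arguments.

Almost surely f has infinitely many zeros in (0,1): at suitable points x_k -> 1 the series is dominated by blocks of
independent coefficients, and each block sum is large of either sign with probability bounded below.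
The rate for R_m is Jensen's inequality with |a_j| = O(j).
*)

theory Submission
  imports Defs "HOL-Computational_Algebra.Computational_Algebra" "HOL-Real_Asymp.Real_Asymp"
begin

subsection \<open>Counting zeros with Blaschke factors\<close>

text \<open>With \<open>m\<close> fixed and \<open>n\<close> growing, the denominators live in no
  fixed space. The numerators do, and their normalisation reduces every estimate to a fixed
  finite-dimensional space. The radius \<open>R m\<close> is where the balance tips: the open disc
  holds at most \<open>m\<close> zeros, few enough for the degree of \<open>B * Q\<close> to stay
  below \<open>m + n + 1\<close>, while the closed disc holds more than \<open>m\<close>, too many
  for a numerator of degree at most \<open>m\<close> to share.

  The telescoping divides by numerators whose zeros wander with \<open>n\<close> and may approach
  any prescribed circle. The circle is therefore chosen after the numerators, outside intervals of
  geometrically decreasing length around the moduli of their zeros.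

  The coefficients need not be identically distributed and only second moments are controlled, so no
  central limit theorem is at hand. Concentration bounds \<open>E |a_j|\<close> from below, duality
  with a Riesz product carries this over to weighted sums, and a zero-one law replaces positive
  probability by probability one. Since the coefficients are real, zeros can be obtained as sign
  changes on (0,1).\<close>

lemma prod_mset_filter_split:
  "(\<Prod>x\<in>#A. f x) = (\<Prod>x\<in>#filter_mset P A. f x) * (\<Prod>x\<in>#filter_mset (\<lambda>x. \<not> P x) A. f x)"
  by (induction A) (auto simp: algebra_simps)

lemma norm_prod_mset:
  fixes f :: "'b \<Rightarrow> 'a :: {comm_semiring_1, real_normed_div_algebra}"
  shows "norm (\<Prod>x\<in>#A. f x) = (\<Prod>x\<in>#A. norm (f x))"
  by (induction A) (auto simp: norm_mult)

lemma prod_mset_mono_nonneg: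
  fixes f g :: "'b \<Rightarrow> real"
  assumes "\<And>x. x \<in># A \<Longrightarrow> 0 \<le> f x \<and> f x \<le> g x"
  shows "0 \<le> (\<Prod>x\<in>#A. f x) \<and> (\<Prod>x\<in>#A. f x) \<le> (\<Prod>x\<in>#A. g x)"
  using assms
proof (induction A)
  case (add x A)
  then have "0 \<le> (\<Prod>x\<in>#A. f x) \<and> (\<Prod>x\<in>#A. f x) \<le> (\<Prod>x\<in>#A. g x)" "0 \<le> f x" "f x \<le> g x"
    by auto
  then show ?case by (auto intro!: mult_mono mult_nonneg_nonneg)
qed auto

lemma holomorphic_on_prod_mset:
  assumes "\<And>w. w \<in># W \<Longrightarrow> g w holomorphic_on S"
  shows "(\<lambda>z. \<Prod>w\<in>#W. g w z) holomorphic_on S"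
  using assms by (induction W) (auto intro!: holomorphic_intros)

lemma max_modulus_disc:
  assumes "f holomorphic_on ball 0 S" "s < S" "cmod z0 \<le> s"
    and "\<And>z. cmod z = s \<Longrightarrow> cmod (f z) \<le> U"
  shows "cmod (f z0) \<le> U"
proof (rule maximum_modulus_frontier[of f "cball 0 s"])
  show "f holomorphic_on interior (cball 0 s)"
    using assms(1,2) by (auto intro: holomorphic_on_subset)
  show "continuous_on (closure (cball 0 s)) f"
    using assms(1,2) by (auto intro!: holomorphic_on_imp_continuous_on holomorphic_on_subset[OF assms(1)])
qed (use assms in auto)

text \<open>On the circle \<open>s^2 = z * cnj z\<close>, which turns the left factor into
  \<open>z * cnj (z - w)\<close>.\<close>

lemma blaschke_on_circle:
  assumes "cmod z = s"
  shows "cmod (of_real (s\<^sup>2) - cnj w * z) = s * cmod (z - w)"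
proof -
  have "complex_of_real (s\<^sup>2) = z * cnj z"
    using assms complex_norm_square[of z] by simp
  then have "of_real (s\<^sup>2) - cnj w * z = z * cnj (z - w)"
    by (simp add: algebra_simps)
  then have "cmod (of_real (s\<^sup>2) - cnj w * z) = cmod z * cmod (cnj (z - w))"
    by (simp only: norm_mult)
  then show ?thesis using assms by (simp only: complex_mod_cnj)
qed

text \<open>The quotient of the two moduli is the pseudohyperbolic distance of z and w in the disc
  of radius s. Over the disc of radius \<rho> it is largest at the antipodal points \<rho> and
  -\<rho>, where it equals the stated constant. The identity \<open>YX\<close> reduces this to the
  moduli of z and w.\<close>

lemma blaschke_in_disc:
  assumes "0 < \<rho>" "\<rho> < s" "cmod z \<le> \<rho>" "cmod w \<le> \<rho>"
  shows "s * cmod (z - w) \<le> (2 * \<rho> * s / (s\<^sup>2 + \<rho>\<^sup>2)) * cmod (of_real (s\<^sup>2) - cnj w * z)"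
proof -
  define Y where "Y = (cmod (of_real (s\<^sup>2) - cnj w * z))\<^sup>2"
  define b where "b = 2 * \<rho> * s / (s\<^sup>2 + \<rho>\<^sup>2)"
  have pos: "s\<^sup>2 + \<rho>\<^sup>2 > 0" using assms by (simp add: add_pos_pos)
  have b0: "b \<ge> 0" using assms pos by (simp add: b_def)
  have b1: "(s\<^sup>2 + \<rho>\<^sup>2)\<^sup>2 * (1 - b\<^sup>2) = (s\<^sup>2 - \<rho>\<^sup>2)\<^sup>2"
  proof -
    have "(s\<^sup>2 + \<rho>\<^sup>2)\<^sup>2 * b\<^sup>2 = (2 * \<rho> * s)\<^sup>2" using pos by (simp add: b_def power_divide)
    then show ?thesis by (simp add: algebra_simps power2_eq_square)
  qed
  have bl1: "1 - b\<^sup>2 \<ge> 0"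
    using b1 pos by (smt (verit, best) mult_pos_neg zero_le_power2 zero_less_power)
  have YX: "Y - (s * cmod (z - w))\<^sup>2 = (s\<^sup>2 - (cmod z)\<^sup>2) * (s\<^sup>2 - (cmod w)\<^sup>2)"
    unfolding Y_def power_mult_distrib cmod_power2 by (simp add: algebra_simps power2_eq_square)
  have "cmod (of_real (s\<^sup>2) - cnj w * z) \<le> s\<^sup>2 + cmod w * cmod z"
    using norm_triangle_ineq4[of "of_real (s\<^sup>2)" "cnj w * z"] by (simp add: norm_mult norm_power)
  also have "\<dots> \<le> s\<^sup>2 + \<rho>\<^sup>2" unfolding power2_eq_square using assms by (intro add_mono mult_mono) auto
  finally have Y: "Y \<le> (s\<^sup>2 + \<rho>\<^sup>2)\<^sup>2" unfolding Y_def by (intro power_mono) auto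
  have "Y * (1 - b\<^sup>2) \<le> (s\<^sup>2 + \<rho>\<^sup>2)\<^sup>2 * (1 - b\<^sup>2)" using Y bl1 by (rule mult_right_mono)
  also have "\<dots> = (s\<^sup>2 - \<rho>\<^sup>2) * (s\<^sup>2 - \<rho>\<^sup>2)" unfolding b1 by (rule power2_eq_square)
  also have "\<dots> \<le> (s\<^sup>2 - (cmod z)\<^sup>2) * (s\<^sup>2 - (cmod w)\<^sup>2)"
    using assms by (intro mult_mono) (auto intro!: power_mono)
  finally have "(s * cmod (z - w))\<^sup>2 \<le> b\<^sup>2 * Y" using YX by (simp add: algebra_simps)
  also have "\<dots> = (b * cmod (of_real (s\<^sup>2) - cnj w * z))\<^sup>2" by (simp add: Y_def power_mult_distrib)
  finally show ?thesis unfolding b_def[symmetric]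
    by (rule power2_le_imp_le) (use b0 in auto)
qed

text \<open>Multiplying by the inverses of the Blaschke factors of the zeros does not change the modulus
  on the circle, so the maximum principle gives a gain of \<open>\<beta>\<close> for each zero.\<close>

lemma zeros_reduce_modulus:
  assumes "h holomorphic_on ball 0 S" "0 < s" "s < S" "cmod z0 \<le> s" "0 \<le> \<beta>"
    and W: "\<And>w. w \<in># W \<Longrightarrow> s * cmod (z0 - w) \<le> \<beta> * cmod (of_real (s\<^sup>2) - cnj w * z0)"
    and U: "\<And>z. cmod z = s \<Longrightarrow> cmod ((\<Prod>w\<in>#W. z - w) * h z) \<le> U"
  shows "cmod ((\<Prod>w\<in>#W. z0 - w) * h z0) \<le> U * \<beta> ^ size W"
proof -
  define g where "g = (\<lambda>z. h z * (\<Prod>w\<in>#W. (of_real (s\<^sup>2) - cnj w * z) / of_real s))"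
  have ng: "cmod (g z) = cmod (h z) * (\<Prod>w\<in>#W. cmod (of_real (s\<^sup>2) - cnj w * z) / s)" for z
    unfolding g_def norm_mult norm_prod_mset norm_divide using assms(2) by simp
  have g: "cmod (g z0) \<le> U"
  proof (rule max_modulus_disc[OF _ assms(3,4)])
    show "g holomorphic_on ball 0 S" unfolding g_def
      using assms(1,2) by (intro holomorphic_intros holomorphic_on_prod_mset) auto
    fix z assume z: "cmod z = s"
    have "cmod (g z) = cmod ((\<Prod>w\<in>#W. z - w) * h z)"
      using assms(2) unfolding ng blaschke_on_circle[OF z] by (simp add: norm_mult norm_prod_mset)
    then show "cmod (g z) \<le> U" using U[OF z] by simp
  qed
  have "(\<Prod>w\<in>#W. cmod (z0 - w)) \<le> (\<Prod>w\<in>#W. \<beta> * (cmod (of_real (s\<^sup>2) - cnj w * z0) / s))"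
    using prod_mset_mono_nonneg[of W "\<lambda>w. cmod (z0 - w)" "\<lambda>w. \<beta> * (cmod (of_real (s\<^sup>2) - cnj w * z0) / s)"]
      W assms(2) by (simp add: field_simps)
  also have "\<dots> = \<beta> ^ size W * (\<Prod>w\<in>#W. cmod (of_real (s\<^sup>2) - cnj w * z0) / s)"
    by (subst prod_mset.distrib) (simp add: prod_mset_constant)
  finally have "cmod (h z0) * (\<Prod>w\<in>#W. cmod (z0 - w))
      \<le> cmod (h z0) * (\<beta> ^ size W * (\<Prod>w\<in>#W. cmod (of_real (s\<^sup>2) - cnj w * z0) / s))"
    by (rule mult_left_mono) simp
  then have "cmod ((\<Prod>w\<in>#W. z0 - w) * h z0) \<le> \<beta> ^ size W * cmod (g z0)"
    unfolding norm_mult norm_prod_mset ng by (simp only: mult_ac)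
  also have "\<dots> \<le> \<beta> ^ size W * U" using g assms(5) by (intro mult_left_mono) auto
  finally show ?thesis by (simp add: mult.commute)
qed

lemma poly_eq_prod_proots: "poly Q z = lead_coeff Q * (\<Prod>w\<in>#proots Q. z - w)" for z :: complex
proof -
  have "poly (\<Prod>w\<in>#A. [:-w, 1:]) z = (\<Prod>w\<in>#A. z - w)" for A
    by (induction A) (auto simp: algebra_simps)
  then show ?thesis using complex_poly_decompose_multiset[of Q] by (metis poly_smult)
qed

text \<open>Each zero in the small disc costs a fixed factor below 1, so a lower bound for Q at the
  single point z0 limits their number. The remaining zeros stay in the cofactor
  \<open>h\<close>.\<close>

lemma zeros_inside_bound:
  fixes Q :: "complex poly"
  assumes "0 < \<rho>" "\<rho> < s" "cmod z0 \<le> \<rho>" and U: "\<And>z. cmod z = s \<Longrightarrow> cmod (poly Q z) \<le> U"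
  shows "cmod (poly Q z0) \<le> U * (2 * \<rho> * s / (s\<^sup>2 + \<rho>\<^sup>2)) ^ size (filter_mset (\<lambda>w. cmod w \<le> \<rho>) (proots Q))"
proof -
  let ?W = "filter_mset (\<lambda>w. cmod w \<le> \<rho>) (proots Q)" and ?V = "filter_mset (\<lambda>w. \<not> cmod w \<le> \<rho>) (proots Q)"
  define h where "h = (\<lambda>z. lead_coeff Q * (\<Prod>w\<in>#?V. z - w))"
  have eq: "poly Q z = (\<Prod>w\<in>#?W. z - w) * h z" for z
    unfolding poly_eq_prod_proots[of Q] h_def by (subst prod_mset_filter_split[where P = "\<lambda>w. cmod w \<le> \<rho>"]) simp
  show ?thesis unfolding eq
  proof (rule zeros_reduce_modulus[where S = "s + 1"])
    show "h holomorphic_on ball 0 (s + 1)" unfolding h_def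
      by (intro holomorphic_intros holomorphic_on_prod_mset)
    show "s * cmod (z0 - w) \<le> 2 * \<rho> * s / (s\<^sup>2 + \<rho>\<^sup>2) * cmod (of_real (s\<^sup>2) - cnj w * z0)"
      if "w \<in># ?W" for w using that assms by (intro blaschke_in_disc) auto
  qed (use assms U eq in auto)
qed

text \<open>Jensen's inequality at radius R: \<open>cmod (lead_coeff Q)\<close> times the product of
  \<open>max R (cmod w)\<close> over all zeros is at most U. Zeros of the closed disc are traded for
  Blaschke numerators, so that \<open>cmod (h 0)\<close> is exactly this product.\<close>

lemma zeros_outside_bound:
  fixes Q :: "complex poly"
  assumes "0 < R" "0 < \<delta>" and U: "\<And>z. cmod z = R \<Longrightarrow> cmod (poly Q z) \<le> U"
  shows "cmod (lead_coeff Q) * R ^ degree Q * (1 + \<delta>) ^ size (filter_mset (\<lambda>w. cmod w \<ge> (1 + \<delta>) * R) (proots Q)) \<le> U"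
proof -
  let ?V = "filter_mset (\<lambda>w. cmod w \<le> R) (proots Q)" and ?W = "filter_mset (\<lambda>w. \<not> cmod w \<le> R) (proots Q)"
  define h where "h = (\<lambda>z. lead_coeff Q * (\<Prod>w\<in>#?V. (of_real (R\<^sup>2) - cnj w * z) / R) * (\<Prod>w\<in>#?W. z - w))"
  have split: "(\<Prod>w\<in>#proots Q. f w) = (\<Prod>w\<in>#?V. f w) * (\<Prod>w\<in>#?W. f w)" for f :: "complex \<Rightarrow> real"
    using prod_mset_filter_split[of f "proots Q" "\<lambda>w. cmod w \<le> R"] .
  have h0: "cmod (h 0) \<le> U"
  proof (rule max_modulus_disc[where f = h and S = "R + 1" and s = R and ?z0.0 = 0])
    show "h holomorphic_on ball 0 (R + 1)" unfolding h_def using assms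
      by (intro holomorphic_intros holomorphic_on_prod_mset) auto
    fix z assume z: "cmod z = R"
    have "cmod (h z) = cmod (lead_coeff Q) * (\<Prod>w\<in>#proots Q. cmod (z - w))"
      unfolding h_def norm_mult norm_prod_mset norm_divide blaschke_on_circle[OF z] split
      using assms by simp
    also have "\<dots> = cmod (poly Q z)" unfolding poly_eq_prod_proots norm_mult norm_prod_mset ..
    finally show "cmod (h z) \<le> U" using U z by simp
  qed (use assms in auto)
  define g where "g = (\<lambda>w::complex. R * (if cmod w \<ge> (1 + \<delta>) * R then 1 + \<delta> else 1))"
  have g: "(\<Prod>w\<in>#A. g w) = R ^ size A * (1 + \<delta>) ^ size (filter_mset (\<lambda>w. cmod w \<ge> (1 + \<delta>) * R) A)" for A
    by (induction A) (auto simp: g_def)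
  have "R ^ degree Q * (1 + \<delta>) ^ size (filter_mset (\<lambda>w. cmod w \<ge> (1 + \<delta>) * R) (proots Q)) = (\<Prod>w\<in>#proots Q. g w)"
    unfolding g size_proots_complex ..
  also have "\<dots> \<le> (\<Prod>w\<in>#proots Q. max R (cmod w))"
    using assms by (intro prod_mset_mono_nonneg[THEN conjunct2]) (auto simp: g_def mult.commute)
  also have "\<dots> = (\<Prod>w\<in>#?V. max R (cmod w)) * (\<Prod>w\<in>#?W. max R (cmod w))" by (rule split)
  also have "(\<Prod>w\<in>#?V. max R (cmod w)) = (\<Prod>w\<in>#?V. R)"
    by (intro arg_cong[where f = prod_mset] image_mset_cong) auto
  also have "(\<Prod>w\<in>#?W. max R (cmod w)) = (\<Prod>w\<in>#?W. cmod w)"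
    by (intro arg_cong[where f = prod_mset] image_mset_cong) auto
  finally have "cmod (lead_coeff Q) * (R ^ degree Q * (1 + \<delta>) ^ size (filter_mset (\<lambda>w. cmod w \<ge> (1 + \<delta>) * R) (proots Q)))
      \<le> cmod (lead_coeff Q) * ((\<Prod>w\<in>#?V. R) * (\<Prod>w\<in>#?W. cmod w))"
    by (intro mult_left_mono) auto
  also have "\<dots> = cmod (h 0)"
    unfolding h_def norm_mult norm_prod_mset norm_divide using assms
    by (simp add: norm_mult power2_eq_square)
  finally show ?thesis using h0 by (simp add: mult.assoc)
qed

subsection \<open>Power sums of zeros\<close>

text \<open>The map \<open>u / (2 * A - u)\<close> sends the half-plane \<open>Re u < A\<close> into
  the unit disc and fixes 0. Schwarz's lemma at half the radius then gives
  \<open>2 * cmod (u z) \<le> cmod (2 * A - u z)\<close>.\<close>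

lemma borel_caratheodory:
  assumes hol: "u holomorphic_on ball 0 r" and "0 < r" "u 0 = 0"
    and A: "\<And>z. cmod z < r \<Longrightarrow> Re (u z) < A" and z: "cmod z \<le> r / 2"
  shows "cmod (u z) \<le> 2 * A"
proof -
  have "A > 0" using A[of 0] assms by simp
  have lt: "cmod w < cmod (2 * A - w)" if "Re w < A" for w :: complex
  proof -
    have "(cmod (2 * A - w))\<^sup>2 - (cmod w)\<^sup>2 = 4 * A * (A - Re w)"
      unfolding cmod_power2 by (simp add: power2_eq_square algebra_simps)
    also have "\<dots> > 0" using that \<open>A > 0\<close> by simp
    finally show ?thesis using power2_less_imp_less by (metis diff_gt_0_iff_gt norm_ge_zero)
  qed
  define g where "g = (\<lambda>\<zeta>::complex. u (r * \<zeta>) / (2 * A - u (r * \<zeta>)))"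
  have in_ball: "cmod (r * \<zeta>) < r" if "cmod \<zeta> < 1" for \<zeta> :: complex
    using that \<open>0 < r\<close> by (simp add: norm_mult)
  have nz: "2 * A - u (r * \<zeta>) \<noteq> 0" if "cmod \<zeta> < 1" for \<zeta> :: complex
    using lt[OF A[OF in_ball[OF that]]] by auto
  have "cmod (g (z / r)) \<le> cmod (z / r)"
  proof (rule Schwarz_Lemma(1))
    have "(u \<circ> (\<lambda>\<zeta>. r * \<zeta>)) holomorphic_on ball 0 1"
      using in_ball by (intro holomorphic_on_compose_gen[OF _ hol] holomorphic_intros) auto
    then show "g holomorphic_on ball 0 1" unfolding g_def comp_def
      using nz by (intro holomorphic_intros) auto
    show "cmod (g \<zeta>) < 1" if "cmod \<zeta> < 1" for \<zeta>
      using lt[OF A[OF in_ball[OF that]]] nz[OF that] unfolding g_def norm_divide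
      by simp
    show "g 0 = 0" using assms by (simp add: g_def)
    show "cmod (z / r) < 1" using z \<open>0 < r\<close> by (simp add: norm_divide)
  qed
  also have "\<dots> \<le> 1 / 2" using z \<open>0 < r\<close> by (simp add: norm_divide field_simps)
  finally have "cmod (u z) / cmod (2 * A - u z) \<le> 1 / 2" using \<open>0 < r\<close> by (simp add: g_def norm_divide)
  moreover have "cmod (2 * A - u z) > 0" using lt[OF A[of z]] z \<open>0 < r\<close> norm_ge_zero[of "u z"] by linarith
  ultimately have "2 * cmod (u z) \<le> cmod (2 * A - u z)" by (simp add: field_simps)
  also have "\<dots> \<le> 2 * A + cmod (u z)" using norm_triangle_ineq4[of "2 * A" "u z"] \<open>A > 0\<close> by simp
  finally show ?thesis by simp
qed

text \<open>At index 0 the coefficient is \<open>- (1 / 0) = 0\<close> by the convention for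
  division, in agreement with \<open>Ln 1 = 0\<close>.\<close>

lemma has_fps_expansion_Ln_one_minus:
  "(\<lambda>\<zeta>. Ln (1 - w * \<zeta>)) has_fps_expansion Abs_fps (\<lambda>n. - (w ^ n / of_nat n))"
proof -
  \<comment> \<open>This radius keeps \<open>w * \<zeta>\<close> inside the unit disc and makes
    sense for w = 0 too.\<close>
  define L where "L = 1 / (2 * (cmod w + 1))"
  have L: "L > 0" unfolding L_def by (simp add: add_nonneg_pos)
  have s: "(\<lambda>n. - (w ^ n / of_nat n) * \<zeta> ^ n) sums Ln (1 - w * \<zeta>)" if "cmod \<zeta> \<le> L" for \<zeta>
  proof -
    have "cmod (w * \<zeta>) \<le> cmod w * L" using that by (simp add: norm_mult mult_left_mono)
    also have "\<dots> < 1"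
    proof -
      have "cmod w < 1 * (2 * (cmod w + 1))" by (smt (verit) norm_ge_zero)
      moreover have "2 * (cmod w + 1) > 0" by (smt (verit) norm_ge_zero)
      ultimately show ?thesis unfolding L_def by (simp add: pos_divide_less_eq)
    qed
    finally have "(\<lambda>n. - ((- (- (w * \<zeta>))) ^ n) / of_nat n) sums Ln (1 + (- (w * \<zeta>)))"
      by (intro Ln_series') simp
    then show ?thesis by (simp add: power_mult_distrib)
  qed
  show ?thesis unfolding has_fps_expansion_def
  proof
    have "ereal L \<le> conv_radius (\<lambda>n. - (w ^ n / of_nat n))"
      using conv_radius_geI[OF sums_summable[OF s[of "of_real L"]]] L by simp
    then show "0 < fps_conv_radius (Abs_fps (\<lambda>n. - (w ^ n / of_nat n)))"
      unfolding fps_conv_radius_def using L by (simp add: zero_ereal_def) (metis ereal_less(2) less_le_trans zero_ereal_def)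
    have "eventually (\<lambda>\<zeta>. \<zeta> \<in> ball 0 L) (nhds (0::complex))"
      using L by (intro eventually_nhds_in_open) auto
    then show "\<forall>\<^sub>F z in nhds 0. eval_fps (Abs_fps (\<lambda>n. - (w ^ n / of_nat n))) z = Ln (1 - w * z)"
      by eventually_elim (use s in \<open>auto simp: eval_fps_def intro!: sums_unique[symmetric]\<close>)
  qed
qed

text \<open>In the sum of \<open>Ln (1 - w * \<zeta>)\<close> the k-th Taylor coefficient is minus
  the k-th power sum divided by k, and the real part is the logarithm of the modulus of the product.
  Borel-Caratheodory bounds the sum by \<open>2 * A\<close> on the disc of radius
  \<open>1 / (2 * L)\<close>, and Cauchy's estimate there produces \<open>(2 * L) ^ k\<close>. The
  bound L on the points keeps \<open>1 - w * \<zeta>\<close> in the right half-plane, where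
  \<open>Ln\<close> is holomorphic.\<close>

lemma power_sum_bound:
  fixes V :: "complex multiset"
  assumes "0 < L" and V: "\<And>w. w \<in># V \<Longrightarrow> cmod w \<le> L" and "k \<ge> 1"
    and bd: "\<And>\<zeta>. cmod \<zeta> < 1 / L \<Longrightarrow> cmod (\<Prod>w\<in>#V. 1 - w * \<zeta>) < exp A"
  shows "cmod (\<Sum>w\<in>#V. w ^ k) \<le> real k * (2 * A) * (2 * L) ^ k"
proof -
  define u where "u = (\<lambda>\<zeta>. \<Sum>w\<in>#V. Ln (1 - w * \<zeta>))"
  have re: "Re (1 - w * \<zeta>) > 0" if "w \<in># V" "cmod \<zeta> < 1 / L" for w \<zeta>
  proof -
    have "cmod (w * \<zeta>) \<le> L * cmod \<zeta>" using V[OF that(1)] by (simp add: norm_mult mult_right_mono)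
    also have "\<dots> < 1" using that(2) \<open>0 < L\<close> by (simp add: field_simps)
    finally show ?thesis using complex_Re_le_cmod[of "w * \<zeta>"] by simp
  qed
  have hol: "u holomorphic_on ball 0 (1 / L)"
    using re unfolding u_def
  proof (induction V)
    case (add w V)
    have "(\<lambda>\<zeta>. Ln (1 - w * \<zeta>)) holomorphic_on ball 0 (1 / L)"
      using add.prems[of w] by (intro holomorphic_intros) (fastforce simp: complex_nonpos_Reals_iff)
    with add show ?case by (auto intro!: holomorphic_intros)
  qed auto
  have Re_u: "exp (Re (u \<zeta>)) = cmod (\<Prod>w\<in>#V. 1 - w * \<zeta>)" if "cmod \<zeta> < 1 / L" for \<zeta>
    using re unfolding u_def
  proof (induction V)
    case (add w V)
    have "1 - w * \<zeta> \<noteq> 0" using add.prems[of w \<zeta>] that by (metis add_mset_remove_trivial less_irrefl union_single_eq_member zero_complex.sel(1))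
    moreover have "exp (Re (\<Sum>w\<in>#V. Ln (1 - w * \<zeta>))) = cmod (\<Prod>w\<in>#V. 1 - w * \<zeta>)"
      using add by auto
    ultimately show ?case by (simp add: exp_add norm_mult)
  qed auto
  have small: "cmod (u z) \<le> 2 * A" if "cmod z \<le> 1 / L / 2" for z
  proof (rule borel_caratheodory[OF hol _ _ _ that])
    show "u 0 = 0" unfolding u_def by (induction V) auto
    show "Re (u z) < A" if "cmod z < 1 / L" for z
      using bd[OF that] unfolding Re_u[OF that, symmetric] by simp
  qed (use \<open>0 < L\<close> in auto)
  have "u has_fps_expansion Abs_fps (\<lambda>n. - ((\<Sum>w\<in>#V. w ^ n) / of_nat n))"
    unfolding u_def
  proof (induction V)
    case empty
    have "Abs_fps (\<lambda>n. 0::complex) = 0" by (simp add: fps_eq_iff)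
    then show ?case by simp
  next
    case (add w V)
    have "Abs_fps (\<lambda>n. - (w ^ n / of_nat n)) + Abs_fps (\<lambda>n. - ((\<Sum>w\<in>#V. w ^ n) / of_nat n)) =
        Abs_fps (\<lambda>n. - ((\<Sum>w\<in>#add_mset w V. w ^ n) / of_nat n))"
      by (simp add: fps_eq_iff add_divide_distrib)
    moreover have "(\<lambda>\<zeta>. Ln (1 - w * \<zeta>) + (\<Sum>w\<in>#V. Ln (1 - w * \<zeta>))) has_fps_expansion
      Abs_fps (\<lambda>n. - (w ^ n / of_nat n)) + Abs_fps (\<lambda>n. - ((\<Sum>w\<in>#V. w ^ n) / of_nat n))"
      by (intro has_fps_expansion_add has_fps_expansion_Ln_one_minus add.IH)
    ultimately show ?case by simp
  qed
  from fps_nth_fps_expansion[OF this, of k]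
  have "(\<Sum>w\<in>#V. w ^ k) = - of_nat k * ((deriv ^^ k) u 0 / fact k)"
    using \<open>k \<ge> 1\<close> by (simp add: field_simps) (metis minus_minus mult_minus_right)
  then have "cmod (\<Sum>w\<in>#V. w ^ k) = real k * (cmod ((deriv ^^ k) u 0) / fact k)"
    by (simp add: norm_mult norm_divide)
  also have "\<dots> \<le> real k * (fact k * (2 * A) / (1 / L / 2) ^ k / fact k)"
  proof (intro mult_left_mono divide_right_mono Cauchy_inequality)
    have "cball 0 (1 / L / 2) \<subseteq> ball (0::complex) (1 / L)" using \<open>0 < L\<close> by (auto simp: field_simps)
    then show "u holomorphic_on ball 0 (1 / L / 2)" "continuous_on (cball 0 (1 / L / 2)) u"
      using hol ball_subset_cball[of "0::complex" "1 / L / 2"]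
      by (meson holomorphic_on_subset holomorphic_on_imp_continuous_on order_trans)+
  qed (use small \<open>0 < L\<close> in auto)
  also have "\<dots> = real k * (2 * A) * (2 * L) ^ k"
    by (simp add: power_divide power_mult_distrib field_simps)
  finally show ?thesis .
qed

subsection \<open>Equidistribution of arguments\<close>

text \<open>Frequencies may repeat in the list, so that addition is concatenation and closure under
  products is a list induction.\<close>

definition trig_sum :: "(complex \<times> int) list \<Rightarrow> real \<Rightarrow> complex" where
  "trig_sum L t = (\<Sum>(c, e)\<leftarrow>L. c * cis (of_int e * t))"

lemma trig_sum_mult: "\<exists>N. \<forall>t. trig_sum L t * trig_sum M t = trig_sum N t"
proof (induction L)
  case Nil
  show ?case by (rule exI[of _ "[]"]) (simp add: trig_sum_def)
next
  case (Cons ce L)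
  obtain c e where ce: "ce = (c, e)" by force
  have "c * cis (of_int e * t) * trig_sum M t = trig_sum (map (\<lambda>(d, f). (c * d, e + f)) M) t" for t
    unfolding trig_sum_def
    by (induction M) (auto simp: algebra_simps cis_mult[symmetric])
  moreover obtain N where "\<forall>t. trig_sum L t * trig_sum M t = trig_sum N t" using Cons by blast
  ultimately have "trig_sum (ce # L) t * trig_sum M t =
      trig_sum (map (\<lambda>(d, f). (c * d, e + f)) M @ N) t" for t
    by (simp add: trig_sum_def ce algebra_simps)
  then show ?case by blast
qed

lemma real_polynomial_function_trig_sum:
  assumes "real_polynomial_function p"
  shows "\<exists>L. \<forall>t. complex_of_real (p (cis t)) = trig_sum L t"
  using assms
proof (induction rule: real_polynomial_function.induct)
  case (linear f)
  \<comment> \<open>Euler's formulas applied to \<open>cos t * f 1 + sin t * f \<i>\<close>.\<close>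
  have "complex_of_real (f (cis t)) = trig_sum [((f 1 - \<i> * f \<i>) / 2, 1), ((f 1 + \<i> * f \<i>) / 2, -1)] t" for t
  proof -
    interpret bounded_linear f by fact
    have "f (cis t) = f (cos t *\<^sub>R 1 + sin t *\<^sub>R \<i>)"
      by (intro arg_cong[where f = f] complex_eqI) auto
    then have "f (cis t) = cos t * f 1 + sin t * f \<i>" unfolding add scale by simp
    then show ?thesis by (simp add: trig_sum_def complex_eq_iff field_simps)
  qed
  then show ?case by blast
next
  case (const c)
  show ?case by (rule exI[of _ "[(of_real c, 0)]"]) (simp add: trig_sum_def)
next
  case (add f g)
  then obtain L M where "\<forall>t. complex_of_real (f (cis t)) = trig_sum L t" "\<forall>t. complex_of_real (g (cis t)) = trig_sum M t"
    by blast
  then show ?case by (intro exI[of _ "L @ M"]) (simp add: trig_sum_def)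
next
  case (mult f g)
  then obtain L M where "\<forall>t. complex_of_real (f (cis t)) = trig_sum L t" "\<forall>t. complex_of_real (g (cis t)) = trig_sum M t"
    by blast
  then show ?case using trig_sum_mult[of L M] by simp
qed

lemma cis_int_has_integral:
  "((\<lambda>t. cis (of_int e * t)) has_integral (if e = 0 then 2 * pi else 0)) {0..2*pi}"
proof (cases "e = 0")
  case True
  then show ?thesis using has_integral_const_real[of "1::complex" 0 "2 * pi"] by (simp add: scaleR_conv_of_real)
next
  case False
  have "((\<lambda>t. cis (of_int e * t)) has_integral (cis (of_int e * (2 * pi)) / (\<i> * e) - cis (of_int e * 0) / (\<i> * e))) {0..2*pi}"
  proof (rule fundamental_theorem_of_calculus)
    show "((\<lambda>t. cis (of_int e * t) / (\<i> * e)) has_vector_derivative cis (of_int e * t)) (at t within {0..2 * pi})" for t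
    proof -
      have "((\<lambda>z. exp (\<i> * of_int e * z) / (\<i> * e)) has_field_derivative exp (\<i> * of_int e * of_real t)) (at (of_real t))"
        using False by (auto intro!: derivative_eq_intros)
      then have "((\<lambda>t. exp (\<i> * of_int e * of_real t) / (\<i> * e)) has_vector_derivative exp (\<i> * of_int e * of_real t)) (at t within {0..2 * pi})"
        using has_vector_derivative_real_field by blast
      then show ?thesis by (simp add: cis_conv_exp mult.assoc)
    qed
  qed simp
  moreover have "cis (of_int e * (2 * pi)) = 1"
    using cis_multiple_2pi[of "of_int e"] by (simp add: mult.commute mult.left_commute)
  ultimately show ?thesis using False by simp
qed

text \<open>Weyl's criterion. The means of trigonometric polynomials converge; Stone--Weierstrass transfers
  this to the continuous functions below the indicator of an arc. Lower bounds on the three arcs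
  of a partition are enough, since the proportions add up to at most 1.\<close>

locale weyl_sequence =
  fixes A :: "nat \<Rightarrow> real multiset"
  assumes range: "\<And>l t. t \<in># A l \<Longrightarrow> 0 \<le> t \<and> t < 2 * pi"
    and nonempty: "eventually (\<lambda>l. A l \<noteq> {#}) sequentially"
    and moments: "\<And>k::nat. k \<ge> 1 \<Longrightarrow> (\<lambda>l. (\<Sum>t\<in>#A l. cis (real k * t)) / of_nat (size (A l))) \<longlonglongrightarrow> 0"
begin

lemma int_moments:
  "(\<lambda>l. (\<Sum>t\<in>#A l. cis (of_int e * t)) / of_nat (size (A l))) \<longlonglongrightarrow> (if e = 0 then 1 else 0)"
proof (cases e "0 :: int" rule: linorder_cases)
  case equal
  have "eventually (\<lambda>l. (\<Sum>t\<in>#A l. cis (of_int e * t)) / of_nat (size (A l)) = 1) sequentially"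
    using nonempty by eventually_elim (simp add: equal)
  then show ?thesis using equal by (simp add: tendsto_eventually)
next
  case greater
  then show ?thesis using moments[of "nat e"] by simp
next
  case less
  have "(\<lambda>l. cnj ((\<Sum>t\<in>#A l. cis (real (nat (-e)) * t)) / of_nat (size (A l)))) \<longlonglongrightarrow> cnj 0"
    using less by (intro tendsto_cnj moments) auto
  moreover have "cnj (\<Sum>t\<in>#B. cis (real (nat (-e)) * t)) = (\<Sum>t\<in>#B. cis (of_int e * t))" for B
    using less by (induction B) (auto simp: cis_cnj)
  ultimately show ?thesis using less by simp
qed

lemma trig_sum_mean:
  "\<exists>c::complex. (\<lambda>l. (\<Sum>t\<in>#A l. trig_sum L t) / of_nat (size (A l))) \<longlonglongrightarrow> c \<and>
       (trig_sum L has_integral 2 * pi * c) {0..2*pi}"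
proof (induction L)
  case Nil
  have "trig_sum [] = (\<lambda>_. 0)" by (simp add: trig_sum_def fun_eq_iff)
  then show ?case by (intro exI[of _ 0]) (simp add: has_integral_0)
next
  case (Cons ce L)
  obtain d e where ce: "ce = (d, e)" by force
  from Cons obtain c :: complex where c: "(\<lambda>l. (\<Sum>t\<in>#A l. trig_sum L t) / of_nat (size (A l))) \<longlonglongrightarrow> c"
    "(trig_sum L has_integral 2 * pi * c) {0..2*pi}" by blast
  have T: "trig_sum (ce # L) = (\<lambda>t. d * cis (of_int e * t) + trig_sum L t)"
    by (simp add: fun_eq_iff trig_sum_def ce)
  define b where "b = (if e = 0 then 1 else 0 :: complex)"
  have "(trig_sum (ce # L) has_integral d * (if e = 0 then 2 * pi else 0) + 2 * pi * c) {0..2*pi}"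
    unfolding T by (intro has_integral_add has_integral_mult_right cis_int_has_integral c(2))
  also have "d * (if e = 0 then 2 * pi else 0) + 2 * pi * c = 2 * pi * (d * b + c)"
    by (simp add: b_def algebra_simps)
  finally have 1: "(trig_sum (ce # L) has_integral 2 * pi * (d * b + c)) {0..2*pi}" .
  have "(\<Sum>t\<in>#B. d * cis (of_int e * t) + trig_sum L t) = d * (\<Sum>t\<in>#B. cis (of_int e * t)) + (\<Sum>t\<in>#B. trig_sum L t)" for B
    by (induction B) (auto simp: algebra_simps)
  then have "(\<lambda>l. (\<Sum>t\<in>#A l. trig_sum (ce # L) t) / of_nat (size (A l))) =
     (\<lambda>l. d * ((\<Sum>t\<in>#A l. cis (of_int e * t)) / of_nat (size (A l))) + (\<Sum>t\<in>#A l. trig_sum L t) / of_nat (size (A l)))"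
    unfolding T by (simp add: add_divide_distrib)
  moreover have "\<dots> \<longlonglongrightarrow> d * b + c"
    unfolding b_def by (intro tendsto_intros int_moments c(1))
  ultimately show ?case using 1 by auto
qed

lemma continuous_mean:
  fixes g :: "complex \<Rightarrow> real"
  assumes "continuous_on (sphere 0 1) g" "0 < \<epsilon>"
  shows "eventually (\<lambda>l. integral {0..2*pi} (\<lambda>t. g (cis t)) / (2 * pi) - \<epsilon>
           < (\<Sum>t\<in>#A l. g (cis t)) / size (A l)) sequentially"
proof -
  \<comment> \<open>One third of \<epsilon> pays for replacing g by p in the integral, one for the
    convergence of the means of p, and one for the return from p to g.\<close>
  obtain p where p: "real_polynomial_function p" and gp: "\<And>z. z \<in> sphere 0 1 \<Longrightarrow> \<bar>g z - p z\<bar> < \<epsilon> / 3"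
    using Stone_Weierstrass_real_polynomial_function[of "sphere 0 1" g "\<epsilon> / 3"] assms by auto
  obtain L where L: "\<forall>t. complex_of_real (p (cis t)) = trig_sum L t"
    using real_polynomial_function_trig_sum[OF p] by blast
  obtain c :: complex where c: "(\<lambda>l. (\<Sum>t\<in>#A l. trig_sum L t) / of_nat (size (A l))) \<longlonglongrightarrow> c"
       "(trig_sum L has_integral 2 * pi * c) {0..2*pi}" using trig_sum_mean by blast
  have gp': "\<bar>g (cis t) - p (cis t)\<bar> < \<epsilon> / 3" for t by (rule gp) simp
  have pe: "p (cis t) = Re (trig_sum L t)" for t using L by (metis Re_complex_of_real)
  have "(\<lambda>l. Re ((\<Sum>t\<in>#A l. trig_sum L t) / of_nat (size (A l)))) \<longlonglongrightarrow> Re c"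
    by (intro tendsto_intros c)
  moreover have "Re (\<Sum>t\<in>#B. trig_sum L t) = (\<Sum>t\<in>#B. p (cis t))" for B
    by (induction B) (auto simp: pe)
  ultimately have lim: "(\<lambda>l. (\<Sum>t\<in>#A l. p (cis t)) / size (A l)) \<longlonglongrightarrow> Re c" by simp
  have "((\<lambda>t. p (cis t)) has_integral 2 * pi * Re c) {0..2*pi}"
    using has_integral_linear[OF c(2) bounded_linear_Re] by (simp add: comp_def pe)
  then have pint: "integral {0..2*pi} (\<lambda>t. p (cis t)) = 2 * pi * Re c" "(\<lambda>t. p (cis t)) integrable_on {0..2*pi}"
    by auto
  have "continuous_on {0..2*pi} (g \<circ> cis)"
    by (intro continuous_on_compose continuous_on_subset[OF assms(1)] continuous_intros) auto
  then have gint: "(\<lambda>t. g (cis t)) integrable_on {0..2*pi}"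
    by (simp add: comp_def integrable_continuous_interval)
  have "integral {0..2*pi} (\<lambda>t. g (cis t)) \<le> integral {0..2*pi} (\<lambda>t. p (cis t) + \<epsilon> / 3)"
  proof (rule integral_le[OF gint])
    show "(\<lambda>t. p (cis t) + \<epsilon> / 3) integrable_on {0..2 * pi}"
      using pint(2) by (intro integrable_add) auto
    show "g (cis t) \<le> p (cis t) + \<epsilon> / 3" for t using gp'[of t] by linarith
  qed
  also have "\<dots> = 2 * pi * Re c + 2 * pi * (\<epsilon> / 3)"
    using pint by (subst integral_add) auto
  finally have 1: "integral {0..2*pi} (\<lambda>t. g (cis t)) / (2 * pi) \<le> Re c + \<epsilon> / 3"
    by (simp add: field_simps)
  have "eventually (\<lambda>l. Re c - \<epsilon> / 3 < (\<Sum>t\<in>#A l. p (cis t)) / size (A l)) sequentially"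
    using order_tendstoD(1)[OF lim] assms(2) by simp
  with nonempty show ?thesis
  proof eventually_elim
    case (elim l)
    have "(\<Sum>t\<in>#A l. p (cis t)) \<le> (\<Sum>t\<in>#A l. g (cis t) + \<epsilon> / 3)"
      by (intro sum_mset_mono) (smt (verit) gp')
    also have "\<dots> = (\<Sum>t\<in>#A l. g (cis t)) + size (A l) * (\<epsilon> / 3)" by (simp add: sum_mset.distrib)
    finally have "(\<Sum>t\<in>#A l. p (cis t)) / size (A l) \<le> (\<Sum>t\<in>#A l. g (cis t)) / size (A l) + \<epsilon> / 3"
      using elim(1) size_eq_0_iff_empty[of "A l"] by (simp add: divide_simps) (simp add: algebra_simps)
    with elim(2) 1 show ?case by simp
  qed
qed

lemma open_arc_mean:
  assumes "0 \<le> \<alpha>" "\<alpha> \<le> \<beta>" "\<beta> \<le> 2 * pi" "0 < \<epsilon>"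
  shows "eventually (\<lambda>l. (\<beta> - \<alpha>) / (2 * pi) - \<epsilon>
      < real (size (filter_mset (\<lambda>t. \<alpha> < t \<and> t < \<beta>) (A l))) / size (A l)) sequentially"
proof -
  \<comment> \<open>\<open>g N\<close> is a continuous ramp that vanishes on the complementary arc C
    and increases with N to the indicator of the open arc. It is defined on the circle, so that
    Stone-Weierstrass applies. C is never empty, since the angle 0 lies outside the open
    interval.\<close>
  define C where "C = cis ` ({0..2*pi} - {\<alpha><..<\<beta>})"
  define g where "g = (\<lambda>N::nat. \<lambda>z. min 1 (real N * infdist z C))"
  have "compact C" unfolding C_def
    by (intro compact_continuous_image continuous_intros compact_diff) auto
  then have "closed C" by (rule compact_imp_closed)
  have "cis 0 \<in> C" unfolding C_def using assms by (intro imageI) auto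
  then have "C \<noteq> {}" by auto
  have cont: "continuous_on S (g N)" for S N unfolding g_def by (intro continuous_intros)
  \<comment> \<open>Angles with the same \<open>cis\<close> differ by a multiple of 2 pi, but a
    point of the open arc is less than 2 pi away from every point of the closed interval.\<close>
  have notin: "cis t \<notin> C" if "\<alpha> < t" "t < \<beta>" for t
  proof
    assume "cis t \<in> C"
    then obtain s where s: "0 \<le> s" "s \<le> 2 * pi" "s \<le> \<alpha> \<or> \<beta> \<le> s" "cis t = cis s"
      unfolding C_def by auto
    then obtain n :: int where n: "t = s + 2 * n * pi"
      using sin_cos_eq_iff[of t s] by (auto simp: cis.ctr complex_eq_iff)
    have "\<bar>t - s\<bar> < 2 * pi" using that assms s by linarith
    then have "\<bar>2 * pi * n\<bar> < 2 * pi" using n by (simp add: algebra_simps)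
    then have "\<bar>real_of_int n\<bar> < 1" by (simp add: abs_mult)
    then have "n = 0" by linarith
    then show False using n s that by auto
  qed
  define i where "i = (\<lambda>t::real. if t \<in> {\<alpha><..<\<beta>} then 1 else 0 :: real)"
  have ptw: "(\<lambda>N. g N (cis t)) \<longlonglongrightarrow> i t" if "t \<in> {0..2*pi}" for t
  proof (cases "t \<in> {\<alpha><..<\<beta>}")
    case True
    have "infdist (cis t) C > 0" using notin[of t] True \<open>closed C\<close> \<open>C \<noteq> {}\<close>
      by (simp add: infdist_pos_not_in_closed)
    then have "eventually (\<lambda>N. 1 \<le> real N * infdist (cis t) C) sequentially"
      by real_asymp
    then have "eventually (\<lambda>N. g N (cis t) = i t) sequentially"
      by eventually_elim (use True in \<open>auto simp: g_def i_def\<close>)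
    then show ?thesis by (rule tendsto_eventually)
  next
    case False
    then have "cis t \<in> C" using that unfolding C_def by auto
    then have "g N (cis t) = 0" for N by (simp add: g_def)
    moreover have "i t = 0" using False by (simp add: i_def)
    ultimately show ?thesis by simp
  qed
  have "(\<lambda>N. integral {0..2*pi} (\<lambda>t. g N (cis t))) \<longlonglongrightarrow> integral {0..2*pi} i"
  proof (rule dominated_convergence(2)[where h = "\<lambda>_. 1"])
    show "(\<lambda>t. g N (cis t)) integrable_on {0..2 * pi}" for N
    proof -
      have "continuous_on {0..2*pi} (g N \<circ> cis)"
        by (intro continuous_on_compose cont continuous_intros)
      then show ?thesis by (simp add: comp_def integrable_continuous_interval)
    qed
    show "norm (g N (cis t)) \<le> 1" for N t by (simp add: g_def infdist_nonneg)
  qed (use ptw in auto)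
  also have "integral {0..2*pi} i = \<beta> - \<alpha>"
  proof (rule integral_unique)
    have "((\<lambda>_. 1::real) has_integral (\<beta> - \<alpha>)) {\<alpha><..<\<beta>}"
      using has_integral_const_real[of "1::real" \<alpha> \<beta>] assms by (simp add: has_integral_Icc_iff_Ioo)
    then show "(i has_integral (\<beta> - \<alpha>)) {0..2*pi}"
      unfolding i_def using assms by (subst has_integral_restrict) auto
  qed
  finally have "eventually (\<lambda>N. integral {0..2*pi} (\<lambda>t. g N (cis t)) > (\<beta> - \<alpha>) - \<epsilon>) sequentially"
    using assms(4) by (intro order_tendstoD(1)) auto
  then obtain N where N: "integral {0..2*pi} (\<lambda>t. g N (cis t)) > (\<beta> - \<alpha>) - \<epsilon>"
    unfolding eventually_sequentially by blast
  have "\<epsilon> / (2 * pi) \<le> \<epsilon> / 2" using assms(4) pi_gt3 by (intro divide_left_mono) auto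
  then have below: "(\<beta> - \<alpha>) / (2 * pi) - \<epsilon> / 2 < integral {0..2*pi} (\<lambda>t. g N (cis t)) / (2 * pi)"
    using divide_strict_right_mono[OF N, of "2 * pi"] by (simp add: diff_divide_distrib)
  have "eventually (\<lambda>l. integral {0..2*pi} (\<lambda>t. g N (cis t)) / (2 * pi) - \<epsilon> / 2
           < (\<Sum>t\<in>#A l. g N (cis t)) / size (A l)) sequentially"
    using assms(4) by (intro continuous_mean cont) auto
  then have "eventually (\<lambda>l. (\<beta> - \<alpha>) / (2 * pi) - \<epsilon> < (\<Sum>t\<in>#A l. g N (cis t)) / size (A l)) sequentially"
    by eventually_elim (use below in linarith)
  then show ?thesis
  proof eventually_elim
    case (elim l)
    have "(\<Sum>t\<in>#A l. g N (cis t)) \<le> (\<Sum>t\<in>#A l. if \<alpha> < t \<and> t < \<beta> then 1 else 0)"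
    proof (rule sum_mset_mono)
      fix t assume "t \<in># A l"
      then have "t \<in> {0..2*pi}" using range by fastforce
      then have "cis t \<in> C" if "\<not> (\<alpha> < t \<and> t < \<beta>)" using that unfolding C_def by auto
      then show "g N (cis t) \<le> (if \<alpha> < t \<and> t < \<beta> then 1 else 0)" by (auto simp: g_def)
    qed
    also have "(\<Sum>t\<in>#B. if \<alpha> < t \<and> t < \<beta> then 1 else 0) = real (size (filter_mset (\<lambda>t. \<alpha> < t \<and> t < \<beta>) B))" for B
      by (induction B) auto
    finally have "(\<Sum>t\<in>#A l. g N (cis t)) / size (A l) \<le> real (size (filter_mset (\<lambda>t. \<alpha> < t \<and> t < \<beta>) (A l))) / size (A l)"
      by (intro divide_right_mono) auto
    with elim show ?case by simp
  qed
qed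

lemma arc_proportion:
  assumes "0 \<le> \<theta>" "\<theta> < \<phi>" "\<phi> < 2 * pi"
  shows "(\<lambda>l. real (size (filter_mset (\<lambda>t. \<theta> < t \<and> t \<le> \<phi>) (A l))) / size (A l))
    \<longlonglongrightarrow> (\<phi> - \<theta>) / (2 * pi)"
proof (rule LIMSEQ_I)
  fix \<epsilon> :: real assume "0 < \<epsilon>"
  have sizes: "real (size (filter_mset (\<lambda>t. \<theta> < t \<and> t < \<phi>) B)) \<le> size (filter_mset (\<lambda>t. \<theta> < t \<and> t \<le> \<phi>) B)"
    "real (size (filter_mset (\<lambda>t. \<theta> < t \<and> t \<le> \<phi>) B)) \<le> real (size B) - size (filter_mset (\<lambda>t. 0 < t \<and> t < \<theta>) B) -
       size (filter_mset (\<lambda>t. \<phi> < t \<and> t < 2 * pi) B)" for B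
    using assms by (induction B) auto
  note arcs = open_arc_mean[of \<theta> \<phi> \<epsilon>] open_arc_mean[of 0 \<theta> "\<epsilon> / 2"] open_arc_mean[of \<phi> "2 * pi" "\<epsilon> / 2"]
  have arcs: "eventually (\<lambda>l. (\<phi> - \<theta>) / (2 * pi) - \<epsilon>
      < real (size (filter_mset (\<lambda>t. \<theta> < t \<and> t < \<phi>) (A l))) / size (A l)) sequentially"
    "eventually (\<lambda>l. \<theta> / (2 * pi) - \<epsilon> / 2
      < real (size (filter_mset (\<lambda>t. 0 < t \<and> t < \<theta>) (A l))) / size (A l)) sequentially"
    "eventually (\<lambda>l. (2 * pi - \<phi>) / (2 * pi) - \<epsilon> / 2
      < real (size (filter_mset (\<lambda>t. \<phi> < t \<and> t < 2 * pi) (A l))) / size (A l)) sequentially"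
    using arcs assms \<open>0 < \<epsilon>\<close> by auto
  have "eventually (\<lambda>l. \<bar>real (size (filter_mset (\<lambda>t. \<theta> < t \<and> t \<le> \<phi>) (A l))) / size (A l) - (\<phi> - \<theta>) / (2 * pi)\<bar> < \<epsilon>) sequentially"
    using nonempty arcs
  proof eventually_elim
    case (elim l)
    let ?n = "real (size (A l))"
    have n: "?n > 0" using elim(1) by (simp add: size_eq_0_iff_empty[symmetric] del: size_eq_0_iff_empty)
    have a: "real (size (filter_mset (\<lambda>t. \<theta> < t \<and> t < \<phi>) (A l))) / ?n \<le> size (filter_mset (\<lambda>t. \<theta> < t \<and> t \<le> \<phi>) (A l)) / ?n"
      using sizes(1)[of "A l"] by (intro divide_right_mono) auto
    have b: "real (size (filter_mset (\<lambda>t. \<theta> < t \<and> t \<le> \<phi>) (A l))) / ?n \<le> 1 - size (filter_mset (\<lambda>t. 0 < t \<and> t < \<theta>) (A l)) / ?n -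
       size (filter_mset (\<lambda>t. \<phi> < t \<and> t < 2 * pi) (A l)) / ?n"
      using divide_right_mono[OF sizes(2)[of "A l"], of ?n] n by (simp add: diff_divide_distrib split: if_splits)
    have c: "(2 * pi - \<phi>) / (2 * pi) = 1 - \<phi> / (2 * pi)" "(\<phi> - \<theta>) / (2 * pi) = \<phi> / (2 * pi) - \<theta> / (2 * pi)"
      by (simp_all add: diff_divide_distrib)
    show ?case using elim(2-) a b unfolding c by simp
  qed
  then show "\<exists>no. \<forall>n\<ge>no. norm (real (size (filter_mset (\<lambda>t. \<theta> < t \<and> t \<le> \<phi>) (A n))) / size (A n) - (\<phi> - \<theta>) / (2 * pi)) < \<epsilon>"
    by (simp add: eventually_sequentially)
qed

end

subsection \<open>The Jentzsch--Szego theorem\<close>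

text \<open>All three estimates are asked for only up to factors
  \<open>exp (\<epsilon> * degree)\<close>. \<open>lower\<close> takes the place of the nonzero
  constant term in the classical theorem. Its point may move with l inside a fixed smaller disc,
  because for the Pade denominators only the maximum over a disc is controlled.\<close>

locale jentzsch_szego =
  fixes Q :: "nat \<Rightarrow> complex poly" and \<rho> R :: real
  assumes radii: "0 < \<rho>" "\<rho> < R"
    and degrees: "filterlim (\<lambda>l. degree (Q l)) at_top sequentially"
    and upper: "\<And>\<epsilon>::real. \<epsilon> > 0 \<Longrightarrow> eventually (\<lambda>l. \<forall>z. cmod z = R \<longrightarrow> cmod (poly (Q l) z) \<le> exp (\<epsilon> * degree (Q l))) sequentially"
    and leading: "\<And>\<epsilon>::real. \<epsilon> > 0 \<Longrightarrow> eventually (\<lambda>l. exp (- \<epsilon> * degree (Q l)) \<le> cmod (lead_coeff (Q l)) * R ^ degree (Q l)) sequentially"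
    and lower: "\<And>\<epsilon>::real. \<epsilon> > 0 \<Longrightarrow> eventually (\<lambda>l. \<exists>z. cmod z \<le> \<rho> \<and> exp (- \<epsilon> * degree (Q l)) \<le> cmod (poly (Q l) z)) sequentially"
begin

definition proportion :: "(complex \<Rightarrow> bool) \<Rightarrow> nat \<Rightarrow> real" where
  "proportion P l = real (size (filter_mset P (proots (Q l)))) / real (degree (Q l))"

lemma degree_pos: "eventually (\<lambda>l. degree (Q l) > 0) sequentially"
  using degrees eventually_gt_at_top by (rule eventually_compose_filterlim[rotated])

lemma R_pos: "R > 0" using radii by simp

lemma proportion_tendsto_0:
  assumes "c > 1"
    and ev: "\<And>\<epsilon>::real. \<epsilon> > 0 \<Longrightarrow> eventually (\<lambda>l. exp (- \<epsilon> * degree (Q l)) * c ^ size (filter_mset P (proots (Q l))) \<le> exp (\<epsilon> * degree (Q l))) sequentially"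
  shows "proportion P \<longlonglongrightarrow> 0"
proof (rule LIMSEQ_I)
  fix \<eta> :: real assume "\<eta> > 0"
  have "ln c > 0" using \<open>c > 1\<close> by simp
  \<comment> \<open>Logarithms give \<open>?N * ln c \<le> 2 * \<epsilon> * ?n\<close>; with this
    choice the right side is \<open>\<eta> / 2 * ?n * ln c\<close>.\<close>
  define \<epsilon> where "\<epsilon> = \<eta> * ln c / 4"
  have "\<epsilon> > 0" using \<open>\<eta> > 0\<close> \<open>ln c > 0\<close> by (simp add: \<epsilon>_def)
  from ev[OF this] degree_pos have "eventually (\<lambda>l. norm (proportion P l - 0) < \<eta>) sequentially"
  proof eventually_elim
    case (elim l)
    let ?n = "real (degree (Q l))" and ?N = "size (filter_mset P (proots (Q l)))"
    have "ln (exp (- \<epsilon> * ?n) * c ^ ?N) \<le> ln (exp (\<epsilon> * ?n))"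
      using elim(1) \<open>c > 1\<close> by (intro ln_mono) auto
    then have "?N * ln c \<le> 2 * \<epsilon> * ?n" using \<open>c > 1\<close> by (simp add: ln_mult ln_realpow)
    then have "?N * ln c \<le> (\<eta> / 2 * ?n) * ln c" by (simp add: \<epsilon>_def mult_ac)
    then have "real ?N \<le> \<eta> / 2 * ?n" using \<open>ln c > 0\<close> by (rule mult_right_le_imp_le)
    also have "\<dots> < \<eta> * ?n" using \<open>\<eta> > 0\<close> elim(2) by simp
    finally show ?case using elim(2) by (simp add: proportion_def field_simps)
  qed
  then show "\<exists>no. \<forall>n\<ge>no. norm (proportion P n - 0) < \<eta>" by (simp add: eventually_sequentially)
qed

lemma proportion_mono: "(\<And>w. P w \<Longrightarrow> P' w) \<Longrightarrow> proportion P l \<le> proportion P' l"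
proof -
  assume "\<And>w. P w \<Longrightarrow> P' w"
  then have "size (filter_mset P W) \<le> size (filter_mset P' W)" for W by (induction W) auto
  then show ?thesis unfolding proportion_def by (intro divide_right_mono of_nat_mono) auto
qed

lemma proportion_inside:
  assumes "\<rho>' < R"
  shows "proportion (\<lambda>w. cmod w \<le> \<rho>') \<longlonglongrightarrow> 0"
proof -
  \<comment> \<open>The disc must hold both the zeros being counted and the point supplied by
    \<open>lower\<close>. The base c exceeds 1 because \<open>(R - r)^2 > 0\<close>.\<close>
  define r where "r = max \<rho> \<rho>'"
  have r: "0 < r" "r < R" "\<rho> \<le> r" using radii assms by (auto simp: r_def)
  define c where "c = (R\<^sup>2 + r\<^sup>2) / (2 * r * R)"
  have "0 < (R - r)\<^sup>2" using r by simp
  then have "c > 1" using r R_pos by (simp add: c_def field_simps power2_eq_square)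
  have "proportion (\<lambda>w. cmod w \<le> r) \<longlonglongrightarrow> 0"
  proof (rule proportion_tendsto_0[OF \<open>c > 1\<close>])
    fix \<epsilon> :: real assume "\<epsilon> > 0"
    from upper[OF this] lower[OF this]
    show "eventually (\<lambda>l. exp (- \<epsilon> * degree (Q l)) * c ^ size (filter_mset (\<lambda>w. cmod w \<le> r) (proots (Q l))) \<le> exp (\<epsilon> * degree (Q l))) sequentially"
    proof eventually_elim
      case (elim l)
      let ?N = "size (filter_mset (\<lambda>w. cmod w \<le> r) (proots (Q l)))"
      from elim obtain z where z: "cmod z \<le> \<rho>" "exp (- \<epsilon> * degree (Q l)) \<le> cmod (poly (Q l) z)" by blast
      note z(2)
      also have "cmod (poly (Q l) z) \<le> exp (\<epsilon> * degree (Q l)) * (2 * r * R / (R\<^sup>2 + r\<^sup>2)) ^ ?N"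
        using elim z r by (intro zeros_inside_bound) auto
      also have "2 * r * R / (R\<^sup>2 + r\<^sup>2) = 1 / c" by (simp add: c_def)
      finally show ?case using \<open>c > 1\<close> by (simp add: field_simps)
    qed
  qed
  then show ?thesis
    by (rule tendsto_sandwich[OF _ _ tendsto_const, rotated 2])
      (auto intro!: always_eventually proportion_mono simp: r_def, simp add: proportion_def)
qed

lemma proportion_outside:
  assumes "\<delta> > 0"
  shows "proportion (\<lambda>w. cmod w \<ge> (1 + \<delta>) * R) \<longlonglongrightarrow> 0"
proof (rule proportion_tendsto_0[where c = "1 + \<delta>"])
  fix \<epsilon> :: real assume "\<epsilon> > 0"
  from upper[OF this] leading[OF this]
  show "eventually (\<lambda>l. exp (- \<epsilon> * degree (Q l)) * (1 + \<delta>) ^ size (filter_mset (\<lambda>w. cmod w \<ge> (1 + \<delta>) * R) (proots (Q l))) \<le> exp (\<epsilon> * degree (Q l))) sequentially"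
  proof eventually_elim
    case (elim l)
    let ?N = "size (filter_mset (\<lambda>w. cmod w \<ge> (1 + \<delta>) * R) (proots (Q l)))"
    have "exp (- \<epsilon> * degree (Q l)) * (1 + \<delta>) ^ ?N \<le> cmod (lead_coeff (Q l)) * R ^ degree (Q l) * (1 + \<delta>) ^ ?N"
      using elim assms by (intro mult_right_mono) auto
    also have "\<dots> \<le> exp (\<epsilon> * degree (Q l))"
      using elim assms R_pos by (intro zeros_outside_bound) auto
    finally show ?case .
  qed
qed (use assms in auto)

lemma annulus_proportion:
  assumes "\<delta> > 0"
  shows "proportion (\<lambda>w. (1 - \<delta>) * R < cmod w \<and> cmod w < (1 + \<delta>) * R) \<longlonglongrightarrow> 1"
proof -
  let ?P = "\<lambda>w. (1 - \<delta>) * R < cmod w \<and> cmod w < (1 + \<delta>) * R"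
  let ?in = "\<lambda>w. cmod w \<le> (1 - \<delta>) * R" and ?out = "\<lambda>w. cmod w \<ge> (1 + \<delta>) * R"
  have "(1 - \<delta>) * R < R" using assms R_pos by simp
  then have "(\<lambda>l. 1 - proportion ?in l - proportion ?out l) \<longlonglongrightarrow> 1 - 0 - 0"
    by (intro tendsto_diff tendsto_const proportion_inside proportion_outside assms)
  moreover have "eventually (\<lambda>l. proportion ?P l = 1 - proportion ?in l - proportion ?out l) sequentially"
    using degree_pos
  proof eventually_elim
    case (elim l)
    have "(1 - \<delta>) * R < (1 + \<delta>) * R" using assms R_pos by (intro mult_strict_right_mono) auto
    then have "size (filter_mset ?P W) + size (filter_mset ?in W) + size (filter_mset ?out W) = size W" for W
      by (induction W) auto
    from arg_cong[OF this[of "proots (Q l)"], of "\<lambda>n. real n / degree (Q l)"] elim show ?case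
      unfolding size_proots_complex proportion_def by (simp add: add_divide_distrib)
  qed
  ultimately show ?thesis by (simp add: tendsto_cong)
qed

text \<open>The product over all zeros is the reversed polynomial divided by the leading
  coefficient; on \<open>cmod \<zeta> = 1 / R\<close> its modulus is that of Q at
  \<open>1 / \<zeta>\<close> divided by \<open>cmod (lead_coeff Q) * R ^ degree Q\<close>, hence
  subexponential. A zero far outside contributes a factor of modulus at least d, and such zeros are
  so few that dividing them out costs little. The maximum principle carries the bound from the
  circle into the disc.\<close>

lemma reversed_product_bound:
  fixes d \<epsilon> :: real
  assumes "0 < d" "d \<le> 1" "0 < \<epsilon>"
  shows "eventually (\<lambda>l. \<forall>\<zeta>. cmod \<zeta> \<le> 1 / R \<longrightarrow>
    cmod (\<Prod>w\<in>#filter_mset (\<lambda>w. \<not> cmod w \<ge> (1 + d) * R) (proots (Q l)). 1 - w * \<zeta>) < exp (\<epsilon> * degree (Q l))) sequentially"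
proof -
  let ?out = "\<lambda>w. cmod w \<ge> (1 + d) * R"
  \<comment> \<open>With fewer than \<open>\<delta> * ?n\<close> far zeros, the product of their
    factors is at least \<open>exp (- (\<epsilon> / 4 * ?n))\<close>. The added 1 keeps the
    denominator positive when d = 1.\<close>
  define \<delta> where "\<delta> = \<epsilon> / 4 / (ln (1 / d) + 1)"
  have ld: "ln (1 / d) \<ge> 0" using assms by simp
  have "\<delta> > 0" "\<epsilon> / 4 > 0" using assms add_nonneg_pos[OF ld zero_less_one] unfolding \<delta>_def by simp_all
  have "eventually (\<lambda>l. proportion ?out l < \<delta>) sequentially"
    using order_tendstoD(2)[OF proportion_outside[OF \<open>0 < d\<close>]] \<open>\<delta> > 0\<close> by simp
  with upper[OF \<open>\<epsilon> / 4 > 0\<close>] leading[OF \<open>\<epsilon> / 4 > 0\<close>] degree_pos show ?thesis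
  proof eventually_elim
    case (elim l)
    let ?W = "proots (Q l)" and ?n = "degree (Q l)"
    let ?V = "filter_mset (\<lambda>w. \<not> ?out w) ?W" and ?N = "size (filter_mset ?out ?W)"
    have n: "real ?n > 0" using elim by simp
    \<comment> \<open>The three quarters come from the upper bound on Q, the leading coefficient and
      the removed factors.\<close>
    have circle: "cmod (\<Prod>w\<in>#?V. 1 - w * \<zeta>) \<le> exp (3 / 4 * \<epsilon> * ?n)" if \<zeta>: "cmod \<zeta> = 1 / R" for \<zeta>
    proof -
      have "\<zeta> \<noteq> 0" using \<zeta> R_pos by auto
      have "cmod (inverse \<zeta>) = R" using \<zeta> by (simp add: norm_inverse)
      have rev: "(\<Prod>w\<in>#B. inverse \<zeta> - w) = inverse \<zeta> ^ size B * (\<Prod>w\<in>#B. 1 - w * \<zeta>)" for B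
        using \<open>\<zeta> \<noteq> 0\<close> by (induction B) (auto simp: field_simps)
      have "cmod (lead_coeff (Q l)) * R ^ ?n * cmod (\<Prod>w\<in>#?W. 1 - w * \<zeta>) = cmod (poly (Q l) (inverse \<zeta>))"
        unfolding poly_eq_prod_proots rev size_proots_complex norm_mult norm_power \<open>cmod (inverse \<zeta>) = R\<close> by simp
      also have "\<dots> \<le> exp (\<epsilon> / 4 * ?n)" using elim(1) \<open>cmod (inverse \<zeta>) = R\<close> by blast
      finally have 1: "cmod (lead_coeff (Q l)) * R ^ ?n * cmod (\<Prod>w\<in>#?W. 1 - w * \<zeta>) \<le> exp (\<epsilon> / 4 * ?n)" .
      have "exp (- (\<epsilon> / 4) * ?n) * cmod (\<Prod>w\<in>#?W. 1 - w * \<zeta>)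
          \<le> cmod (lead_coeff (Q l)) * R ^ ?n * cmod (\<Prod>w\<in>#?W. 1 - w * \<zeta>)"
        using elim(2) by (intro mult_right_mono) auto
      with 1 have all: "exp (- (\<epsilon> / 4) * ?n) * cmod (\<Prod>w\<in>#?W. 1 - w * \<zeta>) \<le> exp (\<epsilon> / 4 * ?n)" by linarith
      have outer: "d ^ size B \<le> cmod (\<Prod>w\<in>#B. 1 - w * \<zeta>)" if "\<And>w. w \<in># B \<Longrightarrow> ?out w" for B
        using that
      proof (induction B)
        case (add w B)
        have "1 + d \<le> cmod w / R" using add.prems[of w] R_pos by (simp add: field_simps)
        also have "\<dots> \<le> 1 + cmod (1 - w * \<zeta>)"
          using norm_triangle_ineq2[of "w * \<zeta>" 1] \<zeta> by (simp add: norm_mult norm_minus_commute)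
        finally have "d \<le> cmod (1 - w * \<zeta>)" by simp
        moreover have "d ^ size B \<le> cmod (\<Prod>w\<in>#B. 1 - w * \<zeta>)" using add by auto
        ultimately show ?case using assms by (auto simp: norm_mult intro!: mult_mono)
      qed auto
      have "ln (1 / d) * ?N \<le> \<epsilon> / 4 * ?n"
      proof -
        have "?N \<le> \<delta> * ?n" using elim(4) n by (simp add: proportion_def field_simps)
        then have "ln (1 / d) * ?N \<le> ln (1 / d) * (\<delta> * ?n)" using ld by (intro mult_left_mono) auto
        also have "\<dots> = (ln (1 / d) / (ln (1 / d) + 1)) * (\<epsilon> / 4 * ?n)" by (simp add: \<delta>_def)
        also have "\<dots> \<le> 1 * (\<epsilon> / 4 * ?n)"
        proof (rule mult_right_mono)
          have "x / (x + 1) \<le> 1" if "x \<ge> 0" for x :: real using that by (simp add: field_simps)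
          then show "ln (1 / d) / (ln (1 / d) + 1) \<le> 1" using ld .
        qed (use assms in auto)
        finally show ?thesis by simp
      qed
      then have "exp (- (\<epsilon> / 4 * ?n)) \<le> exp (- (ln (1 / d) * ?N))" by simp
      also have "\<dots> = d ^ ?N" using assms by (simp add: ln_div exp_of_nat2_mult)
      also have "\<dots> \<le> cmod (\<Prod>w\<in>#filter_mset ?out ?W. 1 - w * \<zeta>)" by (rule outer) auto
      finally have 2: "exp (- (\<epsilon> / 4 * ?n)) \<le> cmod (\<Prod>w\<in>#filter_mset ?out ?W. 1 - w * \<zeta>)" .
      have "cmod (\<Prod>w\<in>#?W. 1 - w * \<zeta>) = cmod (\<Prod>w\<in>#filter_mset ?out ?W. 1 - w * \<zeta>) * cmod (\<Prod>w\<in>#?V. 1 - w * \<zeta>)"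
        by (subst prod_mset_filter_split[of _ _ ?out]) (rule norm_mult)
      also have "\<dots> \<ge> exp (- (\<epsilon> / 4 * ?n)) * cmod (\<Prod>w\<in>#?V. 1 - w * \<zeta>)"
        using 2 by (intro mult_right_mono) auto
      finally have "exp (- (\<epsilon> / 4) * ?n) * (exp (- (\<epsilon> / 4 * ?n)) * cmod (\<Prod>w\<in>#?V. 1 - w * \<zeta>)) \<le> exp (\<epsilon> / 4 * ?n)"
        using all by (meson exp_ge_zero mult_left_mono order_trans)
      then have "exp (3 / 4 * \<epsilon> * ?n) * (exp (- (\<epsilon> / 4) * ?n) * (exp (- (\<epsilon> / 4 * ?n)) * cmod (\<Prod>w\<in>#?V. 1 - w * \<zeta>)))
          \<le> exp (3 / 4 * \<epsilon> * ?n) * exp (\<epsilon> / 4 * ?n)" by (rule mult_left_mono) simp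
      then have "exp (3 / 4 * \<epsilon> * ?n) * (exp (- (\<epsilon> / 4) * ?n) * exp (- (\<epsilon> / 4 * ?n))) * cmod (\<Prod>w\<in>#?V. 1 - w * \<zeta>)
          \<le> exp (\<epsilon> / 4 * ?n) * exp (3 / 4 * \<epsilon> * ?n)" by (simp only: mult.assoc mult.commute[of "exp (\<epsilon> / 4 * ?n)"])
      moreover have "exp (3 / 4 * \<epsilon> * ?n) * (exp (- (\<epsilon> / 4) * ?n) * exp (- (\<epsilon> / 4 * ?n))) = exp (\<epsilon> / 4 * ?n)"
        unfolding exp_add[symmetric] by (rule arg_cong[where f = exp]) (simp add: field_simps)
      ultimately have "exp (\<epsilon> / 4 * ?n) * cmod (\<Prod>w\<in>#?V. 1 - w * \<zeta>) \<le> exp (\<epsilon> / 4 * ?n) * exp (3 / 4 * \<epsilon> * ?n)"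
        by (simp only:)
      then show ?thesis by simp
    qed
    show ?case
    proof (intro allI impI)
      fix \<zeta> :: complex assume "cmod \<zeta> \<le> 1 / R"
      then have "cmod (\<Prod>w\<in>#?V. 1 - w * \<zeta>) \<le> exp (3 / 4 * \<epsilon> * ?n)"
      proof (rule max_modulus_disc[where f = "\<lambda>\<zeta>. \<Prod>w\<in>#?V. 1 - w * \<zeta>" and S = "1 / R + 1", rotated 2])
        show "(\<lambda>\<zeta>. \<Prod>w\<in>#?V. 1 - w * \<zeta>) holomorphic_on ball 0 (1 / R + 1)"
          by (intro holomorphic_on_prod_mset holomorphic_intros)
        show "cmod (\<Prod>w\<in>#?V. 1 - w * z) \<le> exp (3 / 4 * \<epsilon> * ?n)" if "cmod z = 1 / R" for z
          using that by (rule circle)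
      qed simp_all
      also have "\<dots> < exp (\<epsilon> * ?n)" using assms n by simp
      finally show "cmod (\<Prod>w\<in>#?V. 1 - w * \<zeta>) < exp (\<epsilon> * ?n)" .
    qed
  qed
qed

lemma power_means_inside:
  assumes "0 < d" "d \<le> 1" "k \<ge> 1"
  shows "(\<lambda>l. (\<Sum>w\<in>#filter_mset (\<lambda>w. \<not> cmod w \<ge> (1 + d) * R) (proots (Q l)). (w / R) ^ k) / of_nat (degree (Q l))) \<longlonglongrightarrow> 0"
    (is "?f \<longlonglongrightarrow> 0")
proof (rule LIMSEQ_I)
  fix \<eta> :: real assume "\<eta> > 0"
  let ?V = "\<lambda>l. filter_mset (\<lambda>w. \<not> cmod w \<ge> (1 + d) * R) (proots (Q l))"
  define L where "L = (1 + d) * R"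
  \<comment> \<open>Everything in \<open>power_sum_bound\<close> that does not depend on l, after
    division by \<open>R ^ k\<close>.\<close>
  define c where "c = real k * 2 * (2 * L / R) ^ k"
  have L: "L > 0" "R \<le> L" using assms R_pos by (simp_all add: L_def)
  have c: "c > 0" using assms L R_pos by (simp add: c_def)
  define \<epsilon> where "\<epsilon> = \<eta> / (2 * c)"
  have "\<epsilon> > 0" using \<open>\<eta> > 0\<close> c by (simp add: \<epsilon>_def)
  from reversed_product_bound[OF assms(1,2) this] degree_pos
  have "eventually (\<lambda>l. norm (?f l - 0) < \<eta>) sequentially"
  proof eventually_elim
    case (elim l)
    have "cmod (\<Sum>w\<in>#?V l. w ^ k) \<le> real k * (2 * (\<epsilon> * degree (Q l))) * (2 * L) ^ k"
    proof (rule power_sum_bound[OF \<open>L > 0\<close> _ \<open>k \<ge> 1\<close>])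
      show "cmod (\<Prod>w\<in>#?V l. 1 - w * \<zeta>) < exp (\<epsilon> * degree (Q l))" if "cmod \<zeta> < 1 / L" for \<zeta>
      proof -
        have "1 / L \<le> 1 / R" using L R_pos by (simp add: field_simps)
        then show ?thesis using elim(1) that by auto
      qed
    qed (auto simp: L_def)
    moreover have "(\<Sum>w\<in>#?V l. (w / R) ^ k) = (\<Sum>w\<in>#?V l. w ^ k) / of_real R ^ k"
      by (simp only: power_divide sum_mset_distrib_right divide_inverse power_mult_distrib power_inverse)
    ultimately have "cmod (\<Sum>w\<in>#?V l. (w / R) ^ k) \<le> real k * (2 * (\<epsilon> * degree (Q l))) * (2 * L) ^ k / R ^ k"
      using R_pos by (simp add: norm_divide norm_power divide_right_mono)
    also have "\<dots> = c * \<epsilon> * degree (Q l)" by (simp add: c_def power_divide)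
    also have "\<dots> = \<eta> / 2 * degree (Q l)" using c by (simp add: \<epsilon>_def)
    also have "\<dots> < \<eta> * degree (Q l)" using elim(2) \<open>\<eta> > 0\<close> by simp
    finally show ?case using elim(2) by (simp add: norm_divide field_simps)
  qed
  then show "\<exists>no. \<forall>n\<ge>no. norm (?f n - 0) < \<eta>" by (simp add: eventually_sequentially)
qed

text \<open>\<open>cis (real k * Arg2pi w)\<close> is compared with \<open>(w / R) ^ k\<close>,
  whose mean is already known to vanish in the limit. Close to the circle the two differ by
  \<open>\<bar>(cmod w / R) ^ k - 1\<bar>\<close>; a zero inside costs at most 2 and a zero outside
  at most 1, and both kinds have vanishing proportion.\<close>

lemma argument_means:
  assumes "k \<ge> 1"
  shows "(\<lambda>l. (\<Sum>w\<in>#proots (Q l). cis (real k * Arg2pi w)) / of_nat (degree (Q l))) \<longlonglongrightarrow> 0"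
    (is "?f \<longlonglongrightarrow> 0")
proof (rule LIMSEQ_I)
  fix \<eta>' :: real assume "\<eta>' > 0"
  \<comment> \<open>One part for the power means, one for the zeros near the circle, two for those
    inside, one for those outside.\<close>
  define \<eta> where "\<eta> = \<eta>' / 5"
  have "\<eta> > 0" using \<open>\<eta>' > 0\<close> by (simp add: \<eta>_def)
  have "isCont (\<lambda>x::real. x ^ k) 1" by (intro continuous_intros)
  then obtain d0 where d0: "d0 > 0" "\<And>x::real. \<bar>x - 1\<bar> < d0 \<Longrightarrow> \<bar>x ^ k - 1\<bar> < \<eta>"
    using \<open>\<eta> > 0\<close> unfolding continuous_at_eps_delta dist_real_def by force
  define d where "d = min d0 1"
  have d: "d > 0" "d \<le> 1" "\<And>x::real. \<bar>x - 1\<bar> < d \<Longrightarrow> \<bar>x ^ k - 1\<bar> < \<eta>"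
    using d0 by (auto simp: d_def)
  let ?in = "\<lambda>w. cmod w \<le> (1 - d) * R" and ?out = "\<lambda>w. cmod w \<ge> (1 + d) * R"
  have d_ord: "(1 - d) * R < R" "R < (1 + d) * R" using d R_pos by auto
  have diff: "cmod (cis (real k * Arg2pi w) - (if ?out w then 0 else (w / R) ^ k))
      \<le> \<eta> + 2 * (if ?in w then 1 else 0) + (if ?out w then 1 else 0)" for w :: complex
  proof -
    have w: "(w / R) ^ k = of_real ((cmod w / R) ^ k) * cis (real k * Arg2pi w)"
    proof -
      have "w = of_real (cmod w) * cis (Arg2pi w)"
        using Arg2pi_eq[of w] by (simp add: cis_conv_exp)
      then have "(w / R) ^ k = (of_real (cmod w) * cis (Arg2pi w) / R) ^ k" by (rule arg_cong)
      then show ?thesis by (simp add: power_mult_distrib power_divide Complex.DeMoivre)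
    qed
    consider "?in w" | "\<not> ?in w" "\<not> ?out w" | "?out w" by blast
    then show ?thesis
    proof cases
      case 1
      then have "cmod w \<le> R" using d_ord(1) by linarith
      then have "cmod w / R \<le> 1" using R_pos by simp
      then have "(cmod w / R) ^ k \<le> 1" using R_pos by (intro power_le_one) auto
      then have "cmod ((w / R) ^ k) \<le> 1" unfolding w using R_pos by (simp add: norm_mult norm_power norm_divide)
      moreover have "cmod (cis (real k * Arg2pi w) - (w / R) ^ k) \<le> cmod (cis (real k * Arg2pi w)) + cmod ((w / R) ^ k)"
        by (rule norm_triangle_ineq4)
      moreover have "\<not> ?out w" using 1 d_ord by linarith
      ultimately show ?thesis using 1 \<open>\<eta> > 0\<close> by simp
    next
      case 2
      then have "\<bar>cmod w / R - 1\<bar> < d" using R_pos by (simp add: abs_less_iff field_simps)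
      then have "\<bar>(cmod w / R) ^ k - 1\<bar> < \<eta>" by (rule d)
      moreover have "cis (real k * Arg2pi w) - (w / R) ^ k = - of_real ((cmod w / R) ^ k - 1) * cis (real k * Arg2pi w)"
        unfolding w by (simp add: algebra_simps)
      then have "cmod (cis (real k * Arg2pi w) - (w / R) ^ k) = \<bar>(cmod w / R) ^ k - 1\<bar>"
        by (simp only: norm_mult norm_minus_cancel norm_of_real norm_cis mult_1_right)
      ultimately show ?thesis using 2 by simp
    next
      case 3
      then show ?thesis using \<open>\<eta> > 0\<close> by simp
    qed
  qed
  have sum_diff: "cmod (\<Sum>w\<in>#B. cis (real k * Arg2pi w)) \<le> cmod (\<Sum>w\<in>#filter_mset (\<lambda>w. \<not> ?out w) B. (w / R) ^ k)
      + (\<eta> * size B + 2 * size (filter_mset ?in B) + size (filter_mset ?out B))" for B :: "complex multiset"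
  proof -
    have "cmod ((\<Sum>w\<in>#B. cis (real k * Arg2pi w)) - (\<Sum>w\<in>#filter_mset (\<lambda>w. \<not> ?out w) B. (w / R) ^ k))
        \<le> \<eta> * size B + 2 * size (filter_mset ?in B) + size (filter_mset ?out B)"
    proof (induction B)
      case (add w B)
      let ?s = "(\<Sum>w\<in>#B. cis (real k * Arg2pi w)) - (\<Sum>w\<in>#filter_mset (\<lambda>w. \<not> ?out w) B. (w / R) ^ k)"
      have "(\<Sum>w\<in>#add_mset w B. cis (real k * Arg2pi w)) - (\<Sum>w\<in>#filter_mset (\<lambda>w. \<not> ?out w) (add_mset w B). (w / R) ^ k)
         = (cis (real k * Arg2pi w) - (if ?out w then 0 else (w / R) ^ k)) + ?s"
        by simp
      then have "cmod ((\<Sum>w\<in>#add_mset w B. cis (real k * Arg2pi w)) - (\<Sum>w\<in>#filter_mset (\<lambda>w. \<not> ?out w) (add_mset w B). (w / R) ^ k))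
        \<le> cmod (cis (real k * Arg2pi w) - (if ?out w then 0 else (w / R) ^ k)) + cmod ?s"
        by (simp only: norm_triangle_ineq)
      with diff[of w] add show ?case by (auto simp: algebra_simps)
    qed auto
    then show ?thesis using norm_triangle_sub by (meson add_left_mono order_trans)
  qed
  have "eventually (\<lambda>l. cmod ((\<Sum>w\<in>#filter_mset (\<lambda>w. \<not> ?out w) (proots (Q l)). (w / R) ^ k) / of_nat (degree (Q l))) < \<eta>) sequentially"
    using order_tendstoD(2)[OF tendsto_norm[OF power_means_inside[OF d(1,2) assms]]] \<open>\<eta> > 0\<close> by simp
  moreover have "eventually (\<lambda>l. proportion ?in l < \<eta>) sequentially"
    using order_tendstoD(2)[OF proportion_inside[OF d_ord(1)]] \<open>\<eta> > 0\<close> by simp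
  moreover have "eventually (\<lambda>l. proportion ?out l < \<eta>) sequentially"
    using order_tendstoD(2)[OF proportion_outside[OF d(1)]] \<open>\<eta> > 0\<close> by simp
  ultimately have "eventually (\<lambda>l. norm (?f l - 0) < \<eta>') sequentially"
    using degree_pos
  proof eventually_elim
    case (elim l)
    let ?n = "real (degree (Q l))"
    have n: "?n > 0" using elim by simp
    have "cmod (\<Sum>w\<in>#proots (Q l). cis (real k * Arg2pi w)) / ?n \<le> (cmod (\<Sum>w\<in>#filter_mset (\<lambda>w. \<not> ?out w) (proots (Q l)). (w / R) ^ k)
      + (\<eta> * ?n + 2 * size (filter_mset ?in (proots (Q l))) + size (filter_mset ?out (proots (Q l))))) / ?n"
      using sum_diff[of "proots (Q l)"] unfolding size_proots_complex by (intro divide_right_mono) auto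
    also have "\<dots> = cmod ((\<Sum>w\<in>#filter_mset (\<lambda>w. \<not> ?out w) (proots (Q l)). (w / R) ^ k) / of_nat (degree (Q l)))
        + \<eta> + 2 * proportion ?in l + proportion ?out l"
      using n by (simp add: add_divide_distrib norm_divide proportion_def)
    also have "\<dots> < 5 * \<eta>" using elim by simp
    finally show ?case by (simp add: \<eta>_def norm_divide)
  qed
  then show "\<exists>no. \<forall>n\<ge>no. norm (?f n - 0) < \<eta>'" by (simp add: eventually_sequentially)
qed

theorem cluster: "zeros_cluster Q R"
proof -
  interpret weyl_sequence "\<lambda>l. image_mset Arg2pi (proots (Q l))"
  proof
    show "0 \<le> t \<and> t < 2 * pi" if "t \<in># image_mset Arg2pi (proots (Q l))" for t l
      using that Arg2pi_ge_0 Arg2pi_lt_2pi by auto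
    show "eventually (\<lambda>l. image_mset Arg2pi (proots (Q l)) \<noteq> {#}) sequentially"
      using degree_pos by eventually_elim (auto simp flip: size_eq_0_iff_empty simp: size_proots_complex)
    show "(\<lambda>l. (\<Sum>t\<in>#image_mset Arg2pi (proots (Q l)). cis (real k * t)) / of_nat (size (image_mset Arg2pi (proots (Q l))))) \<longlonglongrightarrow> 0"
      if "k \<ge> 1" for k
      using argument_means[OF that] by (simp add: size_proots_complex image_mset.compositionality comp_def)
  qed
  have rm: "root_measure (Q l) {z. P z} = proportion P l" for P l
    by (simp add: root_measure_def proportion_def)
  show ?thesis unfolding zeros_cluster_def rm
  proof (intro conjI allI impI)
    show "proportion (\<lambda>z. \<theta> < Arg2pi z \<and> Arg2pi z \<le> \<phi>) \<longlonglongrightarrow> (\<phi> - \<theta>) / (2 * pi)"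
      if "0 \<le> \<theta> \<and> \<theta> < \<phi> \<and> \<phi> < 2 * pi" for \<theta> \<phi>
      using arc_proportion[of \<theta> \<phi>] that
      by (simp add: filter_mset_image_mset comp_def size_proots_complex proportion_def[abs_def])
  qed (use degrees annulus_proportion in auto)
qed

end

subsection \<open>The radius function\<close>

text \<open>Zeros are split off one point at a time. The product P over the earlier points does not
  vanish at the new point w, so f and the current quotient h have the same order there.\<close>

lemma divide_out_zeros:
  assumes f: "f holomorphic_on S" "open S" "connected S" "\<exists>z\<in>S. f z \<noteq> 0"
    and "finite Z" "Z \<subseteq> S"
  shows "\<exists>h. h holomorphic_on S \<and> (\<forall>z\<in>S. f z = (\<Prod>w\<in>Z. (z - w) ^ nat (zorder f w)) * h z) \<and> (\<forall>w\<in>Z. h w \<noteq> 0)"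
  using assms(5,6)
proof (induction Z rule: finite_induct)
  case empty
  then show ?case using f by auto
next
  case (insert w Z)
  define P where "P = (\<lambda>z. \<Prod>w\<in>Z. (z - w) ^ nat (zorder f w))"
  obtain h where h: "h holomorphic_on S" "\<And>z. z \<in> S \<Longrightarrow> f z = P z * h z" "\<And>w. w \<in> Z \<Longrightarrow> h w \<noteq> 0"
    using insert unfolding P_def by auto
  have "w \<in> S" using insert by auto
  have "\<exists>z\<in>S. h z \<noteq> 0" using f(4) h(2) by (metis mult_zero_right)
  note zo = zorder_exist_zero[OF h(1) f(2,3) \<open>w \<in> S\<close> this]
  have n: "zorder h w \<ge> 0" using zo[THEN conjunct1] by (simp split: if_splits)
  obtain r where r: "r > 0" "cball w r \<subseteq> S" "zor_poly h w holomorphic_on cball w r"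
    and G: "\<And>z. z \<in> cball w r \<Longrightarrow> h z = zor_poly h w z * (z - w) ^ nat (zorder h w) \<and> zor_poly h w z \<noteq> 0"
    using zo[THEN conjunct2] by blast
  have "P w \<noteq> 0" using insert(1,2) by (auto simp: P_def)
  have "zorder f w = zorder h w"
  proof (rule zorder_eqI[of "ball w r" _ "\<lambda>z. P z * zor_poly h w z"])
    show "(\<lambda>z. P z * zor_poly h w z) holomorphic_on ball w r" unfolding P_def
      by (intro holomorphic_intros holomorphic_on_subset[OF r(3)] ball_subset_cball)
    show "f z = P z * zor_poly h w z * (z - w) powi zorder h w" if "z \<in> ball w r" "z \<noteq> w" for z
    proof -
      have "(z - w) powi zorder h w = (z - w) ^ nat (zorder h w)" using n by (simp add: power_int_def)
      moreover have "z \<in> S" "z \<in> cball w r" using that r by (auto simp: subset_iff)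
      ultimately show ?thesis using h(2)[of z] G[of z] by simp
    qed
  qed (use r G[of w] \<open>P w \<noteq> 0\<close> in auto)
  note ord = this
  \<comment> \<open>The singularity at w is removable: near w the quotient agrees with the zero-free
    local factor \<open>zor_poly h w\<close>.\<close>
  define k where "k = (\<lambda>z. if z = w then zor_poly h w w else h z / (z - w) ^ nat (zorder f w))"
  have "k holomorphic_on ball w r"
  proof (rule holomorphic_transform)
    show "zor_poly h w holomorphic_on ball w r" using r(3) by (rule holomorphic_on_subset) auto
    show "zor_poly h w z = k z" if "z \<in> ball w r" for z
      using G[of z] that by (auto simp: k_def ord)
  qed
  moreover have "k holomorphic_on (S - {w})"
  proof (rule holomorphic_transform)
    show "(\<lambda>z. h z / (z - w) ^ nat (zorder f w)) holomorphic_on (S - {w})"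
      by (intro holomorphic_intros holomorphic_on_subset[OF h(1)]) auto
  qed (auto simp: k_def)
  ultimately have "k holomorphic_on (ball w r \<union> (S - {w}))"
    using f(2) by (intro holomorphic_on_Un) auto
  moreover have "ball w r \<union> (S - {w}) = S" using r \<open>w \<in> S\<close> by (auto simp: subset_iff)
  ultimately have "k holomorphic_on S" by simp
  moreover have "f z = (\<Prod>w\<in>insert w Z. (z - w) ^ nat (zorder f w)) * k z" if "z \<in> S" for z
  proof -
    have "h z = (z - w) ^ nat (zorder f w) * k z"
      using G[of w] r(1) by (auto simp: k_def ord)
    then show ?thesis using insert(1,2) h(2)[OF that] by (simp add: P_def mult_ac)
  qed
  moreover have "k v \<noteq> 0" if "v \<in> insert w Z" for v
    using that h(3)[of v] G[of w] r(1) insert(2) by (auto simp: k_def)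
  ultimately show ?case by blast
qed

lemma divide_out_zeros_mset:
  assumes f: "f holomorphic_on S" "open S" "connected S" "\<exists>z\<in>S. f z \<noteq> 0"
    and "finite Z" "Z \<subseteq> S"
  obtains W h where "set_mset W \<subseteq> Z" "int (size W) = (\<Sum>w\<in>Z. zorder f w)" "h holomorphic_on S"
    "\<And>z. z \<in> S \<Longrightarrow> f z = (\<Prod>w\<in>#W. z - w) * h z" "\<And>w. w \<in> Z \<Longrightarrow> h w \<noteq> 0"
proof -
  obtain h where h: "h holomorphic_on S" "\<And>z. z \<in> S \<Longrightarrow> f z = (\<Prod>w\<in>Z. (z - w) ^ nat (zorder f w)) * h z"
    "\<And>w. w \<in> Z \<Longrightarrow> h w \<noteq> 0"
    using divide_out_zeros[OF assms] by blast
  have nonneg: "zorder f w \<ge> 0" if "w \<in> S" for w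
    using zorder_exist_zero[OF f(1-3) that f(4), THEN conjunct1] by (simp split: if_splits)
  have "\<exists>W. set_mset W \<subseteq> Z \<and> int (size W) = (\<Sum>w\<in>Z. zorder f w) \<and>
      (\<forall>z. (\<Prod>w\<in>#W. z - w) = (\<Prod>w\<in>Z. (z - w) ^ nat (zorder f w)))"
    using assms(5,6)
  proof (induction Z rule: finite_induct)
    case (insert w Z)
    then obtain W where "set_mset W \<subseteq> Z" "int (size W) = (\<Sum>w\<in>Z. zorder f w)"
      "\<forall>z. (\<Prod>w\<in>#W. z - w) = (\<Prod>w\<in>Z. (z - w) ^ nat (zorder f w))" by auto
    then show ?case using insert nonneg[of w]
      by (intro exI[of _ "W + replicate_mset (nat (zorder f w)) w"]) (auto simp: mult.commute prod_mset_constant split: if_splits)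
  qed auto
  then obtain W where "set_mset W \<subseteq> Z" "int (size W) = (\<Sum>w\<in>Z. zorder f w)"
      "\<forall>z. (\<Prod>w\<in>#W. z - w) = (\<Prod>w\<in>Z. (z - w) ^ nat (zorder f w))" by blast
  with h show ?thesis by (intro that[of W h]) auto
qed

text \<open>\<open>nz0\<close> makes F a unit among the formal power series and keeps 0 from being a
  zero, which yields positive radii and a function that is not identically zero.\<close>

locale disc_series =
  fixes F :: "complex fps"
  assumes conv: "fps_conv_radius F \<ge> 1" and nz0: "fps_nth F 0 \<noteq> 0"
begin

abbreviation "f \<equiv> eval_fps F"

lemma hol_f: "f holomorphic_on ball 0 1"
proof (intro holomorphic_intros subsetI)
  fix z :: complex assume "z \<in> ball 0 1"
  then have "ereal (cmod z) < 1" by simp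
  then show "z \<in> eball 0 (fps_conv_radius F)" using less_le_trans[OF _ conv] by simp
qed

lemma f_0: "f 0 \<noteq> 0" using nz0 by (simp add: eval_fps_at_0)

lemma f_nonzero: "\<exists>z\<in>ball 0 1. f z \<noteq> 0" using f_0 by (intro bexI[of _ 0]) auto

lemma finite_zeros:
  assumes "r < 1" "A \<subseteq> cball 0 r"
  shows "finite {z \<in> A. f z = 0}"
proof (cases "\<forall>z\<in>ball 0 1. f z = f 0")
  case True
  have "f z \<noteq> 0" if "z \<in> A" for z
  proof -
    have "z \<in> ball 0 1" using that assms by (auto simp: subset_iff)
    then have "f z = f 0" using True by blast
    then show ?thesis using f_0 by metis
  qed
  then have "{z \<in> A. f z = 0} = {}" by blast
  then show ?thesis by (simp only: finite.emptyI)
next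
  case False
  have "finite {z \<in> cball 0 r. f z = 0}"
  proof (rule holomorphic_compact_finite_zeros[OF hol_f])
    show "cball 0 r \<subseteq> ball (0::complex) 1" using assms by auto
    show "\<not> f constant_on ball 0 1"
    proof
      assume "f constant_on ball 0 1"
      then obtain c where "\<forall>z\<in>ball 0 1. f z = c" unfolding constant_on_def by blast
      then have "f z = c" if "z \<in> ball 0 1" for z using that by blast
      then show False using False by (metis centre_in_ball zero_less_one)
    qed
  qed auto
  then show ?thesis by (rule rev_finite_subset) (use assms in auto)
qed

lemma zorder_zero_pos: "z \<in> ball 0 1 \<Longrightarrow> f z = 0 \<Longrightarrow> zorder f z > 0"
  using zorder_exist_zero[OF hol_f _ _ _ f_nonzero, of z, THEN conjunct1] by simp

lemma zorder_sum_mono: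
  assumes "r < 1" "B \<subseteq> cball 0 r" "{z \<in> A. f z = 0} \<subseteq> {z \<in> B. f z = 0}"
  shows "(\<Sum>z | z \<in> A \<and> f z = 0. zorder f z) \<le> (\<Sum>z | z \<in> B \<and> f z = 0. zorder f z)"
proof (rule sum_mono2[OF finite_zeros[OF assms(1,2)] assms(3)])
  show "0 \<le> zorder f z" if "z \<in> {z \<in> B. f z = 0} - {z \<in> A. f z = 0}" for z
    using zorder_zero_pos[of z] that assms by (fastforce simp: subset_iff)
qed

lemma at_most_iff:
  assumes "r < 1"
  shows "at_most_zeros_in f (ball 0 r) m \<longleftrightarrow> (\<Sum>z | z \<in> ball 0 r \<and> f z = 0. zorder f z) \<le> int m"
  using finite_zeros[OF assms, of "ball 0 r"] by (simp add: at_most_zeros_in_def)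

section \<open>Attainment and estimates of the critical radii\<close>

abbreviation "R m \<equiv> zero_radius m F"

lemma admissible_bdd: "bdd_above {r \<in> {0..1}. at_most_zeros_in f (ball 0 r) m}"
  by (rule bdd_aboveI[of _ 1]) auto

lemma le_R: "0 \<le> r \<Longrightarrow> r \<le> 1 \<Longrightarrow> at_most_zeros_in f (ball 0 r) m \<Longrightarrow> r \<le> R m"
  unfolding zero_radius_def using admissible_bdd by (intro cSup_upper) auto

lemma R_pos: "R m > 0"
proof -
  have "isCont f 0" using hol_f by (auto simp: holomorphic_on_open field_differentiable_def
      intro!: field_differentiable_imp_continuous_at)
  then have "eventually (\<lambda>z. f z \<noteq> 0) (nhds 0)"
    using f_0 by (intro tendsto_imp_eventually_ne) (auto simp: continuous_at tendsto_at_iff_tendsto_nhds)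
  then obtain e where e: "e > 0" "\<And>z. z \<in> ball 0 e \<Longrightarrow> f z \<noteq> 0"
    unfolding eventually_nhds_metric by (auto simp: dist_commute)
  define r where "r = min e (1 / 2)"
  have r: "0 < r" "r < 1" using e by (auto simp: r_def)
  have none: "{z. z \<in> ball 0 r \<and> f z = 0} = {}" using e by (auto simp: r_def)
  have "at_most_zeros_in f (ball 0 r) m" unfolding at_most_iff[OF r(2)] none by simp
  then have "r \<le> R m" using r by (intro le_R) auto
  then show ?thesis using r by simp
qed

lemma R_le:
  assumes "\<not> at_most_zeros_in f (ball 0 x) m" "x < 1"
  shows "R m \<le> x"
  unfolding zero_radius_def
proof (rule cSup_least)
  show "{r \<in> {0..1}. at_most_zeros_in f (ball 0 r) m} \<noteq> {}"
    by (auto intro!: exI[of _ 0] simp: at_most_zeros_in_def)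
  fix r assume r: "r \<in> {r \<in> {0..1}. at_most_zeros_in f (ball 0 r) m}"
  show "r \<le> x"
  proof (rule ccontr)
    assume "\<not> r \<le> x"
    have fin: "finite {z \<in> ball 0 r. f z = 0}" using r by (simp add: at_most_zeros_in_def)
    have "(\<Sum>z | z \<in> ball 0 x \<and> f z = 0. zorder f z) \<le> (\<Sum>z | z \<in> ball 0 r \<and> f z = 0. zorder f z)"
      by (rule sum_mono2[OF fin]) (use \<open>\<not> r \<le> x\<close> r zorder_zero_pos in \<open>force+\<close>)
    also have "\<dots> \<le> int m" using r by (simp add: at_most_zeros_in_def)
    finally show False using assms at_most_iff by blast
  qed
qed

lemma R_less_1:
  assumes "infinite {z \<in> ball 0 1. f z = 0}"
  shows "R m < 1"
proof -
  obtain T where T: "T \<subseteq> {z \<in> ball 0 1. f z = 0}" "finite T" "card T = Suc m"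
    using infinite_arbitrarily_large[OF assms] by blast
  define x where "x = (1 + Max (cmod ` T)) / 2"
  have "T \<noteq> {}" using T by auto
  then have "Max (cmod ` T) \<in> cmod ` T" using T(2) by (intro Max_in) auto
  then have M: "Max (cmod ` T) < 1" using T(1) by auto
  then have x: "x < 1" by (simp add: x_def)
  have Tx: "T \<subseteq> {z \<in> ball 0 x. f z = 0}"
  proof
    fix z assume "z \<in> T"
    then have "cmod z \<le> Max (cmod ` T)" using T(2) by auto
    then show "z \<in> {z \<in> ball 0 x. f z = 0}" using M T(1) \<open>z \<in> T\<close> by (auto simp: x_def)
  qed
  have "int (Suc m) = (\<Sum>z\<in>T. 1)" using T by simp
  also have "\<dots> \<le> (\<Sum>z\<in>T. zorder f z)"
  proof (rule sum_mono)
    fix z assume "z \<in> T"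
    then have "0 < zorder f z" using zorder_zero_pos[of z] T(1) by auto
    then show "1 \<le> zorder f z" by simp
  qed
  also have "\<dots> = (\<Sum>z | z \<in> T \<and> f z = 0. zorder f z)"
    by (rule sum.cong) (use T(1) in auto)
  also have "\<dots> \<le> (\<Sum>z | z \<in> ball 0 x \<and> f z = 0. zorder f z)"
    using Tx x by (intro zorder_sum_mono[of x]) auto
  finally have "R m \<le> x" using x by (intro R_le) (auto simp: at_most_iff)
  then show ?thesis using x by simp
qed

text \<open>The supremum is attained: the finitely many zeros of the open disc lie in a smaller
  closed disc, so an admissible radius close enough to the supremum already captures all of
  them.\<close>

lemma zeros_in_ball:
  assumes "R m < 1"
  shows "(\<Sum>z | z \<in> ball 0 (R m) \<and> f z = 0. zorder f z) \<le> int m"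
proof (rule ccontr)
  define Z where "Z = {z \<in> ball 0 (R m). f z = 0}"
  define \<rho> where "\<rho> = Max (insert 0 (cmod ` Z))"
  assume *: "\<not> ?thesis"
  have fin: "finite Z" unfolding Z_def by (rule finite_zeros[OF assms]) auto
  have "\<rho> \<in> insert 0 (cmod ` Z)" unfolding \<rho>_def using fin by (intro Max_in) auto
  then have "\<rho> < R m" using R_pos by (auto simp: Z_def)
  then obtain r where r: "r \<in> {r \<in> {0..1}. at_most_zeros_in f (ball 0 r) m}" "\<rho> < r"
    unfolding zero_radius_def by (subst (asm) less_cSup_iff[OF _ admissible_bdd])
      (auto intro!: exI[of _ 0] simp: at_most_zeros_in_def)
  have "r \<le> R m" using r by (intro le_R) auto
  have "{z. z \<in> ball 0 (R m) \<and> f z = 0} = {z. z \<in> ball 0 r \<and> f z = 0}"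
  proof (intro equalityI subsetI)
    fix z assume z: "z \<in> {z. z \<in> ball 0 (R m) \<and> f z = 0}"
    then have "cmod z \<le> \<rho>" unfolding \<rho>_def using fin by (intro Max_ge) (auto simp: Z_def)
    then show "z \<in> {z. z \<in> ball 0 r \<and> f z = 0}" using z r by auto
  qed (use \<open>r \<le> R m\<close> in auto)
  then show False using * r by (simp add: at_most_zeros_in_def)
qed

text \<open>Zeros do not accumulate inside the unit disc, so a zero-free annulus begins at
  \<open>R m\<close>. With at most m zeros in the closed disc the radius could be enlarged across
  it.\<close>

lemma zeros_in_cball:
  assumes "R m < 1"
  shows "(\<Sum>z | z \<in> cball 0 (R m) \<and> f z = 0. zorder f z) > int m"
proof (rule ccontr)
  assume *: "\<not> ?thesis"
  define x where "x = (1 + R m) / 2"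
  have x: "R m < x" "x < 1" using assms by (auto simp: x_def)
  define Z where "Z = {z \<in> cball 0 x - cball 0 (R m). f z = 0}"
  have fin: "finite Z" unfolding Z_def by (rule finite_zeros[OF x(2)]) auto
  define r where "r = Min (insert x (cmod ` Z))"
  have "r \<in> insert x (cmod ` Z)" unfolding r_def using fin by (intro Min_in) auto
  then have "R m < r" using x by (auto simp: Z_def)
  have "r \<le> x" unfolding r_def using fin by (intro Min_le) auto
  have "{z. z \<in> ball 0 r \<and> f z = 0} \<subseteq> {z. z \<in> cball 0 (R m) \<and> f z = 0}"
  proof
    fix z assume z: "z \<in> {z. z \<in> ball 0 r \<and> f z = 0}"
    have "z \<notin> Z"
    proof
      assume "z \<in> Z"
      then have "r \<le> cmod z" unfolding r_def using fin by (intro Min_le) auto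
      then show False using z by auto
    qed
    then show "z \<in> {z. z \<in> cball 0 (R m) \<and> f z = 0}" using z \<open>r \<le> x\<close> by (auto simp: Z_def)
  qed
  then have "(\<Sum>z | z \<in> ball 0 r \<and> f z = 0. zorder f z) \<le> (\<Sum>z | z \<in> cball 0 (R m) \<and> f z = 0. zorder f z)"
    using assms by (intro zorder_sum_mono[of "R m"]) auto
  then have "at_most_zeros_in f (ball 0 r) m" using * \<open>r \<le> x\<close> x by (subst at_most_iff) auto
  then have "r \<le> R m" using \<open>R m < r\<close> R_pos[of m] \<open>r \<le> x\<close> x by (intro le_R) auto
  then show False using \<open>R m < r\<close> by simp
qed

text \<open>Jensen's inequality at the centre: each zero in the disc of radius r contributes a
  factor r / s, so m + 1 of them would force
  \<open>cmod (f 0) \<le> U * (r / s) ^ Suc m\<close>.\<close>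

lemma R_lower_bound:
  assumes "0 \<le> r" "r < s" "s < 1" and U: "\<And>z. cmod z = s \<Longrightarrow> cmod (f z) \<le> U"
    and small: "U * (r / s) ^ Suc m < cmod (f 0)"
  shows "r \<le> R m"
proof (rule le_R)
  define Z where "Z = {z. z \<in> ball 0 r \<and> f z = 0}"
  have fin: "finite Z" using finite_zeros[of r "ball 0 r"] assms by (simp add: Z_def)
  obtain W h where W: "set_mset W \<subseteq> Z" "int (size W) = (\<Sum>w\<in>Z. zorder f w)" "h holomorphic_on ball 0 1"
    "\<And>z. z \<in> ball 0 1 \<Longrightarrow> f z = (\<Prod>w\<in>#W. z - w) * h z"
    by (rule divide_out_zeros_mset[OF hol_f _ _ f_nonzero fin]) (use assms in \<open>auto simp: Z_def\<close>)
  have "cmod ((\<Prod>w\<in>#W. 0 - w) * h 0) \<le> U * (r / s) ^ size W"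
  proof (rule zeros_reduce_modulus[OF W(3)])
    fix w assume "w \<in># W"
    then have "cmod w \<le> r" using W(1) by (auto simp: Z_def)
    moreover have "s > 0" using assms by simp
    ultimately show "s * cmod (0 - w) \<le> r / s * cmod (of_real (s\<^sup>2) - cnj w * 0)"
      by (simp add: norm_power power2_eq_square norm_mult mult.commute mult_left_mono)
  next
    show "cmod ((\<Prod>w\<in>#W. z - w) * h z) \<le> U" if "cmod z = s" for z
      using U[OF that] W(4)[of z] that assms by simp
  qed (use assms in auto)
  then have le: "cmod (f 0) \<le> U * (r / s) ^ size W" using W(4)[of 0] by simp
  have "size W \<le> m"
  proof (rule ccontr)
    assume "\<not> size W \<le> m"
    have "cmod (f (of_real s)) \<le> U" using assms by (intro U) simp
    then have "0 \<le> U" using norm_ge_zero order_trans by blast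
    have "(r / s) ^ size W \<le> (r / s) ^ Suc m"
      using assms \<open>\<not> size W \<le> m\<close> by (intro power_decreasing) auto
    then have "U * (r / s) ^ size W \<le> U * (r / s) ^ Suc m" using \<open>0 \<le> U\<close> by (rule mult_left_mono)
    then show False using le small by linarith
  qed
  then show "at_most_zeros_in f (ball 0 r) m" using W(2) assms by (subst at_most_iff) (auto simp: Z_def)
qed (use assms in auto)

end

subsection \<open>Polynomials of bounded degree\<close>

text \<open>This norm is chosen because it dominates the polynomial on the closed unit disc and
  grows at most by the factor \<open>1 + cmod w\<close> under multiplication by a linear factor with
  root w.\<close>

definition coeff_norm :: "complex poly \<Rightarrow> real" where
  "coeff_norm P = (\<Sum>i\<le>degree P. cmod (coeff P i))"

lemma coeff_norm_eq: "degree P \<le> n \<Longrightarrow> coeff_norm P = (\<Sum>i\<le>n. cmod (coeff P i))"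
  unfolding coeff_norm_def by (rule sum.mono_neutral_left) (auto simp: coeff_eq_0)

lemma coeff_norm_nonneg: "coeff_norm P \<ge> 0"
  unfolding coeff_norm_def by (rule sum_nonneg) simp

lemma coeff_norm_0 [simp]: "coeff_norm 0 = 0"
  by (simp add: coeff_norm_def)

lemma coeff_norm_const [simp]: "coeff_norm [:c:] = cmod c"
  by (simp add: coeff_norm_def)

lemma coeff_le_coeff_norm: "cmod (coeff P i) \<le> coeff_norm P"
proof (cases "i \<le> degree P")
  case True
  then show ?thesis unfolding coeff_norm_def by (intro member_le_sum) auto
next
  case False
  then show ?thesis using coeff_norm_nonneg by (simp add: coeff_eq_0)
qed

lemma coeff_norm_pos: "P \<noteq> 0 \<Longrightarrow> coeff_norm P > 0"
  using coeff_le_coeff_norm[of P "degree P"] by (smt (verit) leading_coeff_0_iff zero_less_norm_iff)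

lemma coeff_norm_smult: "coeff_norm (smult c P) = cmod c * coeff_norm P"
  by (subst coeff_norm_eq[of _ "degree P"]) (auto simp: degree_smult_le norm_mult sum_distrib_left coeff_norm_def)

lemma coeff_norm_add: "coeff_norm (P + Q) \<le> coeff_norm P + coeff_norm Q"
proof -
  let ?n = "max (degree P) (degree Q)"
  have "coeff_norm (P + Q) = (\<Sum>i\<le>?n. cmod (coeff (P + Q) i))"
    by (rule coeff_norm_eq) (rule degree_add_le_max)
  also have "\<dots> \<le> (\<Sum>i\<le>?n. cmod (coeff P i) + cmod (coeff Q i))"
    by (intro sum_mono) (simp add: norm_triangle_ineq)
  also have "\<dots> = coeff_norm P + coeff_norm Q"
    by (simp add: sum.distrib coeff_norm_eq[of P ?n] coeff_norm_eq[of Q ?n])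
  finally show ?thesis .
qed

lemma coeff_norm_pCons_0: "coeff_norm (pCons 0 P) = coeff_norm P"
proof -
  have "coeff_norm (pCons 0 P) = (\<Sum>i\<le>Suc (degree P). cmod (coeff (pCons 0 P) i))"
    by (rule coeff_norm_eq) (rule degree_pCons_le)
  also have "\<dots> = coeff_norm P" by (subst sum.atMost_Suc_shift) (simp add: coeff_norm_def)
  finally show ?thesis .
qed

lemma coeff_norm_linear_factor: "coeff_norm ([:-w, 1:] * P) \<le> (1 + cmod w) * coeff_norm P"
proof -
  have "[:-w, 1:] * P = smult (-w) P + pCons 0 P" by simp
  then have "coeff_norm ([:-w, 1:] * P) \<le> coeff_norm (smult (-w) P) + coeff_norm (pCons 0 P)"
    using coeff_norm_add by metis
  then show ?thesis unfolding coeff_norm_smult coeff_norm_pCons_0 by (simp add: algebra_simps)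
qed

lemma cmod_poly_le_coeff_norm:
  assumes "cmod z \<le> 1"
  shows "cmod (poly P z) \<le> coeff_norm P"
proof -
  have "cmod (poly P z) \<le> (\<Sum>i\<le>degree P. cmod (coeff P i * z ^ i))"
    unfolding poly_altdef by (rule norm_sum)
  also have "\<dots> \<le> coeff_norm P" unfolding coeff_norm_def
    using assms by (intro sum_mono) (simp add: norm_mult norm_power mult_left_le power_le_one)
  finally show ?thesis .
qed

text \<open>Building P from its linear factors bounds \<open>coeff_norm P\<close> by
  \<open>cmod (lead_coeff P)\<close> times the product of \<open>1 + cmod w\<close>. The value at z
  is the same product with \<open>cmod (z - w)\<close>, and the factors are compared one by
  one.\<close>

lemma poly_lower_bound:
  assumes "0 \<le> \<kappa>" and w: "\<And>w. w \<in># proots P \<Longrightarrow> \<kappa> * (1 + cmod w) \<le> cmod (z - w)"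
  shows "\<kappa> ^ degree P * coeff_norm P \<le> cmod (poly P z)"
proof -
  have "coeff_norm (\<Prod>w\<in>#A. [:-w, 1:]) \<le> (\<Prod>w\<in>#A. 1 + cmod w)" for A
  proof (induction A)
    case empty
    have "coeff_norm 1 = 1" by (simp add: coeff_norm_def)
    then show ?case by simp
  next
    case (add w A)
    have "coeff_norm ([:-w, 1:] * (\<Prod>w\<in>#A. [:-w, 1:])) \<le> (1 + cmod w) * coeff_norm (\<Prod>w\<in>#A. [:-w, 1:])"
      by (rule coeff_norm_linear_factor)
    also have "\<dots> \<le> (1 + cmod w) * (\<Prod>w\<in>#A. 1 + cmod w)"
      using add by (intro mult_left_mono) auto
    finally show ?case by (simp only: image_mset_add_mset prod_mset.add_mset)
  qed
  then have "cmod (lead_coeff P) * coeff_norm (\<Prod>w\<in>#proots P. [:-w, 1:]) \<le> cmod (lead_coeff P) * (\<Prod>w\<in>#proots P. 1 + cmod w)"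
    by (intro mult_left_mono) auto
  then have "coeff_norm P \<le> cmod (lead_coeff P) * (\<Prod>w\<in>#proots P. 1 + cmod w)"
    by (metis coeff_norm_smult complex_poly_decompose_multiset)
  then have "\<kappa> ^ degree P * coeff_norm P \<le> \<kappa> ^ degree P * (cmod (lead_coeff P) * (\<Prod>w\<in>#proots P. 1 + cmod w))"
    using assms(1) by (intro mult_left_mono) auto
  also have "\<dots> = cmod (lead_coeff P) * (\<Prod>w\<in>#proots P. \<kappa> * (1 + cmod w))"
    by (simp add: prod_mset.distrib prod_mset_constant size_proots_complex del: distrib_left_numeral)
  also have "\<dots> \<le> cmod (lead_coeff P) * (\<Prod>w\<in>#proots P. cmod (z - w))"
    using assms by (intro mult_left_mono prod_mset_mono_nonneg[THEN conjunct2]) auto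
  also have "\<dots> = cmod (poly P z)" unfolding poly_eq_prod_proots[of P z] norm_mult norm_prod_mset ..
  finally show ?thesis .
qed

text \<open>Evaluate at a root, divide the linear factor out, and repeat.\<close>

lemma near_multiple_bound:
  assumes "\<And>w. w \<in># W \<Longrightarrow> cmod w < \<rho>" "0 < \<rho>" "\<rho> < S"
  shows "\<exists>C\<ge>0. \<forall>P u e. (P = 0 \<or> degree P < size W) \<longrightarrow> u holomorphic_on ball 0 S \<longrightarrow>
     (\<forall>z\<in>cball 0 \<rho>. cmod (poly P z - (\<Prod>w\<in>#W. z - w) * u z) \<le> e) \<longrightarrow> coeff_norm P \<le> C * e"
  using assms(1)
proof (induction W)
  case empty
  then show ?case by (intro exI[of _ 0]) auto
next
  case (add w W)
  have "\<And>v. v \<in># W \<Longrightarrow> cmod v < \<rho>" using add.prems by simp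
  from add.IH[OF this] obtain C where C: "C \<ge> 0"
    "\<forall>P u e. (P = 0 \<or> degree P < size W) \<longrightarrow> u holomorphic_on ball 0 S \<longrightarrow>
     (\<forall>z\<in>cball 0 \<rho>. cmod (poly P z - (\<Prod>w\<in>#W. z - w) * u z) \<le> e) \<longrightarrow> coeff_norm P \<le> C * e" by blast
  have w: "cmod w < \<rho>" using add.prems by simp
  define \<eta> where "\<eta> = \<rho> - cmod w"
  have "\<eta> > 0" using w by (simp add: \<eta>_def)
  show ?case
  \<comment> \<open>Dividing by the factor with root w turns the error e into at most
    \<open>2 * e / \<eta>\<close> for the quotient, with the same u. Multiplying back costs
    \<open>1 + cmod w\<close>, and the final 1 accounts for the remainder \<open>poly P w\<close>.
    None of this depends on P, u or e.\<close>
  proof (intro exI[of _ "(1 + cmod w) * (C * (2 / \<eta>)) + 1"] conjI allI impI)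
    show "0 \<le> (1 + cmod w) * (C * (2 / \<eta>)) + 1" using C(1) \<open>\<eta> > 0\<close> by simp
    fix P u e
    assume P: "P = 0 \<or> degree P < size (add_mset w W)" and u: "u holomorphic_on ball 0 S"
      and e: "\<forall>z\<in>cball 0 \<rho>. cmod (poly P z - (\<Prod>w\<in>#add_mset w W. z - w) * u z) \<le> e"
    define p where "p = synthetic_div P w"
    have P_eq: "P = [:-w, 1:] * p + [:poly P w:]" unfolding p_def by (rule synthetic_div_correct'[symmetric])
    have c: "cmod (poly P w) \<le> e" using e w by (auto dest: bspec[of _ _ w])
    have "p = 0 \<or> degree p < size W"
      using P by (cases "degree P = 0") (auto simp: p_def degree_synthetic_div synthetic_div_eq_0_iff)
    moreover have "cmod (poly p z - (\<Prod>w\<in>#W. z - w) * u z) \<le> 2 * e / \<eta>" if "z \<in> cball 0 \<rho>" for z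
    proof (rule max_modulus_disc[where f = "\<lambda>z. poly p z - (\<Prod>w\<in>#W. z - w) * u z"])
      show "(\<lambda>z. poly p z - (\<Prod>w\<in>#W. z - w) * u z) holomorphic_on ball 0 S"
        by (intro holomorphic_intros holomorphic_on_prod_mset u)
      fix z :: complex assume z: "cmod z = \<rho>"
      have "(z - w) * (poly p z - (\<Prod>w\<in>#W. z - w) * u z) = (poly P z - (\<Prod>w\<in>#add_mset w W. z - w) * u z) - poly P w"
        by (subst P_eq) (simp add: algebra_simps)
      then have "cmod (z - w) * cmod (poly p z - (\<Prod>w\<in>#W. z - w) * u z) \<le> cmod (poly P z - (\<Prod>w\<in>#add_mset w W. z - w) * u z) + cmod (poly P w)"
        by (metis norm_mult norm_triangle_ineq4)
      also have "\<dots> \<le> e + e" using e z c by (intro add_mono) auto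
      finally have "cmod (z - w) * cmod (poly p z - (\<Prod>w\<in>#W. z - w) * u z) \<le> 2 * e" by simp
      moreover have "\<eta> \<le> cmod (z - w)" using norm_triangle_ineq2[of z w] z by (simp add: \<eta>_def)
      then have "\<eta> * cmod (poly p z - (\<Prod>w\<in>#W. z - w) * u z) \<le> cmod (z - w) * cmod (poly p z - (\<Prod>w\<in>#W. z - w) * u z)"
        by (rule mult_right_mono) simp
      ultimately have "\<eta> * cmod (poly p z - (\<Prod>w\<in>#W. z - w) * u z) \<le> 2 * e" by linarith
      then show "cmod (poly p z - (\<Prod>w\<in>#W. z - w) * u z) \<le> 2 * e / \<eta>"
        using \<open>\<eta> > 0\<close> by (simp add: field_simps)
    qed (use that assms in auto)
    ultimately have "coeff_norm p \<le> C * (2 * e / \<eta>)" using C(2) u by blast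
    then have "(1 + cmod w) * coeff_norm p \<le> (1 + cmod w) * (C * (2 * e / \<eta>))"
      by (rule mult_left_mono) simp
    moreover have "coeff_norm P \<le> coeff_norm ([:-w, 1:] * p) + coeff_norm [:poly P w:]"
      using coeff_norm_add P_eq by metis
    ultimately have "coeff_norm P \<le> (1 + cmod w) * (C * (2 * e / \<eta>)) + e"
      using coeff_norm_linear_factor[of w p] c by simp
    also have "\<dots> = ((1 + cmod w) * (C * (2 / \<eta>)) + 1) * e" by (simp add: algebra_simps)
    finally show "coeff_norm P \<le> ((1 + cmod w) * (C * (2 / \<eta>)) + 1) * e" .
  qed
qed

text \<open>Schwarz's lemma for a zero of order N at the origin: the maximum principle is applied to
  the series divided by \<open>z ^ N\<close>.\<close>

lemma eval_fps_vanishing_bound: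
  fixes H :: "complex fps"
  assumes conv: "fps_conv_radius H \<ge> 1" and van: "\<And>j. j < N \<Longrightarrow> fps_nth H j = 0"
    and "0 < r" "r < 1" "cmod z \<le> r" and U: "\<And>z. cmod z = r \<Longrightarrow> cmod (eval_fps H z) \<le> U"
  shows "cmod (eval_fps H z) \<le> U * (cmod z / r) ^ N"
proof -
  define K where "K = fps_shift N H"
  have H: "H = fps_X ^ N * K"
    by (rule fps_ext) (simp add: K_def fps_X_power_mult_nth van)
  have K: "fps_conv_radius K \<ge> 1" using conv by (simp add: K_def)
  have eval: "eval_fps H x = x ^ N * eval_fps K x" if "cmod x < 1" for x
  proof -
    have "ereal (cmod x) < fps_conv_radius K" using less_le_trans[OF _ K] that by simp
    then show ?thesis by (subst H, subst eval_fps_mult) (auto simp: eval_fps_power)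
  qed
  have "cmod (eval_fps K z) \<le> U / r ^ N"
  proof (rule max_modulus_disc[OF _ \<open>r < 1\<close> \<open>cmod z \<le> r\<close>])
    show "eval_fps K holomorphic_on ball 0 1"
    proof (intro holomorphic_intros subsetI)
      fix z :: complex assume "z \<in> ball 0 1"
      then show "z \<in> eball 0 (fps_conv_radius K)" using less_le_trans[OF _ K] by simp
    qed
    show "cmod (eval_fps K z) \<le> U / r ^ N" if "cmod z = r" for z
      using U[OF that] eval[of z] that assms by (simp add: norm_mult norm_power field_simps)
  qed
  then have "cmod z ^ N * cmod (eval_fps K z) \<le> cmod z ^ N * (U / r ^ N)" by (rule mult_left_mono) simp
  then show ?thesis using eval[of z] assms by (simp add: norm_mult norm_power power_divide mult.commute)
qed

lemma coeff_mult_top: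
  fixes p q :: "'a :: comm_semiring_0 poly"
  assumes "degree p \<le> a" "degree q \<le> b"
  shows "coeff (p * q) (a + b) = coeff p a * coeff q b"
proof -
  have "coeff (p * q) (a + b) = (\<Sum>i\<le>a + b. coeff p i * coeff q (a + b - i))" by (rule coeff_mult)
  also have "\<dots> = (\<Sum>i\<in>{a}. coeff p i * coeff q (a + b - i))"
  proof (rule sum.mono_neutral_right)
    show "\<forall>i\<in>{..a + b} - {a}. coeff p i * coeff q (a + b - i) = 0"
    proof
      fix i assume "i \<in> {..a + b} - {a}"
      then have "i > degree p \<or> a + b - i > degree q" using assms by auto
      then show "coeff p i * coeff q (a + b - i) = 0" by (auto simp: coeff_eq_0)
    qed
  qed auto
  finally show ?thesis by simp
qed

text \<open>A measure argument: the forbidden intervals have total length at most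
  \<open>2 * c * m / (1 - q)\<close>, less than \<open>b - a\<close>, so a radius avoiding all of
  them at once exists.\<close>

lemma avoid_shrinking_intervals:
  fixes D :: "nat \<Rightarrow> real set"
  assumes "a < b" "0 < q" "q < 1" and D: "\<And>n. finite (D n)" "\<And>n. card (D n) \<le> m"
  shows "\<exists>r c. a < r \<and> r < b \<and> 0 < c \<and> c \<le> 1 \<and> (\<forall>n. \<forall>d\<in>D n. c * q ^ n \<le> \<bar>r - d\<bar>)"
proof -
  \<comment> \<open>The second term brings the total length down to at most
    \<open>(b - a) / 2\<close>; using m + 1 avoids a zero denominator.\<close>
  define c where "c = min 1 ((b - a) * (1 - q) / (4 * (real m + 1)))"
  have c: "0 < c" "c \<le> 1" "c \<le> (b - a) * (1 - q) / (4 * (real m + 1))"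
    using assms by (auto simp: c_def)
  define A where "A = (\<lambda>n. \<Union>d\<in>D n. {d - c * q ^ n..d + c * q ^ n})"
  have A: "A n \<in> sets lborel" for n unfolding A_def using D(1) by auto
  have eA: "emeasure lborel (A n) \<le> ennreal (real m * (2 * c) * q ^ n)" for n
  proof -
    have "emeasure lborel (A n) \<le> (\<Sum>d\<in>D n. emeasure lborel {d - c * q ^ n..d + c * q ^ n})"
      unfolding A_def using D(1) by (intro emeasure_subadditive_finite) auto
    also have "\<dots> = (\<Sum>d\<in>D n. ennreal (2 * c * q ^ n))"
      using c assms by (intro sum.cong) auto
    also have "\<dots> = ennreal (real (card (D n)) * (2 * c * q ^ n))"
      using c assms by (subst sum_ennreal) auto
    also have "\<dots> \<le> ennreal (real m * (2 * c * q ^ n))"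
      using c assms D(2) by (intro ennreal_leI mult_right_mono) auto
    finally show ?thesis by (simp add: mult.assoc)
  qed
  have sums: "(\<lambda>n. real m * (2 * c) * q ^ n) sums (real m * (2 * c) * (1 / (1 - q)))"
    using assms by (intro sums_mult geometric_sums) auto
  have "emeasure lborel (\<Union>n. A n) \<le> (\<Sum>n. emeasure lborel (A n))"
    using A by (intro emeasure_subadditive_countably) auto
  also have "\<dots> \<le> (\<Sum>n. ennreal (real m * (2 * c) * q ^ n))"
    using eA by (intro suminf_le) auto
  also have "\<dots> = ennreal (real m * (2 * c) * (1 / (1 - q)))"
    using c assms sums by (subst suminf_ennreal2) (auto simp: sums_iff)
  also have "\<dots> < ennreal (b - a)"
  proof (rule ennreal_lessI)
    have "real m * (2 * c) * (1 / (1 - q)) \<le> (real m + 1) * (2 * ((b - a) * (1 - q) / (4 * (real m + 1)))) * (1 / (1 - q))"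
      using c assms by (intro mult_mono) auto
    also have "\<dots> = (b - a) / 2"
    proof -
      have *: "t * (2 * (x * y / (4 * t))) * (1 / y) = x / 2" if "t \<noteq> 0" "y \<noteq> 0" for t x y :: real
        using that by (simp add: field_simps)
      show ?thesis by (rule *) (use assms in auto)
    qed
    also have "\<dots> < b - a" using assms by simp
    finally show "real m * (2 * c) * (1 / (1 - q)) < b - a" .
  qed (use assms in auto)
  also have "\<dots> = emeasure lborel {a<..<b}" using assms by simp
  finally have less: "emeasure lborel (\<Union>n. A n) < emeasure lborel {a<..<b}" .
  have "\<not> {a<..<b} \<subseteq> (\<Union>n. A n)"
  proof
    assume "{a<..<b} \<subseteq> (\<Union>n. A n)"
    then have "emeasure lborel {a<..<b} \<le> emeasure lborel (\<Union>n. A n)"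
      using A by (intro emeasure_mono) auto
    then show False using less by simp
  qed
  then obtain r where r0: "r \<in> {a<..<b}" and r1: "r \<notin> (\<Union>n. A n)" by blast
  then have r: "a < r" "r < b" "r \<notin> (\<Union>n. A n)" by simp_all
  have "c * q ^ n \<le> \<bar>r - d\<bar>" if "d \<in> D n" for n d
    using r(3) that by (force simp: A_def)
  then show ?thesis using r c by blast
qed

subsection \<open>Pade denominators\<close>

context disc_series
begin

lemma eval_conv: "cmod z < 1 \<Longrightarrow> ereal (cmod z) < fps_conv_radius F"
  using less_le_trans[OF _ conv] by simp

lemma f_expansion: "f has_fps_expansion F"
proof (rule eval_fps_has_fps_expansion)
  show "0 < fps_conv_radius F" using eval_conv[of 0] by (simp add: zero_ereal_def)
qed

lemma f_bounded:
  assumes "r < 1"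
  obtains U where "U > 0" "\<And>z. cmod z \<le> r \<Longrightarrow> cmod (f z) \<le> U"
proof -
  have "cball 0 r \<subseteq> ball (0::complex) 1" using assms by auto
  then have "continuous_on (cball 0 r) f"
    by (intro holomorphic_on_imp_continuous_on holomorphic_on_subset[OF hol_f])
  then have "bounded (f ` cball 0 r)" by (intro compact_imp_bounded compact_continuous_image) auto
  then obtain U where "U > 0" "\<forall>x\<in>f ` cball 0 r. cmod x \<le> U" unfolding bounded_pos by blast
  then show ?thesis by (intro that[of U]) auto
qed

section \<open>Normalised Pade pairs and the size of their denominators\<close>

definition remainder :: "complex poly \<Rightarrow> complex poly \<Rightarrow> complex fps" where
  "remainder P Q = F * fps_of_poly Q - fps_of_poly P"

lemma eval_remainder:
  assumes "cmod z < 1"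
  shows "eval_fps (remainder P Q) z = f z * poly Q z - poly P z"
proof -
  have "ereal (cmod z) < fps_conv_radius (F * fps_of_poly Q)"
    using eval_conv[OF assms] fps_conv_radius_mult[of F "fps_of_poly Q"] by (auto intro: less_le_trans)
  then show ?thesis unfolding remainder_def
    using eval_conv[OF assms] by (subst eval_fps_diff) (auto simp: eval_fps_mult)
qed

lemma conv_remainder: "fps_conv_radius (remainder P Q) \<ge> 1"
proof -
  have "1 \<le> fps_conv_radius (F * fps_of_poly Q)"
    using conv fps_conv_radius_mult[of F "fps_of_poly Q"] by (auto intro: order_trans)
  then show ?thesis unfolding remainder_def
    using fps_conv_radius_diff[of "F * fps_of_poly Q" "fps_of_poly P"] by (auto intro: order_trans)
qed

lemma pade_nth:
  assumes "is_pade F m n P Q" "j \<le> m + n"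
  shows "fps_nth (remainder P Q) j = 0"
  using assms by (simp add: is_pade_def remainder_def)

lemma mult_vanishing:
  fixes A B :: "complex fps"
  assumes "\<And>j. j \<le> N \<Longrightarrow> fps_nth A j = 0" "j \<le> N"
  shows "fps_nth (A * B) j = 0" "fps_nth (B * A) j = 0"
  using assms by (auto simp: fps_mult_nth intro!: sum.neutral)

text \<open>With P = 0 the product \<open>F * Q\<close> would vanish through order m + n. Since F is
  a unit, so would Q, whose degree is at most n.\<close>

lemma pade_numerator_nonzero:
  assumes "is_pade F m n P Q"
  shows "P \<noteq> 0"
proof
  assume "P = 0"
  have "Q \<noteq> 0" "degree Q \<le> n" using assms by (auto simp: is_pade_def)
  have van: "fps_nth (F * fps_of_poly Q) j = 0" if "j \<le> m + n" for j
    using pade_nth[OF assms that] \<open>P = 0\<close> by (simp add: remainder_def)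
  have "fps_of_poly Q = inverse F * (F * fps_of_poly Q)"
    using inverse_mult_eq_1[OF nz0] by (simp add: mult.assoc[symmetric])
  then have "coeff Q j = 0" if "j \<le> m + n" for j
    using mult_vanishing(2)[OF van that, where B = "inverse F"] by (metis fps_of_poly_nth)
  then have "coeff Q (degree Q) = 0" using \<open>degree Q \<le> n\<close> by simp
  then show False using \<open>Q \<noteq> 0\<close> by simp
qed

definition normalised_pade :: "nat \<Rightarrow> nat \<Rightarrow> complex poly \<Rightarrow> complex poly \<Rightarrow> bool" where
  "normalised_pade m n P Q \<longleftrightarrow> is_pade F m n P Q \<and> coeff_norm P = 1"

lemma normalise_pade:
  assumes "is_pade F m n P Q"
  obtains c where "c \<noteq> 0" "normalised_pade m n (smult c P) (smult c Q)"
proof -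
  define x where "x = coeff_norm P"
  have x: "x > 0" unfolding x_def using pade_numerator_nonzero[OF assms] by (rule coeff_norm_pos)
  define c where "c = complex_of_real (1 / x)"
  have "F * fps_of_poly (smult c Q) - fps_of_poly (smult c P) = fps_const c * (F * fps_of_poly Q - fps_of_poly P)"
    by (simp add: fps_of_poly_smult algebra_simps)
  then have "is_pade F m n (smult c P) (smult c Q)"
    using assms x by (simp add: is_pade_def c_def)
  moreover have "coeff_norm (smult c P) = 1" using x by (simp add: coeff_norm_smult c_def x_def norm_divide)
  ultimately show ?thesis using x by (intro that[of c]) (auto simp: normalised_pade_def c_def)
qed

lemma has_fps_expansion_poly: "poly Q has_fps_expansion fps_of_poly Q"
proof -
  have "eval_fps (fps_of_poly Q) = poly Q" by (rule ext) simp
  then show ?thesis using eval_fps_has_fps_expansion[of "fps_of_poly Q"] by simp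
qed

lemma poly_coeff_bound:
  assumes "0 < \<rho>" "\<And>z. cmod z \<le> \<rho> \<Longrightarrow> cmod (poly Q z) \<le> U"
  shows "cmod (coeff Q i) \<le> U / \<rho> ^ i"
proof -
  have "cmod (coeff Q i) = cmod ((deriv ^^ i) (poly Q) 0) / fact i"
    using arg_cong[OF fps_nth_fps_expansion[OF has_fps_expansion_poly, of Q i], of cmod] by (simp add: norm_divide)
  also have "\<dots> \<le> fact i * U / \<rho> ^ i / fact i"
    using assms by (intro divide_right_mono Cauchy_inequality) (auto intro!: holomorphic_intros continuous_intros)
  finally show ?thesis by simp
qed

text \<open>If Q stayed below c on the whole disc, Cauchy's estimates would make its coefficients
  small, and with them the first m + 1 coefficients of f Q, which are those of P. The constant A
  depends only on F, m and \<rho>, so one c serves all n, and \<open>A * c < 1\<close> contradicts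
  the normalisation.\<close>

lemma pade_denominator_lower:
  assumes "0 < \<rho>" "\<rho> < 1"
  obtains c where "c > 0" "\<And>n P Q. normalised_pade m n P Q \<Longrightarrow> \<exists>z. cmod z \<le> \<rho> \<and> c \<le> cmod (poly Q z)"
proof -
  define A where "A = (\<Sum>j\<le>m. \<Sum>i\<le>j. cmod (fps_nth F (j - i)) / \<rho> ^ i)"
  have A: "A \<ge> 0" unfolding A_def using assms by (intro sum_nonneg) auto
  define c where "c = 1 / (A + 1)"
  show ?thesis
  proof (rule that[of c])
    show "c > 0" using A by (simp add: c_def)
    fix n P Q assume np: "normalised_pade m n P Q"
    show "\<exists>z. cmod z \<le> \<rho> \<and> c \<le> cmod (poly Q z)"
    proof (rule ccontr)
      assume "\<not> ?thesis"
      then have "cmod (poly Q z) \<le> c" if "cmod z \<le> \<rho>" for z using that by (meson linear)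
      note Qi = poly_coeff_bound[OF assms(1) this]
      have deg: "degree P \<le> m" using np by (simp add: normalised_pade_def is_pade_def)
      have "cmod (coeff P j) \<le> (\<Sum>i\<le>j. cmod (fps_nth F (j - i)) / \<rho> ^ i) * c" if "j \<le> m" for j
      proof -
        have "coeff P j = fps_nth (fps_of_poly Q * F) j"
          using pade_nth[of m n P Q j] np that by (simp add: normalised_pade_def remainder_def mult.commute)
        then have "cmod (coeff P j) \<le> (\<Sum>i\<le>j. cmod (coeff Q i * fps_nth F (j - i)))"
          by (simp add: fps_mult_nth atLeast0AtMost norm_sum)
        also have "\<dots> \<le> (\<Sum>i\<le>j. c / \<rho> ^ i * cmod (fps_nth F (j - i)))"
          unfolding norm_mult by (intro sum_mono mult_right_mono Qi) auto
        finally show ?thesis unfolding sum_distrib_right by (simp add: mult.commute)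
      qed
      then have "coeff_norm P \<le> (\<Sum>j\<le>m. (\<Sum>i\<le>j. cmod (fps_nth F (j - i)) / \<rho> ^ i) * c)"
        unfolding coeff_norm_eq[OF deg] by (intro sum_mono) auto
      also have "\<dots> = A * c" by (simp add: A_def sum_distrib_right)
      also have "\<dots> < 1" using A by (simp add: c_def)
      finally show False using np by (simp add: normalised_pade_def)
    qed
  qed
qed

text \<open>Let \<open>B\<close> be the polynomial of the zeros inside the disc of radius \<open>S\<close>. Since \<open>B / f\<close> is holomorphic
  there, \<open>B Q\<close> agrees with the Taylor polynomial of \<open>(B / f) P\<close> of degree \<open>m + n\<close>.\<close>

lemma pade_denominator_upper:
  fixes \<epsilon> :: real
  assumes "0 < S" "S < 1" and h: "h holomorphic_on ball 0 1" "\<And>z. z \<in> ball 0 S \<Longrightarrow> h z \<noteq> 0"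
    and fh: "\<And>z. z \<in> ball 0 1 \<Longrightarrow> f z = (\<Prod>w\<in>#W. z - w) * h z"
    and W: "size W \<le> m" "\<And>w. w \<in># W \<Longrightarrow> cmod w < S"
    and "\<epsilon> > 0"
  shows "eventually (\<lambda>n. \<forall>P Q. normalised_pade m n P Q \<longrightarrow>
     (\<forall>z. cmod z \<le> S \<longrightarrow> cmod (poly Q z) \<le> exp (\<epsilon> * n))) sequentially"
proof -
  define k where "k = (\<lambda>z. 1 / h z)"
  \<comment> \<open>\<open>h\<close> may vanish on the circle of radius S, so \<open>1 / h\<close>
    is bounded only on smaller circles. Cauchy's estimates on this one lose
    \<open>(S / r) ^ (m + n)\<close>, which takes half of the admissible exponent.\<close>
  define r where "r = S * exp (- (\<epsilon> / 2))"
  have r: "0 < r" "r < S" "S / r = exp (\<epsilon> / 2)" using assms by (auto simp: r_def exp_minus field_simps)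
  have sub: "ball 0 S \<subseteq> ball (0::complex) 1" using assms by auto
  have hol_k: "k holomorphic_on ball 0 S" unfolding k_def
    using h by (intro holomorphic_intros holomorphic_on_subset[OF h(1) sub]) auto
  define K where "K = fps_expansion k 0"
  have K: "k has_fps_expansion K" unfolding K_def
    using assms(1) hol_k by (intro analytic_at_imp_has_fps_expansion_0) (auto simp: analytic_at intro!: exI[of _ "ball 0 S"])
  define B where "B = (\<Prod>w\<in>#W. [:-w, 1:])"
  have B: "poly B z = (\<Prod>w\<in>#W. z - w)" for z unfolding B_def by (induction W) (auto simp: algebra_simps)
  have dB: "degree B = size W"
  proof -
    have "degree (\<Prod>w\<in>#W. [:-w, 1:]) = size W \<and> (\<Prod>w\<in>#W. [:-w, 1:]) \<noteq> 0"
      by (induction W) (auto simp: degree_mult_eq simp del: mult_pCons_left)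
    then show ?thesis by (simp add: B_def)
  qed
  have FK: "F * K = fps_of_poly B"
  proof (rule fps_expansion_unique_complex)
    show "(\<lambda>z. f z * k z) has_fps_expansion F * K" by (intro has_fps_expansion_mult f_expansion K)
    have "eventually (\<lambda>z. z \<in> ball 0 S) (nhds (0::complex))"
      using assms(1) by (intro eventually_nhds_in_open) auto
    then have "eventually (\<lambda>z. f z * k z = poly B z) (nhds 0)"
      by eventually_elim (use h(2) fh sub in \<open>auto simp: B k_def\<close>)
    then show "(\<lambda>z. f z * k z) has_fps_expansion fps_of_poly B"
      using has_fps_expansion_poly by (subst has_fps_expansion_cong) auto
  qed
  obtain C where C: "C > 0" "\<And>z. cmod z = r \<Longrightarrow> cmod (k z) \<le> C"
  proof -
    have "continuous_on (sphere 0 r) k"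
      using r by (intro holomorphic_on_imp_continuous_on holomorphic_on_subset[OF hol_k]) auto
    then have "bounded (k ` sphere 0 r)" by (intro compact_imp_bounded compact_continuous_image) auto
    then obtain C where "C > 0" "\<forall>x\<in>k ` sphere 0 r. cmod x \<le> C" unfolding bounded_pos by blast
    then show ?thesis by (intro that[of C]) auto
  qed
  have Kj: "cmod (fps_nth K j) \<le> C / r ^ j" for j
  proof -
    have "cmod (fps_nth K j) = cmod ((deriv ^^ j) k 0) / fact j"
      using fps_nth_fps_expansion[OF K, of j] by (simp add: norm_divide)
    also have "\<dots> \<le> fact j * C / r ^ j / fact j"
    proof (intro divide_right_mono Cauchy_inequality)
      have "cball 0 r \<subseteq> ball (0::complex) S" using r by auto
      then show "k holomorphic_on ball 0 r" "continuous_on (cball 0 r) k"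
        using ball_subset_cball[of "0::complex" r] hol_k
        by (meson holomorphic_on_subset holomorphic_on_imp_continuous_on order_trans)+
    qed (use r C in auto)
    finally show ?thesis by simp
  qed
  \<comment> \<open>The zeros in W lie strictly inside the circle, so B stays away from 0 on it and
    can be divided out.\<close>
  define b where "b = (\<Prod>w\<in>#W. S - cmod w)"
  have b: "b > 0" unfolding b_def using W(2) by (induction W) auto
  have Bb: "b \<le> cmod (poly B z)" if "cmod z = S" for z
    unfolding B norm_prod_mset b_def
    using W(2) that norm_triangle_ineq2[of z] by (intro prod_mset_mono_nonneg[THEN conjunct2]) (auto simp: less_imp_le)
  have bound: "cmod (poly Q z) \<le> C / b * (real m + real n + 1) * exp (\<epsilon> / 2 * (real m + real n))"
    if np: "normalised_pade m n P Q" and z: "cmod z \<le> S" for n P Q z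
  proof (rule max_modulus_disc[OF _ _ z])
    show "poly Q holomorphic_on ball 0 1" by (intro holomorphic_intros)
    fix z assume z: "cmod z = S"
    have ip: "is_pade F m n P Q" and nP: "coeff_norm P = 1" using np by (auto simp: normalised_pade_def)
    have deg: "degree (B * Q) \<le> m + n"
      using degree_mult_le[of B Q] dB W(1) ip by (simp add: is_pade_def)
    have coeff: "cmod (coeff (B * Q) j) \<le> C / r ^ j" if "j \<le> m + n" for j
    proof -
      have "fps_of_poly (B * Q) = K * remainder P Q + K * fps_of_poly P"
        by (simp add: fps_of_poly_mult FK[symmetric] remainder_def algebra_simps)
      then have "fps_nth (fps_of_poly (B * Q)) j = fps_nth (K * remainder P Q + K * fps_of_poly P) j" by simp
      then have "coeff (B * Q) j = fps_nth (K * fps_of_poly P) j"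
        using mult_vanishing(2)[OF pade_nth[OF ip] that, where B = K] by simp
      then have "cmod (coeff (B * Q) j) \<le> (\<Sum>i\<le>j. cmod (fps_nth K i * coeff P (j - i)))"
        by (simp add: fps_mult_nth atLeast0AtMost norm_sum)
      also have "\<dots> \<le> (\<Sum>i\<le>j. C / r ^ j * cmod (coeff P (j - i)))"
      proof (intro sum_mono)
        fix i assume "i \<in> {..j}"
        then have "r ^ j \<le> r ^ i" using r assms by (intro power_decreasing) auto
        then have "C / r ^ i \<le> C / r ^ j" using r C by (intro divide_left_mono) auto
        then show "cmod (fps_nth K i * coeff P (j - i)) \<le> C / r ^ j * cmod (coeff P (j - i))"
          unfolding norm_mult using Kj[of i] by (intro mult_right_mono) auto
      qed
      also have "\<dots> = C / r ^ j * (\<Sum>i\<le>j. cmod (coeff P (j - i)))" by (simp add: sum_distrib_left)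
      also have "\<dots> \<le> C / r ^ j * 1"
      proof (rule mult_left_mono)
        have "(\<Sum>i\<le>j. cmod (coeff P (j - i))) = (\<Sum>i\<le>j. cmod (coeff P i))"
          by (rule sum.reindex_bij_witness[of _ "\<lambda>i. j - i" "\<lambda>i. j - i"]) auto
        also have "\<dots> \<le> (\<Sum>i\<le>max j (degree P). cmod (coeff P i))" by (rule sum_mono2) auto
        also have "\<dots> = 1" using nP coeff_norm_eq[of P "max j (degree P)"] by simp
        finally show "(\<Sum>i\<le>j. cmod (coeff P (j - i))) \<le> 1" .
      qed (use C r in simp)
      finally show ?thesis by simp
    qed
    have "poly (B * Q) z = (\<Sum>j\<le>m + n. coeff (B * Q) j * z ^ j)"
      unfolding poly_altdef using deg by (intro sum.mono_neutral_left) (auto simp: coeff_eq_0)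
    then have "cmod (poly (B * Q) z) \<le> (\<Sum>j\<le>m + n. cmod (coeff (B * Q) j * z ^ j))"
      by (simp add: norm_sum)
    also have "\<dots> \<le> (\<Sum>j\<le>m + n. C * exp (\<epsilon> / 2 * (real m + real n)))"
    proof (rule sum_mono)
      fix j assume j: "j \<in> {..m + n}"
      have "cmod (coeff (B * Q) j * z ^ j) \<le> C / r ^ j * S ^ j"
        unfolding norm_mult norm_power z using coeff j assms by (intro mult_right_mono) auto
      also have "\<dots> = C * (S / r) ^ j" by (simp add: power_divide)
      also have "\<dots> \<le> C * (S / r) ^ (m + n)"
        using C r j \<open>\<epsilon> > 0\<close> by (intro mult_left_mono power_increasing) auto
      also have "(S / r) ^ (m + n) = exp (\<epsilon> / 2 * (real m + real n))"
        unfolding r(3) by (simp add: exp_of_nat_mult[symmetric] mult.commute)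
      finally show "cmod (coeff (B * Q) j * z ^ j) \<le> C * exp (\<epsilon> / 2 * (real m + real n))" .
    qed
    also have "\<dots> = C * (real m + real n + 1) * exp (\<epsilon> / 2 * (real m + real n))" by (simp add: algebra_simps)
    finally have 1: "cmod (poly B z) * cmod (poly Q z) \<le> C * (real m + real n + 1) * exp (\<epsilon> / 2 * (real m + real n))"
      by (simp add: norm_mult)
    have "b * cmod (poly Q z) \<le> cmod (poly B z) * cmod (poly Q z)" using Bb[OF z] by (rule mult_right_mono) simp
    with 1 have "b * cmod (poly Q z) \<le> C * (real m + real n + 1) * exp (\<epsilon> / 2 * (real m + real n))" by linarith
    then show "cmod (poly Q z) \<le> C / b * (real m + real n + 1) * exp (\<epsilon> / 2 * (real m + real n))"
      using b by (simp add: field_simps)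
  qed (use assms in auto)
  have "C / b > 0" using C b by simp
  then have "eventually (\<lambda>n. C / b * (real m + real n + 1) * exp (\<epsilon> / 2 * (real m + real n)) \<le> exp (\<epsilon> * real n)) sequentially"
    using \<open>\<epsilon> > 0\<close> by real_asymp
  then show ?thesis
    by eventually_elim (use bound in \<open>blast intro: order_trans\<close>)
qed

text \<open>The cross product is a combination of the two remainders, so its coefficients below
  index m + n + 1 vanish, and its degree is at most that index. Only \<open>P * Q'\<close> can reach
  that degree.\<close>

lemma pade_cross:
  assumes "is_pade F m (Suc n) P' Q'" "is_pade F m n P Q"
  shows "poly (P' * Q - P * Q') z = - (coeff P m * coeff Q' (Suc n)) * z ^ (m + Suc n)"
proof -
  define X where "X = P' * Q - P * Q'"
  have deg: "degree P \<le> m" "degree P' \<le> m" "degree Q \<le> n" "degree Q' \<le> Suc n"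
    using assms by (auto simp: is_pade_def)
  have "degree (P' * Q) \<le> m + n" "degree (P * Q') \<le> m + Suc n"
    using degree_mult_le[of P' Q] degree_mult_le[of P Q'] deg by linarith+
  then have dX: "degree X \<le> m + Suc n" and top: "coeff (P' * Q) (m + Suc n) = 0"
    unfolding X_def by (auto intro!: degree_diff_le coeff_eq_0)
  have "fps_of_poly X = remainder P Q * fps_of_poly Q' - remainder P' Q' * fps_of_poly Q"
    by (simp add: X_def remainder_def fps_of_poly_diff fps_of_poly_mult algebra_simps)
  then have "fps_nth (fps_of_poly X) j = 0" if "j \<le> m + n" for j
    using mult_vanishing(1)[OF pade_nth[OF assms(2)] that, where B = "fps_of_poly Q'"]
      mult_vanishing(1)[OF pade_nth[OF assms(1)], where j = j and B = "fps_of_poly Q"] that by simp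
  then have low: "coeff X j = 0" if "j < m + Suc n" for j using that by simp
  have "poly X z = (\<Sum>j\<le>m + Suc n. coeff X j * z ^ j)"
    unfolding poly_altdef using dX by (intro sum.mono_neutral_left) (auto simp: coeff_eq_0)
  also have "\<dots> = (\<Sum>j\<in>{m + Suc n}. coeff X j * z ^ j)"
    by (rule sum.mono_neutral_right) (auto simp: low)
  finally have "poly X z = coeff X (m + Suc n) * z ^ (m + Suc n)" by simp
  moreover have "coeff X (m + Suc n) = - (coeff P m * coeff Q' (Suc n))"
    unfolding X_def coeff_diff top using coeff_mult_top[OF deg(1,4)] by simp
  ultimately show ?thesis unfolding X_def by simp
qed

end

section \<open>Leading coefficients along a subsequence, and clustering\<close>

context disc_series
begin

text \<open>If the leading coefficients were small from some point on, the telescoping sum of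
  \<open>Q\<^sub>n\<^sub>+\<^sub>1 / P\<^sub>n\<^sub>+\<^sub>1 - Q\<^sub>n / P\<^sub>n\<close> would make the denominators grow only linearly on a circle of radius
  \<open>r > S\<close>. Then \<open>f Q\<^sub>n - P\<^sub>n\<close> tends to 0 on a disc containing more than \<open>m\<close> zeros of \<open>f\<close>, which is
  impossible for normalised numerators of degree at most \<open>m\<close>.\<close>

lemma pade_leading_coeff:
  assumes S: "0 < S" "S < 1" and h: "h holomorphic_on ball 0 1"
    and fh: "\<And>z. z \<in> ball 0 1 \<Longrightarrow> f z = (\<Prod>w\<in>#W. z - w) * h z"
    and W: "size W > m" "\<And>w. w \<in># W \<Longrightarrow> cmod w \<le> S"
    and \<theta>: "\<theta> > 0" "\<theta> * S < 1"
  shows "\<exists>n\<ge>N. \<forall>P Q. normalised_pade m n P Q \<longrightarrow> \<theta> ^ n < cmod (coeff Q n)"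
proof (rule ccontr)
  assume "\<not> ?thesis"
  then have "\<forall>n. \<exists>P Q. n \<ge> N \<longrightarrow> normalised_pade m n P Q \<and> cmod (coeff Q n) \<le> \<theta> ^ n"
    by (meson linorder_not_le)
  then obtain P Q where "\<forall>n. n \<ge> N \<longrightarrow> normalised_pade m n (P n) (Q n) \<and> cmod (coeff (Q n) n) \<le> \<theta> ^ n"
    by metis
  then have pade: "is_pade F m n (P n) (Q n)" and nP: "coeff_norm (P n) = 1"
    and small: "cmod (coeff (Q n) n) \<le> \<theta> ^ n" if "n \<ge> N" for n
    using that by (auto simp: normalised_pade_def)
  have dP: "degree (P n) \<le> m" if "n \<ge> N" for n using pade[OF that] by (simp add: is_pade_def)
  have P0: "P n \<noteq> 0" if "n \<ge> N" for n using pade_numerator_nonzero[OF pade[OF that]] .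
  \<comment> \<open>T lies above S but below both 1 and \<open>1 / \<theta>\<close>: circles up to T
    remain in the unit disc and \<open>\<theta> * T < 1\<close>.\<close>
  define T where "T = min ((1 + S) / 2) ((S + 1 / \<theta>) / 2)"
  have "S < 1 / \<theta>" using \<theta> by (simp add: field_simps)
  then have T: "S < T" "T < 1" "T < 1 / \<theta>" using S by (auto simp: T_def min_def field_simps)
  have "T > 0" using T S by simp
  have \<theta>T: "0 < \<theta> * T" "\<theta> * T < 1" using T(3) \<theta>(1) \<open>T > 0\<close> by (simp_all add: field_simps)
  \<comment> \<open>The telescoped differences are of size \<open>(\<theta> * T) ^ n\<close> divided
    by 2 m factors of order \<open>q ^ n\<close>, m for each of the two numerators. The root of
    order 2 m + 1 pays for all of them and leaves one factor \<open>q ^ n\<close>.\<close>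
  define q where "q = root (2 * m + 1) (\<theta> * T)"
  have q: "0 < q" "q < 1" "q ^ (2 * m + 1) = \<theta> * T"
    using \<theta>T by (simp_all add: q_def real_root_lt_1_iff del: power_Suc)
  \<comment> \<open>The moduli to be avoided: those of the zeros of the n-th numerator, at most m of
    them. Before N, where nothing is known about \<open>P n\<close>, the set is empty.\<close>
  define D where "D = (\<lambda>n. if n \<ge> N then cmod ` {w. poly (P n) w = 0} else {})"
  have "finite (D n)" "card (D n) \<le> m" for n
  proof -
    show "finite (D n)" using P0[of n] by (auto simp: D_def poly_roots_finite)
    show "card (D n) \<le> m"
    proof (cases "n \<ge> N")
      case True
      have "card (D n) \<le> card {w. poly (P n) w = 0}"
        using True P0[OF True] by (auto simp: D_def intro!: card_image_le poly_roots_finite)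
      also have "\<dots> \<le> degree (P n)" using P0[OF True] by (rule card_poly_roots_bound)
      finally show ?thesis using dP[OF True] by simp
    qed (simp add: D_def)
  qed
  from avoid_shrinking_intervals[where D = D, OF T(1) q(1,2) this]
  obtain r c where r: "S < r" "r < T" and c: "0 < c" "c \<le> 1"
    and away: "\<And>n d. d \<in> D n \<Longrightarrow> c * q ^ n \<le> \<bar>r - d\<bar>" by blast
  have r1: "0 < r" "r < 1" using r S T by auto
  \<comment> \<open>The 3 bounds \<open>1 + cmod w\<close> for zeros with
    \<open>cmod w \<le> 2\<close>. For the others \<open>\<kappa> n \<le> 1 / 3\<close> is enough,
    because \<open>(1 + x) / 3 \<le> x - 1\<close> once \<open>x \<ge> 2\<close>.\<close>
  define \<kappa> where "\<kappa> = (\<lambda>n. c / 3 * q ^ n)"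
  have \<kappa>: "0 < \<kappa> n" "\<kappa> n \<le> 1 / 3" for n
  proof -
    show "0 < \<kappa> n" using c q by (simp add: \<kappa>_def)
    have "c * q ^ n \<le> 1 * 1" using c q by (intro mult_mono power_le_one) auto
    then show "\<kappa> n \<le> 1 / 3" by (simp add: \<kappa>_def)
  qed
  have Plow: "\<kappa> n ^ m \<le> cmod (poly (P n) z)" if n: "n \<ge> N" and z: "cmod z = r" for n z
  proof -
    have "\<kappa> n ^ m \<le> \<kappa> n ^ degree (P n)"
      using dP[OF n] \<kappa>[of n] by (intro power_decreasing) auto
    also have "\<dots> = \<kappa> n ^ degree (P n) * coeff_norm (P n)" using nP[OF n] by simp
    also have "\<dots> \<le> cmod (poly (P n) z)"
    proof (rule poly_lower_bound)
      fix w assume "w \<in># proots (P n)"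
      then have "cmod w \<in> D n" using n P0[OF n] by (auto simp: D_def)
      then have 1: "3 * \<kappa> n \<le> \<bar>r - cmod w\<bar>" using away[of "cmod w" n] by (simp add: \<kappa>_def)
      have 2: "\<bar>r - cmod w\<bar> \<le> cmod (z - w)" using norm_triangle_ineq3[of z w] z by simp
      show "\<kappa> n * (1 + cmod w) \<le> cmod (z - w)"
      proof (cases "cmod w \<le> 2")
        case True
        have "\<kappa> n * (1 + cmod w) \<le> \<kappa> n * 3" using True \<kappa>[of n] by (intro mult_left_mono) auto
        then show ?thesis using 1 2 by linarith
      next
        case False
        have 3: "\<kappa> n * (1 + cmod w) \<le> 1 / 3 * (1 + cmod w)" using \<kappa>[of n] by (intro mult_right_mono) auto
        then have 3: "\<kappa> n * (1 + cmod w) \<le> 1 / 3 + cmod w / 3" by (simp add: field_simps)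
        have "k \<le> d" if "k \<le> 1 / 3 + x / 3" "\<bar>r - x\<bar> \<le> d" "2 < x" for k x d :: real
          using that r1 by linarith
        from this[OF 3 2] show ?thesis using False by simp
      qed
    qed (use \<kappa>[of n] in auto)
    finally show ?thesis .
  qed
  define E where "E = 1 / (c / 3) ^ (2 * m)"
  have E: "E > 0" using c by (simp add: E_def)
  have step: "cmod (poly (Q (Suc n)) z / poly (P (Suc n)) z - poly (Q n) z / poly (P n) z) \<le> E"
    if n: "n \<ge> N" and z: "cmod z = r" for n z
  proof -
    have n': "Suc n \<ge> N" using n by simp
    define x where "x = q ^ Suc n"
    have x: "0 < x" "x \<le> 1" using q by (auto simp: x_def power_le_one simp del: power_Suc)
    have nz: "poly (P n) z \<noteq> 0" "poly (P (Suc n)) z \<noteq> 0"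
      using Plow[OF n z] Plow[OF n' z] \<kappa>[of n] \<kappa>[of "Suc n"] by (smt (verit) norm_zero zero_less_power)+
    have "poly (Q (Suc n)) z / poly (P (Suc n)) z - poly (Q n) z / poly (P n) z =
       - poly (P (Suc n) * Q n - P n * Q (Suc n)) z / (poly (P n) z * poly (P (Suc n)) z)"
      using nz by (simp add: field_simps)
    also have "\<dots> = coeff (P n) m * coeff (Q (Suc n)) (Suc n) * z ^ (m + Suc n) / (poly (P n) z * poly (P (Suc n)) z)"
      unfolding pade_cross[OF pade[OF n'] pade[OF n]] by simp
    finally have "cmod (poly (Q (Suc n)) z / poly (P (Suc n)) z - poly (Q n) z / poly (P n) z) =
       cmod (coeff (P n) m) * cmod (coeff (Q (Suc n)) (Suc n)) * r ^ (m + Suc n) / (cmod (poly (P n) z) * cmod (poly (P (Suc n)) z))"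
      using z by (simp add: norm_mult norm_divide norm_power)
    also have "\<dots> \<le> 1 * \<theta> ^ Suc n * T ^ Suc n / (\<kappa> (Suc n) ^ m * \<kappa> (Suc n) ^ m)"
    proof (rule frac_le)
      have "r ^ (m + Suc n) \<le> r ^ Suc n" using r1 by (intro power_decreasing) auto
      also have "\<dots> \<le> T ^ Suc n" using r r1 by (intro power_mono) auto
      finally show "cmod (coeff (P n) m) * cmod (coeff (Q (Suc n)) (Suc n)) * r ^ (m + Suc n) \<le> 1 * \<theta> ^ Suc n * T ^ Suc n"
        using coeff_le_coeff_norm[of "P n" m] nP[OF n] small[OF n'] \<theta>(1) r1 \<open>T > 0\<close>
        by (intro mult_mono mult_nonneg_nonneg) auto
      have "\<kappa> (Suc n) \<le> \<kappa> n" unfolding \<kappa>_def using c q by (intro mult_left_mono power_decreasing) auto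
      then have "\<kappa> (Suc n) ^ m \<le> \<kappa> n ^ m" using \<kappa>[of "Suc n"] by (intro power_mono) auto
      then have "\<kappa> (Suc n) ^ m \<le> cmod (poly (P n) z)" using Plow[OF n z] by linarith
      then show "\<kappa> (Suc n) ^ m * \<kappa> (Suc n) ^ m \<le> cmod (poly (P n) z) * cmod (poly (P (Suc n)) z)"
        using Plow[OF n' z] \<kappa>[of "Suc n"] by (intro mult_mono) auto
      show "0 < \<kappa> (Suc n) ^ m * \<kappa> (Suc n) ^ m" using \<kappa>[of "Suc n"] by simp
      show "0 \<le> 1 * \<theta> ^ Suc n * T ^ Suc n" using \<theta>(1) \<open>T > 0\<close> by simp
    qed
    also have "1 * \<theta> ^ Suc n * T ^ Suc n = x ^ (2 * m + 1)"
      unfolding x_def power_mult[symmetric] mult.commute[of "Suc n"] power_mult q(3)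
      by (simp add: power_mult_distrib)
    also have "\<kappa> (Suc n) ^ m * \<kappa> (Suc n) ^ m = (c / 3) ^ (2 * m) * x ^ (2 * m)"
    proof -
      have "\<kappa> (Suc n) = c / 3 * x" by (simp only: \<kappa>_def x_def)
      moreover have "y ^ (2 * m) = y ^ m * y ^ m" for y :: real by (simp add: mult_2 power_add)
      ultimately show ?thesis by (simp only: power_mult_distrib mult_ac)
    qed
    also have "x ^ (2 * m + 1) / ((c / 3) ^ (2 * m) * x ^ (2 * m)) = x * E"
      using x by (simp add: E_def)
    \<comment> \<open>Bounded differences give ratios of linear growth, which the geometric decay of
      the remainders absorbs.\<close>
    also have "\<dots> \<le> 1 * E" using x E by (intro mult_right_mono) auto
    finally show ?thesis by simp
  qed
  define A where "A = coeff_norm (Q N) / \<kappa> N ^ m"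
  have A: "A \<ge> 0" using coeff_norm_nonneg \<kappa>[of N] by (simp add: A_def)
  have ratio: "cmod (poly (Q n) z / poly (P n) z) \<le> A + E * n" if "n \<ge> N" and z: "cmod z = r" for n z
    using that(1)
  proof (induction n rule: dec_induct)
    case base
    have "cmod (poly (Q N) z) / cmod (poly (P N) z) \<le> coeff_norm (Q N) / \<kappa> N ^ m"
      using Plow[OF order_refl z] \<kappa>[of N] coeff_norm_nonneg r1 z by (intro frac_le cmod_poly_le_coeff_norm) auto
    also have "\<dots> \<le> A + E * N" using E by (simp add: A_def)
    finally show ?case by (simp add: norm_divide)
  next
    case (step n)
    have "cmod (poly (Q (Suc n)) z / poly (P (Suc n)) z) \<le>
      cmod (poly (Q (Suc n)) z / poly (P (Suc n)) z - poly (Q n) z / poly (P n) z) + cmod (poly (Q n) z / poly (P n) z)"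
      using norm_triangle_sub by (simp add: add.commute)
    also have "\<dots> \<le> E + (A + E * n)"
      using \<open>n \<ge> N\<close> z step.IH by (intro add_mono \<open>\<And>z n. N \<le> n \<Longrightarrow> cmod z = r \<Longrightarrow> _ \<le> E\<close>) auto
    finally show ?case by (simp add: algebra_simps)
  qed
  obtain U where U: "U > 0" "\<And>z. cmod z \<le> r \<Longrightarrow> cmod (f z) \<le> U" using f_bounded[OF r1(2)] by blast
  \<comment> \<open>On the circle of radius r the remainder grows at most linearly in n, and it
    vanishes at 0 to order m + n + 1. On the smaller disc of radius \<rho>, which still contains all
    of W, it therefore decays like \<open>t ^ n\<close>.\<close>
  define \<rho> where "\<rho> = (S + r) / 2"
  have \<rho>: "S < \<rho>" "\<rho> < r" "0 < \<rho>" "\<rho> < 1" using r S r1 by (auto simp: \<rho>_def)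
  define t where "t = \<rho> / r"
  have t: "0 < t" "t < 1" using \<rho> r1 by (auto simp: t_def)
  define e where "e = (\<lambda>n. (U * (A + E * real n) + 1) * t ^ n)"
  have rem: "cmod (f z * poly (Q n) z - poly (P n) z) \<le> e n" if n: "n \<ge> N" and z: "cmod z \<le> \<rho>" for n z
  proof -
    have "cmod (eval_fps (remainder (P n) (Q n)) z) \<le> (U * (A + E * real n) + 1) * (cmod z / r) ^ (m + n + 1)"
    proof (rule eval_fps_vanishing_bound[OF conv_remainder])
      show "fps_nth (remainder (P n) (Q n)) j = 0" if "j < m + n + 1" for j
        using pade_nth[OF pade[OF n]] that by simp
      fix z assume z: "cmod z = r"
      have P1: "cmod (poly (P n) z) \<le> 1" using cmod_poly_le_coeff_norm[of z "P n"] nP[OF n] z r1 by simp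
      have "poly (P n) z \<noteq> 0" using Plow[OF n z] \<kappa>[of n] by (smt (verit) norm_zero zero_less_power)
      then have "cmod (poly (Q n) z) = cmod (poly (Q n) z / poly (P n) z) * cmod (poly (P n) z)"
        by (simp add: norm_divide)
      also have "\<dots> \<le> (A + E * n) * 1" using ratio[OF n z] P1 A E by (intro mult_mono) auto
      finally have Q1: "cmod (poly (Q n) z) \<le> A + E * n" by simp
      have "cmod (f z * poly (Q n) z - poly (P n) z) \<le> cmod (f z) * cmod (poly (Q n) z) + cmod (poly (P n) z)"
        by (metis norm_mult norm_triangle_ineq4)
      also have "\<dots> \<le> U * (A + E * n) + 1"
        using U(2)[of z] U(1) Q1 P1 z by (intro add_mono mult_mono) auto
      finally show "cmod (eval_fps (remainder (P n) (Q n)) z) \<le> U * (A + E * real n) + 1"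
        using z r1 by (simp add: eval_remainder)
    qed (use r1 z \<rho> in auto)
    also have "\<dots> \<le> (U * (A + E * real n) + 1) * t ^ n"
    proof (intro mult_left_mono)
      have "(cmod z / r) ^ (m + n + 1) \<le> t ^ (m + n + 1)"
        unfolding t_def using z r1 by (intro power_mono divide_right_mono) auto
      also have "\<dots> \<le> t ^ n" using t by (intro power_decreasing) auto
      finally show "(cmod z / r) ^ (m + n + 1) \<le> t ^ n" .
    qed (use U A E in auto)
    finally show ?thesis using z \<rho> by (simp add: eval_remainder e_def)
  qed
  \<comment> \<open>\<open>f * Q n\<close> is a multiple of the polynomial with roots W, while
    \<open>P n\<close> has degree at most m, less than \<open>size W\<close>. Being close to such a
    multiple forces \<open>P n\<close> to be small, against norm 1.\<close>
  have "cmod w < \<rho>" if "w \<in># W" for w using W(2)[OF that] \<rho> by linarith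
  from near_multiple_bound[OF this \<rho>(3,4)] obtain C where C: "C \<ge> 0"
    "\<And>P u e. P = 0 \<or> degree P < size W \<Longrightarrow> u holomorphic_on ball 0 1 \<Longrightarrow>
     (\<forall>z\<in>cball 0 \<rho>. cmod (poly P z - (\<Prod>w\<in>#W. z - w) * u z) \<le> e) \<Longrightarrow> coeff_norm P \<le> C * e"
    by blast
  have "1 \<le> C * e n" if n: "n \<ge> N" for n
  proof -
    have "coeff_norm (P n) \<le> C * e n"
    proof (rule C(2)[where u = "\<lambda>z. h z * poly (Q n) z"])
      show "(\<lambda>z. h z * poly (Q n) z) holomorphic_on ball 0 1" by (intro holomorphic_intros h)
      show "\<forall>z\<in>cball 0 \<rho>. cmod (poly (P n) z - (\<Prod>w\<in>#W. z - w) * (h z * poly (Q n) z)) \<le> e n"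
      proof
        fix z :: complex assume z: "z \<in> cball 0 \<rho>"
        then have "z \<in> ball 0 1" using \<rho> by simp
        from fh[OF this] have "poly (P n) z - (\<Prod>w\<in>#W. z - w) * (h z * poly (Q n) z) = - (f z * poly (Q n) z - poly (P n) z)"
          by simp
        then show "cmod (poly (P n) z - (\<Prod>w\<in>#W. z - w) * (h z * poly (Q n) z)) \<le> e n"
          using rem[OF n, of z] z by (simp only: norm_minus_cancel) simp
      qed
    qed (use dP[OF n] W(1) in auto)
    then show ?thesis using nP[OF n] by simp
  qed
  moreover have "(\<lambda>n. C * e n) \<longlonglongrightarrow> 0" unfolding e_def using t by real_asymp
  then have "eventually (\<lambda>n. C * e n < 1) sequentially" by (rule order_tendstoD) simp
  then obtain n0 where "\<forall>n\<ge>n0. C * e n < 1" unfolding eventually_sequentially by blast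
  ultimately show False by (meson max.cobounded1 max.cobounded2 not_less)
qed

text \<open>The definition of \<open>R m\<close> enters through two zero counts: W1, the zeros of
  the open disc, serves the upper bound, and W2, those of the closed disc, serves the leading
  coefficients. Hence both estimates refer to the same circle.\<close>

theorem pade_zeros_cluster:
  assumes "R m < 1"
  shows "\<exists>s. strict_mono s \<and> (\<forall>Q. (\<forall>l. pade_denominator F m (s l) (Q l)) \<longrightarrow> zeros_cluster Q (R m))"
proof -
  let ?S = "R m"
  have S: "0 < ?S" using R_pos .
  define Z1 where "Z1 = {z. z \<in> ball 0 ?S \<and> f z = 0}"
  define Z2 where "Z2 = {z. z \<in> cball 0 ?S \<and> f z = 0}"
  have fin: "finite Z1" "finite Z2"
    using finite_zeros[OF assms, of "ball 0 ?S"] finite_zeros[OF assms, of "cball 0 ?S"] by (auto simp: Z1_def Z2_def)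
  have sub: "Z1 \<subseteq> ball 0 1" "Z2 \<subseteq> ball 0 1" using assms by (auto simp: Z1_def Z2_def)
  obtain W1 h1 where W1: "set_mset W1 \<subseteq> Z1" "int (size W1) = (\<Sum>w\<in>Z1. zorder f w)" "h1 holomorphic_on ball 0 1"
    "\<And>z. z \<in> ball 0 1 \<Longrightarrow> f z = (\<Prod>w\<in>#W1. z - w) * h1 z" "\<And>w. w \<in> Z1 \<Longrightarrow> h1 w \<noteq> 0"
    by (rule divide_out_zeros_mset[OF hol_f open_ball connected_ball f_nonzero fin(1) sub(1)]) blast
  obtain W2 h2 where W2: "set_mset W2 \<subseteq> Z2" "int (size W2) = (\<Sum>w\<in>Z2. zorder f w)" "h2 holomorphic_on ball 0 1"
    "\<And>z. z \<in> ball 0 1 \<Longrightarrow> f z = (\<Prod>w\<in>#W2. z - w) * h2 z" "\<And>w. w \<in> Z2 \<Longrightarrow> h2 w \<noteq> 0"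
    by (rule divide_out_zeros_mset[OF hol_f open_ball connected_ball f_nonzero fin(2) sub(2)]) blast
  have size: "size W1 \<le> m" "m < size W2"
    using zeros_in_ball[OF assms] zeros_in_cball[OF assms] W1(2) W2(2) by (auto simp: Z1_def Z2_def)
  have h1: "h1 z \<noteq> 0" if "z \<in> ball 0 ?S" for z
  proof
    assume "h1 z = 0"
    moreover have "z \<in> ball 0 1" using that assms by simp
    ultimately have "z \<in> Z1" using that W1(4)[of z] by (simp add: Z1_def)
    then show False using W1(5) \<open>h1 z = 0\<close> by blast
  qed
  \<comment> \<open>\<open>\<theta> l * ?S\<close> is below 1, as \<open>pade_leading_coeff\<close>
    demands, but tends to 1, so the leading coefficients picked along the diagonal lose only a
    subexponential factor.\<close>
  define \<theta> where "\<theta> = (\<lambda>l::nat. exp (- 1 / (real l + 1)) / ?S)"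
  \<comment> \<open>Quantifying over all normalised pairs makes the subsequence independent of the
    choice of denominators.\<close>
  define G where "G = (\<lambda>l n. \<forall>P Q. normalised_pade m n P Q \<longrightarrow> \<theta> l ^ n < cmod (coeff Q n))"
  have G: "\<exists>n\<ge>N. G l n" for l N unfolding G_def
  proof (rule pade_leading_coeff[OF S assms W2(3,4) size(2)])
    show "\<theta> l > 0" "\<theta> l * ?S < 1" using S by (auto simp: \<theta>_def)
    show "cmod w \<le> ?S" if "w \<in># W2" for w using W2(1) that by (auto simp: Z2_def)
  qed
  obtain s where s: "\<And>l. G l (s l)" "\<And>l. s l < s (Suc l)"
    using dependent_nat_choice[of G "\<lambda>_ a b. a < b"] G by (metis Suc_le_lessD)
  have mono: "strict_mono s" using s(2) by (simp add: strict_mono_Suc_iff)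
  then have slim: "filterlim s at_top sequentially" by (rule filterlim_subseq)
  show ?thesis
  proof (intro exI[of _ s] conjI mono allI impI)
    fix Q assume "\<forall>l. pade_denominator F m (s l) (Q l)"
    then have "\<forall>l. \<exists>c P. c \<noteq> 0 \<and> normalised_pade m (s l) (smult c P) (smult c (Q l))"
      unfolding pade_denominator_def by (metis normalise_pade)
    then obtain c P where c: "\<And>l. c l \<noteq> 0" and np: "\<And>l. normalised_pade m (s l) (smult (c l) (P l)) (smult (c l) (Q l))"
      by metis
    define Q' where "Q' = (\<lambda>l. smult (c l) (Q l))"
    have lead: "\<theta> l ^ s l < cmod (coeff (Q' l) (s l))" for l
      using s(1)[of l] np[of l] unfolding G_def Q'_def by blast
    have \<theta>pos: "\<theta> l > 0" for l using S by (simp add: \<theta>_def)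
    \<comment> \<open>The bound concerns the coefficient of index s l; being positive, it makes this
      the leading one.\<close>
    have deg: "degree (Q' l) = s l" for l
    proof (rule antisym)
      show "degree (Q' l) \<le> s l" using np[of l] unfolding normalised_pade_def is_pade_def Q'_def by blast
      have "0 < cmod (coeff (Q' l) (s l))"
        using zero_less_power[OF \<theta>pos[of l]] lead[of l] by (rule less_trans)
      then have "coeff (Q' l) (s l) \<noteq> 0" by (simp only: zero_less_norm_iff not_False_eq_True)
      then show "s l \<le> degree (Q' l)" by (rule le_degree)
    qed
    interpret jentzsch_szego Q' "?S / 2" ?S
    proof
      show "0 < ?S / 2" "?S / 2 < ?S" using S by auto
      show "filterlim (\<lambda>l. degree (Q' l)) at_top sequentially" unfolding deg by (rule slim)
      fix \<epsilon> :: real assume \<epsilon>: "\<epsilon> > 0"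
      have "eventually (\<lambda>n. \<forall>P Q. normalised_pade m n P Q \<longrightarrow>
         (\<forall>z. cmod z \<le> ?S \<longrightarrow> cmod (poly Q z) \<le> exp (\<epsilon> * n))) sequentially"
        using W1(1) by (intro pade_denominator_upper[OF S assms W1(3) h1 W1(4) size(1) _ \<epsilon>]) (auto simp: Z1_def)
      from eventually_compose_filterlim[OF this slim]
      show "eventually (\<lambda>l. \<forall>z. cmod z = ?S \<longrightarrow> cmod (poly (Q' l) z) \<le> exp (\<epsilon> * degree (Q' l))) sequentially"
      proof eventually_elim
        case (elim l)
        then show ?case using np[of l] unfolding deg unfolding Q'_def by (metis order_refl)
      qed
      have "eventually (\<lambda>l. 1 / (real l + 1) < \<epsilon>) sequentially" using \<epsilon> by real_asymp
      then show "eventually (\<lambda>l. exp (- \<epsilon> * degree (Q' l)) \<le> cmod (lead_coeff (Q' l)) * ?S ^ degree (Q' l)) sequentially"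
      proof eventually_elim
        case (elim l)
        have "- \<epsilon> * s l \<le> - 1 / (real l + 1) * s l" using elim by (intro mult_right_mono) auto
        then have "exp (- \<epsilon> * s l) \<le> exp (- 1 / (real l + 1) * s l)" by simp
        also have "\<dots> = exp (- 1 / (real l + 1)) ^ s l" by (rule exp_of_nat2_mult)
        also have "\<dots> = (\<theta> l * ?S) ^ s l" using S by (simp add: \<theta>_def)
        also have "\<dots> \<le> cmod (coeff (Q' l) (s l)) * ?S ^ s l"
          unfolding power_mult_distrib using lead[of l] S by (intro mult_right_mono) auto
        finally show ?case unfolding deg .
      qed
      obtain b where b: "b > 0" "\<And>n P Q. normalised_pade m n P Q \<Longrightarrow> \<exists>z. cmod z \<le> ?S / 2 \<and> b \<le> cmod (poly Q z)"
        using pade_denominator_lower[of "?S / 2" m] S assms by auto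
      have "eventually (\<lambda>n. exp (- \<epsilon> * real n) \<le> b) sequentially" using b(1) \<epsilon> by real_asymp
      from eventually_compose_filterlim[OF this slim]
      show "eventually (\<lambda>l. \<exists>z. cmod z \<le> ?S / 2 \<and> exp (- \<epsilon> * degree (Q' l)) \<le> cmod (poly (Q' l) z)) sequentially"
      proof eventually_elim
        case (elim l)
        then show ?case using b(2)[OF np[of l]] unfolding deg unfolding Q'_def by (meson order_trans)
      qed
    qed
    have "root_measure (Q' l) B = root_measure (Q l) B" "degree (Q' l) = degree (Q l)" for l B
      using c[of l] by (simp_all add: root_measure_def Q'_def)
    then show "zeros_cluster Q ?S" using cluster by (simp add: zeros_cluster_def)
  qed
qed

end

subsection \<open>Linear combinations of the random coefficients\<close>

locale random_coefficients = prob_space M for M :: "'w measure" +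
  fixes a :: "nat \<Rightarrow> 'w \<Rightarrow> real" and K :: real
  assumes indep: "indep_vars (\<lambda>_. borel) a UNIV"
    and int: "\<And>j. integrable M (a j)"
    and mean: "\<And>j. expectation (a j) = 0"
    and int2: "\<And>j. integrable M (\<lambda>\<omega>. (a j \<omega>)\<^sup>2)"
    and var: "\<And>j. expectation (\<lambda>\<omega>. (a j \<omega>)\<^sup>2) = 1"
    and conc: "\<And>j \<epsilon>. \<epsilon> > 0 \<Longrightarrow> levy_conc M (a j) \<epsilon> \<le> K * \<epsilon>"
begin

lemma meas [measurable]: "a j \<in> borel_measurable M"
  using int by (rule borel_measurable_integrable)

text \<open>Chebyshev's inequality makes the exceptional probabilities summable. By Borel-Cantelli
  only finitely many coefficients exceed j + 1, and C absorbs these.\<close>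

lemma AE_linear_growth: "AE \<omega> in M. \<exists>C>0. \<forall>j. \<bar>a j \<omega>\<bar> \<le> C * (real j + 1)"
proof -
  let ?A = "\<lambda>j. {\<omega> \<in> space M. \<bar>a j \<omega>\<bar> \<ge> real j + 1}"
  have le: "prob (?A j) \<le> 1 / (real j + 1)\<^sup>2" for j
    using second_moment_method[of "a j" "real j + 1"] int2[of j] var[of j] by simp
  have "summable (\<lambda>j. 1 / (real j + 1)\<^sup>2)"
  proof -
    have "summable (\<lambda>n. inverse (real n ^ 2))" by (rule inverse_power_summable) simp
    then show ?thesis using summable_Suc_iff[of "\<lambda>n. inverse (real n ^ 2)"]
      by (simp add: inverse_eq_divide add.commute)
  qed
  then have "summable (\<lambda>j. prob (?A j))"
    by (rule summable_comparison_test'[where N = 0]) (use le in simp)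
  then have "AE \<omega> in M. eventually (\<lambda>j. \<omega> \<in> space M - ?A j) sequentially"
    by (intro borel_cantelli_AE1) (auto simp: emeasure_eq_measure)
  then show ?thesis
  proof eventually_elim
    case (elim \<omega>)
    then obtain n where n: "\<And>j. j \<ge> n \<Longrightarrow> \<bar>a j \<omega>\<bar> < real j + 1"
      unfolding eventually_sequentially by fastforce
    define C where "C = 1 + (\<Sum>j<n. \<bar>a j \<omega>\<bar>)"
    have C: "C \<ge> 1" by (simp add: C_def sum_nonneg)
    have "\<bar>a j \<omega>\<bar> \<le> C * (real j + 1)" for j
    proof (cases "j < n")
      case True
      then have "\<bar>a j \<omega>\<bar> \<le> (\<Sum>j<n. \<bar>a j \<omega>\<bar>)" by (intro member_le_sum) auto
      also have "\<dots> \<le> C * 1" by (simp add: C_def)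
      also have "\<dots> \<le> C * (real j + 1)" using C by (intro mult_left_mono) auto
      finally show ?thesis .
    next
      case False
      then have "\<bar>a j \<omega>\<bar> \<le> 1 * (real j + 1)" using n[of j] by simp
      also have "\<dots> \<le> C * (real j + 1)" using C by (intro mult_right_mono) auto
      finally show ?thesis .
    qed
    then show ?case using C by (intro exI[of _ C]) auto
  qed
qed

lemma prob_small:
  assumes "\<epsilon> > 0"
  shows "prob {\<omega> \<in> space M. \<bar>a j \<omega>\<bar> < \<epsilon>} \<le> max K 1 * \<epsilon>"
proof -
  have "prob {\<omega> \<in> space M. \<bar>a j \<omega> - 0\<bar> < \<epsilon>} \<le> levy_conc M (a j) \<epsilon>"
    unfolding levy_conc_def
    by (rule cSUP_upper[of 0 UNIV]) (auto intro!: bdd_aboveI[of _ 1])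
  also have "\<dots> \<le> K * \<epsilon>" using assms by (rule conc)
  also have "\<dots> \<le> max K 1 * \<epsilon>" using assms by (intro mult_right_mono) auto
  finally show ?thesis by simp
qed

lemma AE_nonzero: "AE \<omega> in M. a j \<omega> \<noteq> 0"
proof -
  let ?Z = "{\<omega> \<in> space M. a j \<omega> = 0}"
  have le: "prob ?Z \<le> max K 1 * \<epsilon>" if "\<epsilon> > 0" for \<epsilon>
  proof -
    have "prob ?Z \<le> prob {\<omega> \<in> space M. \<bar>a j \<omega>\<bar> < \<epsilon>}"
      using that by (intro finite_measure_mono) auto
    also have "\<dots> \<le> max K 1 * \<epsilon>" using that by (rule prob_small)
    finally show ?thesis .
  qed
  have "prob ?Z \<le> 0"
  proof (rule field_le_epsilon)
    fix e :: real assume "e > 0"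
    then show "prob ?Z \<le> 0 + e" using le[of "e / max K 1"] by simp
  qed
  then have "prob ?Z = 0" by (simp add: measure_le_0_iff)
  then show ?thesis by (subst AE_iff_measurable[OF _ refl]) (auto simp: emeasure_eq_measure)
qed

text \<open>Below the threshold \<open>1 / (2 * max K 1)\<close> each \<open>\<bar>a j\<bar>\<close>
  falls with probability at most 1/2; \<gamma> is half of that threshold. The maximum with 1 makes
  the divisor positive.\<close>

definition \<gamma> :: real where "\<gamma> = 1 / (4 * max K 1)"

lemma \<gamma>_pos: "\<gamma> > 0" by (simp add: \<gamma>_def)

lemma expectation_abs_ge: "expectation (\<lambda>\<omega>. \<bar>a j \<omega>\<bar>) \<ge> \<gamma>"
proof -
  define \<epsilon> where "\<epsilon> = 1 / (2 * max K 1)"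
  have \<epsilon>: "\<epsilon> > 0" by (simp add: \<epsilon>_def)
  let ?S = "{\<omega> \<in> space M. \<bar>a j \<omega>\<bar> < \<epsilon>}"
  have "max K 1 * \<epsilon> = 1 / 2" by (simp add: \<epsilon>_def)
  then have "prob ?S \<le> 1 / 2" using prob_small[OF \<epsilon>, of j] by simp
  then have "\<gamma> \<le> \<epsilon> * (1 - prob ?S)" using \<epsilon> by (simp add: \<gamma>_def \<epsilon>_def field_simps)
  also have "1 - prob ?S = prob (space M - ?S)" by (rule prob_compl[symmetric]) measurable
  also have "\<epsilon> * prob (space M - ?S) = expectation (\<lambda>\<omega>. \<epsilon> * indicator (space M - ?S) \<omega>)" by simp
  also have "\<dots> \<le> expectation (\<lambda>\<omega>. \<bar>a j \<omega>\<bar>)"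
  proof (rule integral_mono)
    show "integrable M (\<lambda>\<omega>. \<epsilon> * indicator (space M - ?S) \<omega>)"
      by (intro integrable_mult_right integrable_real_indicator) (auto simp: emeasure_eq_measure)
  qed (use int \<epsilon> in \<open>auto simp: indicator_def\<close>)
  finally show ?thesis .
qed

text \<open>The centred sign is bounded and has mean 0. Because \<open>a j\<close> has mean 0 as
  well, centring does not affect the correlation, which is \<open>E |a j|\<close>.\<close>

definition b :: "nat \<Rightarrow> 'w \<Rightarrow> real" where
  "b j \<omega> = sgn (a j \<omega>) - expectation (\<lambda>\<omega>. sgn (a j \<omega>))"

lemma meas_b [measurable]: "b j \<in> borel_measurable M"
  unfolding b_def by measurable

lemma int_sgn: "integrable M (\<lambda>\<omega>. sgn (a j \<omega>))"
  by (rule integrable_const_bound[where B = 1]) (auto simp: abs_sgn_eq)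

lemma b_bound: "\<bar>b j \<omega>\<bar> \<le> 2"
proof -
  have "\<bar>expectation (\<lambda>\<omega>. sgn (a j \<omega>))\<bar> \<le> expectation (\<lambda>\<omega>. \<bar>sgn (a j \<omega>)\<bar>)"
    by (rule integral_abs_bound)
  also have "\<dots> \<le> expectation (\<lambda>\<omega>. 1)"
  proof (rule integral_mono)
    show "integrable M (\<lambda>\<omega>. \<bar>sgn (a j \<omega>)\<bar>)" using int_sgn by (rule integrable_abs)
  qed (auto simp: abs_sgn_eq)
  finally have "\<bar>expectation (\<lambda>\<omega>. sgn (a j \<omega>))\<bar> \<le> 1" by (simp add: prob_space)
  moreover have "\<bar>sgn (a j \<omega>)\<bar> \<le> 1" by (simp add: abs_sgn_eq)
  ultimately show ?thesis unfolding b_def by linarith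
qed

lemma int_b: "integrable M (b j)"
  by (rule integrable_const_bound[where B = 2]) (use b_bound in auto)

lemma mean_b: "expectation (b j) = 0"
  unfolding b_def using int_sgn by (simp add: prob_space)

lemma int_ab: "integrable M (\<lambda>\<omega>. a j \<omega> * b j \<omega>)"
proof (rule Bochner_Integration.integrable_bound)
  show "integrable M (\<lambda>\<omega>. 2 * a j \<omega>)" using int by simp
  show "AE \<omega> in M. norm (a j \<omega> * b j \<omega>) \<le> norm (2 * a j \<omega>)"
    using b_bound[of j] by (auto simp: abs_mult mult.commute[of "2"] intro!: mult_left_mono)
qed measurable

lemma mean_ab: "expectation (\<lambda>\<omega>. a j \<omega> * b j \<omega>) = expectation (\<lambda>\<omega>. \<bar>a j \<omega>\<bar>)"
proof -
  have "expectation (\<lambda>\<omega>. a j \<omega> * b j \<omega>) = expectation (\<lambda>\<omega>. \<bar>a j \<omega>\<bar> - a j \<omega> * expectation (\<lambda>\<omega>. sgn (a j \<omega>)))"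
    by (intro Bochner_Integration.integral_cong) (auto simp: b_def algebra_simps abs_sgn)
  also have "\<dots> = expectation (\<lambda>\<omega>. \<bar>a j \<omega>\<bar>)" using int[of j] mean[of j] by (simp add: integrable_abs)
  finally show ?thesis .
qed

lemma expectation_product:
  assumes "l \<noteq> j"
  shows "integrable M (\<lambda>\<omega>. a l \<omega> * a j \<omega>)" "expectation (\<lambda>\<omega>. a l \<omega> * a j \<omega>) = 0"
proof -
  have ind: "indep_vars (\<lambda>_. borel) a {l, j}" using indep by (rule indep_vars_subset) auto
  have eq: "(\<Prod>i\<in>{l, j}. a i \<omega>) = a l \<omega> * a j \<omega>" for \<omega> using assms by simp
  show "integrable M (\<lambda>\<omega>. a l \<omega> * a j \<omega>)"
    using indep_vars_integrable[OF _ ind int] by (simp only: eq) simp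
  show "expectation (\<lambda>\<omega>. a l \<omega> * a j \<omega>) = 0"
    using indep_vars_lebesgue_integral[OF _ ind int] assms mean by (simp only: eq) simp
qed

section \<open>Riesz products and weighted sums of the coefficients\<close>

context
  fixes J :: "nat set" and c :: "nat \<Rightarrow> real" and \<sigma> :: real
  assumes fin: "finite J" and \<sigma>: "\<sigma> > 0" "\<sigma>\<^sup>2 = (\<Sum>j\<in>J. (c j)\<^sup>2)"
begin

definition S :: "'w \<Rightarrow> real" where "S \<omega> = (\<Sum>j\<in>J. c j * a j \<omega>)"

lemma meas_S [measurable]: "S \<in> borel_measurable M"
  unfolding S_def by measurable

lemma int_S: "integrable M S" unfolding S_def using int by auto

lemma mean_S: "expectation S = 0" unfolding S_def using int mean by simp

lemma second_moment_S: "integrable M (\<lambda>\<omega>. (S \<omega>)\<^sup>2)" "expectation (\<lambda>\<omega>. (S \<omega>)\<^sup>2) = \<sigma>\<^sup>2"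
proof -
  have eq: "(S \<omega>)\<^sup>2 = (\<Sum>l\<in>J. \<Sum>j\<in>J. (c l * c j) * (a l \<omega> * a j \<omega>))" for \<omega>
    unfolding S_def power2_eq_square sum_product by (simp add: mult_ac)
  have i: "integrable M (\<lambda>\<omega>. a l \<omega> * a j \<omega>)" for l j
    using expectation_product(1)[of l j] int2[of j] by (cases "l = j") (auto simp: power2_eq_square)
  have e: "expectation (\<lambda>\<omega>. a l \<omega> * a j \<omega>) = (if l = j then 1 else 0)" for l j
    using expectation_product(2)[of l j] var[of j] by (auto simp: power2_eq_square)
  show "integrable M (\<lambda>\<omega>. (S \<omega>)\<^sup>2)" unfolding eq using i by auto
  have "expectation (\<lambda>\<omega>. (S \<omega>)\<^sup>2) = (\<Sum>l\<in>J. \<Sum>j\<in>J. (c l * c j) * (if l = j then 1 else 0))"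
    unfolding eq using i by (simp add: Bochner_Integration.integral_sum e)
  also have "\<dots> = \<sigma>\<^sup>2" unfolding \<sigma>(2) using fin
    by (intro sum.cong) (auto simp: power2_eq_square if_distrib sum.delta cong: if_cong)
  finally show "expectation (\<lambda>\<omega>. (S \<omega>)\<^sup>2) = \<sigma>\<^sup>2" .
qed

text \<open>Only second moments are available, so the lower bound of the first absolute moment comes from
  duality with a Riesz product, whose modulus is bounded and which correlates with each \<open>a j\<close>.\<close>

definition T :: "'w \<Rightarrow> complex" where
  "T \<omega> = (\<Prod>j\<in>J. 1 + \<i> * of_real (c j / \<sigma> * b j \<omega>))"

text \<open>The imaginary unit makes each factor only quadratically larger than 1:
  \<open>1 + y^2 \<le> exp (y^2)\<close> with \<open>y^2 \<le> 4 * (c j / \<sigma>)^2\<close>. The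
  squares \<open>(c j / \<sigma>)^2\<close> add up to 1.\<close>

lemma T_bound: "cmod (T \<omega>) \<le> exp 2"
proof -
  have "cmod (1 + \<i> * of_real (c j / \<sigma> * b j \<omega>)) \<le> exp (2 * (c j / \<sigma>)\<^sup>2)" for j
  proof -
    let ?y = "c j / \<sigma> * b j \<omega>"
    have "(b j \<omega>)\<^sup>2 \<le> 2\<^sup>2" using b_bound[of j \<omega>] by (intro abs_le_square_iff[THEN iffD1]) simp
    then have "(c j / \<sigma>)\<^sup>2 * (b j \<omega>)\<^sup>2 \<le> (c j / \<sigma>)\<^sup>2 * 2\<^sup>2" by (rule mult_left_mono) simp
    then have "(c j / \<sigma>)\<^sup>2 * (b j \<omega>)\<^sup>2 \<le> 4 * (c j / \<sigma>)\<^sup>2" by simp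
    then have "?y\<^sup>2 \<le> 4 * (c j / \<sigma>)\<^sup>2" unfolding power_mult_distrib .
    moreover have "(cmod (1 + \<i> * of_real ?y))\<^sup>2 = 1 + ?y\<^sup>2" by (simp add: cmod_power2)
    ultimately have "(cmod (1 + \<i> * of_real ?y))\<^sup>2 \<le> 1 + 4 * (c j / \<sigma>)\<^sup>2" by simp
    also have "\<dots> \<le> exp (4 * (c j / \<sigma>)\<^sup>2)" by (rule exp_ge_add_one_self)
    also have "\<dots> = (exp (2 * (c j / \<sigma>)\<^sup>2))\<^sup>2" by (simp add: exp_double[symmetric] power2_eq_square exp_add[symmetric])
    finally show ?thesis by (rule power2_le_imp_le) simp
  qed
  then have "cmod (T \<omega>) \<le> (\<Prod>j\<in>J. exp (2 * (c j / \<sigma>)\<^sup>2))"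
    unfolding T_def prod_norm[symmetric] by (intro prod_mono) auto
  also have "\<dots> = exp (\<Sum>j\<in>J. 2 * (c j / \<sigma>)\<^sup>2)" using fin by (rule exp_sum[symmetric])
  also have "(\<Sum>j\<in>J. 2 * (c j / \<sigma>)\<^sup>2) = 2"
    unfolding sum_distrib_left[symmetric] power_divide sum_divide_distrib[symmetric] \<sigma>(2)[symmetric]
    using \<sigma>(1) by simp
  finally show ?thesis .
qed

lemma meas_T [measurable]: "T \<in> borel_measurable M"
  unfolding T_def by measurable

text \<open>\<open>a l * T\<close> is a product of independent factors. Those with j different from
  l have mean 1 because \<open>b j\<close> is centred; the factor of index l has mean
  \<open>\<i> * c l / \<sigma>\<close> times \<open>E |a l|\<close>.\<close>

lemma expectation_aT:
  assumes "l \<in> J"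
  shows "integrable M (\<lambda>\<omega>. of_real (a l \<omega>) * T \<omega>)"
    "expectation (\<lambda>\<omega>. of_real (a l \<omega>) * T \<omega>) = \<i> * of_real (c l / \<sigma> * expectation (\<lambda>\<omega>. \<bar>a l \<omega>\<bar>))"
proof -
  define \<beta> where "\<beta> j = expectation (\<lambda>\<omega>. sgn (a j \<omega>))" for j
  define Y where "Y j x = (if j = l then of_real x else 1) * (1 + \<i> * of_real (c j / \<sigma> * (sgn x - \<beta> j)))" for j x
  have Ym: "Y j \<in> borel_measurable borel" for j unfolding Y_def by measurable
  have "indep_vars (\<lambda>_. borel) a J" using indep by (rule indep_vars_subset) simp
  then have ind: "indep_vars (\<lambda>_. borel) (\<lambda>j \<omega>. Y j (a j \<omega>)) J"
    by (rule indep_vars_compose2) (rule Ym)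
  have Y1: "Y j (a j \<omega>) = 1 + \<i> * of_real (c j / \<sigma>) * of_real (b j \<omega>)" if "j \<noteq> l" for j \<omega>
    using that by (simp add: Y_def b_def \<beta>_def)
  have Yl: "Y l (a l \<omega>) = of_real (a l \<omega>) + \<i> * of_real (c l / \<sigma>) * of_real (a l \<omega> * b l \<omega>)" for \<omega>
    by (simp add: Y_def b_def \<beta>_def algebra_simps)
  have intY: "integrable M (\<lambda>\<omega>. Y j (a j \<omega>))" for j
    using int int_b int_ab by (cases "j = l") (auto simp: Y1 Yl intro!: integrable_of_real simp del: of_real_mult)
  have E1: "expectation (\<lambda>\<omega>. Y j (a j \<omega>)) = 1" if "j \<noteq> l" for j
    using int_b[of j] mean_b[of j] that by (simp add: Y1 prob_space integrable_of_real)
  have El: "expectation (\<lambda>\<omega>. Y l (a l \<omega>)) = \<i> * of_real (c l / \<sigma> * expectation (\<lambda>\<omega>. \<bar>a l \<omega>\<bar>))"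
    using int[of l] int_ab[of l] mean[of l] mean_ab[of l]
    by (simp add: Yl integrable_of_real del: of_real_mult) simp
  have prod: "(\<Prod>j\<in>J. Y j (a j \<omega>)) = of_real (a l \<omega>) * T \<omega>" for \<omega>
  proof -
    have "(\<Prod>j\<in>J. Y j (a j \<omega>)) = (\<Prod>j\<in>J. if j = l then of_real (a j \<omega>) else 1) * T \<omega>"
      unfolding T_def Y_def b_def \<beta>_def prod.distrib[symmetric] by (intro prod.cong) auto
    then show ?thesis using fin assms by simp
  qed
  show "integrable M (\<lambda>\<omega>. of_real (a l \<omega>) * T \<omega>)"
    using indep_vars_integrable[OF fin ind intY] by (simp add: prod)
  have "expectation (\<lambda>\<omega>. of_real (a l \<omega>) * T \<omega>) = (\<Prod>j\<in>J. expectation (\<lambda>\<omega>. Y j (a j \<omega>)))"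
    using indep_vars_lebesgue_integral[OF fin ind intY] by (simp add: prod)
  also have "\<dots> = (\<Prod>j\<in>J. if j = l then \<i> * of_real (c l / \<sigma> * expectation (\<lambda>\<omega>. \<bar>a l \<omega>\<bar>)) else 1)"
    by (intro prod.cong) (auto simp: E1 El)
  also have "\<dots> = \<i> * of_real (c l / \<sigma> * expectation (\<lambda>\<omega>. \<bar>a l \<omega>\<bar>))" using fin assms by simp
  finally show "expectation (\<lambda>\<omega>. of_real (a l \<omega>) * T \<omega>) = \<i> * of_real (c l / \<sigma> * expectation (\<lambda>\<omega>. \<bar>a l \<omega>\<bar>))" .
qed

text \<open>Duality: the modulus of \<open>E (S * T)\<close> is the sum of
  \<open>(c l)^2 * E |a l|\<close> divided by \<sigma>, hence at least
  \<open>\<gamma> * \<sigma>\<close>, and it is at most \<open>exp 2 * E |S|\<close>.\<close>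

lemma first_moment_lower: "exp (-2) * \<gamma> * \<sigma> \<le> expectation (\<lambda>\<omega>. \<bar>S \<omega>\<bar>)"
proof -
  have eq: "of_real (S \<omega>) * T \<omega> = (\<Sum>l\<in>J. of_real (c l) * (of_real (a l \<omega>) * T \<omega>))" for \<omega>
    by (simp add: S_def sum_distrib_right mult.assoc)
  have "expectation (\<lambda>\<omega>. of_real (S \<omega>) * T \<omega>) = (\<Sum>l\<in>J. of_real (c l) * (\<i> * of_real (c l / \<sigma> * expectation (\<lambda>\<omega>. \<bar>a l \<omega>\<bar>))))"
    unfolding eq using expectation_aT by (subst Bochner_Integration.integral_sum) auto
  also have "\<dots> = \<i> * of_real ((\<Sum>l\<in>J. (c l)\<^sup>2 * expectation (\<lambda>\<omega>. \<bar>a l \<omega>\<bar>)) / \<sigma>)"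
    by (simp add: sum_distrib_left sum_divide_distrib power2_eq_square mult_ac)
  finally have E: "cmod (expectation (\<lambda>\<omega>. of_real (S \<omega>) * T \<omega>)) = \<bar>(\<Sum>l\<in>J. (c l)\<^sup>2 * expectation (\<lambda>\<omega>. \<bar>a l \<omega>\<bar>)) / \<sigma>\<bar>"
    by (simp only: norm_mult norm_of_real norm_ii mult_1_left)
  have "\<gamma> * \<sigma> = (\<Sum>l\<in>J. (c l)\<^sup>2 * \<gamma>) / \<sigma>"
    unfolding sum_distrib_right[symmetric] \<sigma>(2)[symmetric] using \<sigma>(1) by (simp add: power2_eq_square)
  also have "\<dots> \<le> (\<Sum>l\<in>J. (c l)\<^sup>2 * expectation (\<lambda>\<omega>. \<bar>a l \<omega>\<bar>)) / \<sigma>"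
    using \<sigma>(1) expectation_abs_ge by (intro divide_right_mono sum_mono mult_left_mono) auto
  also have "\<dots> \<le> cmod (expectation (\<lambda>\<omega>. of_real (S \<omega>) * T \<omega>))" unfolding E by (rule abs_ge_self)
  also have "\<dots> \<le> expectation (\<lambda>\<omega>. cmod (of_real (S \<omega>) * T \<omega>))" by (rule integral_norm_bound)
  also have "\<dots> \<le> expectation (\<lambda>\<omega>. exp 2 * \<bar>S \<omega>\<bar>)"
  proof (rule integral_mono)
    have "integrable M (\<lambda>\<omega>. of_real (S \<omega>) * T \<omega>)"
      unfolding eq using expectation_aT(1) by auto
    then show "integrable M (\<lambda>\<omega>. cmod (of_real (S \<omega>) * T \<omega>))" by (rule integrable_norm)
    show "integrable M (\<lambda>\<omega>. exp 2 * \<bar>S \<omega>\<bar>)" using int_S by auto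
    show "cmod (of_real (S \<omega>) * T \<omega>) \<le> exp 2 * \<bar>S \<omega>\<bar>" for \<omega>
      using mult_left_mono[OF T_bound[of \<omega>], of "\<bar>S \<omega>\<bar>"] by (simp add: norm_mult mult.commute)
  qed
  also have "\<dots> = exp 2 * expectation (\<lambda>\<omega>. \<bar>S \<omega>\<bar>)" by simp
  finally have "\<gamma> * \<sigma> \<le> exp 2 * expectation (\<lambda>\<omega>. \<bar>S \<omega>\<bar>)" .
  then have "exp (-2) * (\<gamma> * \<sigma>) \<le> exp (-2) * (exp 2 * expectation (\<lambda>\<omega>. \<bar>S \<omega>\<bar>))"
    by (rule mult_left_mono) simp
  moreover have "exp (-2) * (exp 2 * x) = x" for x :: real
    by (simp flip: mult.assoc exp_add)
  ultimately show ?thesis by (simp only: mult.assoc)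
qed

text \<open>A Paley-Zygmund argument for the positive part, whose mean is half of
  \<open>E |S|\<close> because S is centred. Changing the signs of all c gives the same bound for
  large negative values.\<close>

lemma prob_large:
  "prob {\<omega> \<in> space M. S \<omega> > (exp (-2) * \<gamma> / 8) * \<sigma>} \<ge> (exp (-2) * \<gamma>)\<^sup>2 / 8"
proof -
  define \<delta> where "\<delta> = exp (-2) * \<gamma>"
  have \<delta>: "\<delta> > 0" using \<gamma>_pos by (simp add: \<delta>_def)
  let ?E = "{\<omega> \<in> space M. S \<omega> > \<delta> / 8 * \<sigma>}"
  have E[measurable]: "?E \<in> events" by measurable
  \<comment> \<open>Off the event the first term suffices; on it, the inequality of the means for
    the last two. The weights make the first two terms contribute
    \<open>\<delta> * \<sigma> / 8\<close> each to the mean, leaving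
    \<open>\<delta> * \<sigma> / 4\<close> for the event.\<close>
  have pt: "(\<bar>S \<omega>\<bar> + S \<omega>) / 2 \<le> \<delta> / 8 * \<sigma> + \<delta> / (8 * \<sigma>) * (S \<omega>)\<^sup>2 + 2 * \<sigma> / \<delta> * indicator ?E \<omega>"
    if "\<omega> \<in> space M" for \<omega>
  proof (cases "\<omega> \<in> ?E")
    case True
    have "0 < \<delta> / 8 * \<sigma>" using \<delta> \<sigma> by simp
    also have "\<dots> < S \<omega>" using True by simp
    finally have "0 < S \<omega>" .
    have "0 \<le> (\<delta> * S \<omega> - 4 * \<sigma>)\<^sup>2 / (8 * \<sigma> * \<delta>)" using \<delta> \<sigma> by simp
    also have "\<dots> = \<delta> / (8 * \<sigma>) * (S \<omega>)\<^sup>2 + 2 * \<sigma> / \<delta> - S \<omega>"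
      using \<delta> \<sigma>(1) by (simp add: field_simps power2_eq_square)
    finally have "S \<omega> \<le> \<delta> / (8 * \<sigma>) * (S \<omega>)\<^sup>2 + 2 * \<sigma> / \<delta>" by simp
    moreover have "0 \<le> \<delta> / 8 * \<sigma>" using \<delta> \<sigma> by simp
    ultimately show ?thesis using True \<open>0 < S \<omega>\<close> by simp
  next
    case False
    then have "S \<omega> \<le> \<delta> / 8 * \<sigma>" using that by auto
    moreover have "0 \<le> \<delta> / 8 * \<sigma>" "0 \<le> \<delta> / (8 * \<sigma>) * (S \<omega>)\<^sup>2" using \<delta> \<sigma> by simp_all
    ultimately show ?thesis using False by (auto simp: abs_if)
  qed
  have iE: "integrable M (\<lambda>\<omega>. indicator ?E \<omega> :: real)"
    by (rule integrable_real_indicator) (auto simp: emeasure_eq_measure)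
  have "expectation (\<lambda>\<omega>. (\<bar>S \<omega>\<bar> + S \<omega>) / 2) \<le>
      expectation (\<lambda>\<omega>. \<delta> / 8 * \<sigma> + \<delta> / (8 * \<sigma>) * (S \<omega>)\<^sup>2 + 2 * \<sigma> / \<delta> * indicator ?E \<omega>)"
    using int_S second_moment_S(1) iE pt by (intro integral_mono) auto
  also have "\<dots> = \<delta> / 8 * \<sigma> + \<delta> / (8 * \<sigma>) * \<sigma>\<^sup>2 + 2 * \<sigma> / \<delta> * prob ?E"
    using second_moment_S iE by (simp add: prob_space)
  also have "expectation (\<lambda>\<omega>. (\<bar>S \<omega>\<bar> + S \<omega>) / 2) = expectation (\<lambda>\<omega>. \<bar>S \<omega>\<bar>) / 2"
    using int_S mean_S by (simp add: integrable_abs)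
  finally have "\<delta> * \<sigma> / 2 \<le> \<delta> / 8 * \<sigma> + \<delta> / (8 * \<sigma>) * \<sigma>\<^sup>2 + 2 * \<sigma> / \<delta> * prob ?E"
    using first_moment_lower by (simp add: \<delta>_def)
  also have "\<delta> / (8 * \<sigma>) * \<sigma>\<^sup>2 = \<delta> / 8 * \<sigma>" using \<sigma>(1) by (simp add: power2_eq_square)
  finally have le: "\<delta> * \<sigma> / 2 \<le> \<delta> / 8 * \<sigma> + \<delta> / 8 * \<sigma> + 2 * \<sigma> / \<delta> * prob ?E" .
  have "\<delta> / 4 \<le> 2 / \<delta> * p" if "\<delta> * \<sigma> / 2 \<le> \<delta> / 8 * \<sigma> + \<delta> / 8 * \<sigma> + 2 * \<sigma> / \<delta> * p" for p
  proof -
    have "\<sigma> * (\<delta> / 2) \<le> \<sigma> * (\<delta> / 4 + 2 / \<delta> * p)" using that by (simp add: algebra_simps)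
    then have "\<delta> / 2 \<le> \<delta> / 4 + 2 / \<delta> * p" using \<sigma>(1) by (rule mult_left_le_imp_le)
    then show ?thesis by simp
  qed
  from this[OF le] have "\<delta> / 4 \<le> 2 / \<delta> * prob ?E" .
  then have "\<delta>\<^sup>2 / 8 \<le> prob ?E" using \<delta> by (simp add: field_simps power2_eq_square)
  then show ?thesis by (simp add: \<delta>_def)
qed

end

lemma prob_linear_combination_large:
  fixes J :: "nat set" and c :: "nat \<Rightarrow> real"
  assumes "finite J" "\<sigma> > 0" "\<sigma>\<^sup>2 = (\<Sum>j\<in>J. (c j)\<^sup>2)"
  shows "prob {\<omega> \<in> space M. (\<Sum>j\<in>J. c j * a j \<omega>) > exp (-2) * \<gamma> / 8 * \<sigma>} \<ge> (exp (-2) * \<gamma>)\<^sup>2 / 8"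
  using prob_large[OF assms] unfolding S_def[OF assms] .

text \<open>Sums over disjoint blocks are independent, so the zero-one law leaves only almost surely
  finitely many or almost surely infinitely many events. In the first case dominated convergence
  would send the probabilities to 0, but they are bounded below.\<close>

lemma AE_infinitely_often_large:
  fixes N :: "nat \<Rightarrow> nat" and c :: "nat \<Rightarrow> nat \<Rightarrow> real" and \<sigma> :: "nat \<Rightarrow> real"
  assumes N: "strict_mono N" and \<sigma>: "\<And>k. \<sigma> k > 0" "\<And>k. (\<sigma> k)\<^sup>2 = (\<Sum>j=N k..<N (Suc k). (c k j)\<^sup>2)"
  shows "AE \<omega> in M. infinite {k. (\<Sum>j=N k..<N (Suc k). c k j * a j \<omega>) > exp (-2) * \<gamma> / 8 * \<sigma> k}"
proof -
  define B where "B = (\<lambda>k. {N k..<N (Suc k)})"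
  define Y where "Y = (\<lambda>k g. \<Sum>j\<in>B k. c k j * g j :: real)"
  define E where "E = (\<lambda>k \<omega>. (\<Sum>j\<in>B k. c k j * a j \<omega>) > exp (-2) * \<gamma> / 8 * \<sigma> k)"
  have "B k \<inter> B l = {}" if "k < l" for k l
  proof -
    have "N (Suc k) \<le> N l" using that N by (simp add: strict_mono_less_eq)
    then show ?thesis by (auto simp: B_def)
  qed
  then have disj: "disjoint_family_on B UNIV"
    unfolding disjoint_family_on_def by (metis inf_commute linorder_neqE_nat)
  have Ym: "Y k \<in> borel_measurable (PiM (B k) (\<lambda>_. borel))" for k
    unfolding Y_def by measurable
  have "indep_vars (\<lambda>k. PiM (B k) (\<lambda>_. borel)) (\<lambda>k \<omega>. restrict (\<lambda>i. a i \<omega>) (B k)) UNIV"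
    by (rule indep_vars_restrict[OF indep _ disj]) simp
  then have "indep_vars (\<lambda>_. borel) (\<lambda>k \<omega>. Y k (restrict (\<lambda>i. a i \<omega>) (B k))) UNIV"
    by (rule indep_vars_compose2) (rule Ym)
  moreover have "Y k (restrict (\<lambda>i. a i \<omega>) (B k)) = (\<Sum>j\<in>B k. c k j * a j \<omega>)" for k \<omega>
    unfolding Y_def by (intro sum.cong) auto
  ultimately have "indep_vars (\<lambda>_. borel) (\<lambda>k \<omega>. \<Sum>j\<in>B k. c k j * a j \<omega>) UNIV" by simp
  then have ind: "indep_events (\<lambda>k. {\<omega> \<in> space M. E k \<omega>}) UNIV"
    unfolding E_def by (rule indep_eventsI_indep_vars) auto
  have ge: "prob {\<omega> \<in> space M. E k \<omega>} \<ge> (exp (-2) * \<gamma>)\<^sup>2 / 8" for k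
    unfolding E_def using \<sigma>[of k] by (intro prob_linear_combination_large) (auto simp: B_def)
  have Em [measurable]: "{\<omega> \<in> space M. E k \<omega>} \<in> events" for k unfolding E_def by measurable
  have "\<not> (AE \<omega> in M. finite {k. E k \<omega>})"
  proof
    assume fin: "AE \<omega> in M. finite {k. E k \<omega>}"
    have "(\<lambda>k. expectation (indicat_real {\<omega> \<in> space M. E k \<omega>})) \<longlonglongrightarrow> expectation (\<lambda>_. 0)"
    proof (rule integral_dominated_convergence[where w = "\<lambda>_. 1"])
      show "AE \<omega> in M. (\<lambda>k. indicat_real {\<omega> \<in> space M. E k \<omega>} \<omega>) \<longlonglongrightarrow> 0"
        using fin
      proof eventually_elim
        case (elim \<omega>)
        then have "eventually (\<lambda>k. \<not> E k \<omega>) sequentially"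
          by (simp add: cofinite_eq_sequentially[symmetric] eventually_cofinite)
        then have "eventually (\<lambda>k. indicat_real {\<omega> \<in> space M. E k \<omega>} \<omega> = 0) sequentially"
          by eventually_elim simp
        then show ?case by (rule tendsto_eventually)
      qed
    qed (auto simp: indicator_def)
    then have "(\<lambda>k. prob {\<omega> \<in> space M. E k \<omega>}) \<longlonglongrightarrow> 0" by simp
    from LIMSEQ_le_const[OF this] ge have "(exp (-2) * \<gamma>)\<^sup>2 / 8 \<le> 0" by blast
    moreover have "(exp (-2) * \<gamma>)\<^sup>2 / 8 > 0" using \<gamma>_pos by simp
    ultimately show False by linarith
  qed
  then have "AE \<omega> in M. infinite {k. E k \<omega>}" using borel_0_1_law_AE[OF ind] by blast
  then show ?thesis by (simp add: E_def B_def)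
qed

end

subsection \<open>Zeros of the random series\<close>

lemma summable_linear_powers:
  fixes x :: real
  assumes "0 \<le> x" "x < 1"
  shows "summable (\<lambda>j. (real j + 1) * x ^ j)" "(\<Sum>j. (real j + 1) * x ^ j) = 1 / (1 - x)\<^sup>2"
  using geometric_deriv_sums[of x] assms by (auto simp: sums_iff add.commute)

text \<open>\<open>x\<close> is so close to 1 that the terms with index in \<open>{N..<N'}\<close> dominate the previous ones, and then
  \<open>N'\<close> is so large that the later ones are negligible.\<close>

lemma exists_dominant_block:
  fixes N k :: nat
  shows "\<exists>x N'. N < N' \<and> 1 - 1 / (real k + 2) < x \<and> x < 1 \<and>
    ((real k + 1) * ((real N)\<^sup>2 + 1))\<^sup>2 \<le> (\<Sum>j=N..<N'. (x ^ j)\<^sup>2) \<and>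
    (\<Sum>j. (real (j + N') + 1) * x ^ (j + N')) \<le> 1"
proof -
  \<comment> \<open>\<open>N^2 + 1\<close> is the size of everything outside the block, up to a
    constant; the factor k + 1 eventually beats that constant.\<close>
  define y where "y = ((real k + 1) * ((real N)\<^sup>2 + 1))\<^sup>2"
  \<comment> \<open>The block receives at least m terms, each as close to 1 as desired once x is
    near 1.\<close>
  obtain m :: nat where m: "y < real m" using reals_Archimedean2 by blast
  have "((\<lambda>x. real m * (x ^ (N + m))\<^sup>2) \<longlongrightarrow> real m * (1 ^ (N + m))\<^sup>2) (at_left 1)"
    by (intro tendsto_intros)
  then have "eventually (\<lambda>x. y < real m * (x ^ (N + m))\<^sup>2) (at_left (1::real))"
    using m by (intro order_tendstoD) auto
  moreover have "eventually (\<lambda>x. x \<in> {1 - 1 / (real k + 2)<..<1}) (at_left (1::real))"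
    by (rule eventually_at_left_real) simp
  ultimately have "eventually (\<lambda>x. y < real m * (x ^ (N + m))\<^sup>2 \<and> x \<in> {1 - 1 / (real k + 2)<..<1}) (at_left (1::real))"
    by (rule eventually_conj)
  then obtain x where x: "y < real m * (x ^ (N + m))\<^sup>2" "1 - 1 / (real k + 2) < x" "x < 1"
    using eventually_happens'[OF trivial_limit_at_left_real] by fastforce
  have "1 / (real k + 2) \<le> 1" by simp
  then have "x > 0" using x(2) by linarith
  obtain N0 where N0: "\<And>n. n \<ge> N0 \<Longrightarrow> norm (\<Sum>j. (real (j + n) + 1) * x ^ (j + n)) < 1"
    using suminf_exist_split[OF zero_less_one summable_linear_powers(1)[of x]] \<open>x > 0\<close> x(3) by auto
  define N' where "N' = max N0 (N + m) + 1"
  have "y \<le> (\<Sum>j=N..<N + m. (x ^ (N + m))\<^sup>2)" using x(1) by simp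
  also have "\<dots> \<le> (\<Sum>j=N..<N + m. (x ^ j)\<^sup>2)"
    using \<open>x > 0\<close> x(3) by (intro sum_mono power_mono power_decreasing) auto
  also have "\<dots> \<le> (\<Sum>j=N..<N'. (x ^ j)\<^sup>2)"
    by (intro sum_mono2) (auto simp: N'_def)
  finally have "y \<le> (\<Sum>j=N..<N'. (x ^ j)\<^sup>2)" .
  moreover have "(\<Sum>j. (real (j + N') + 1) * x ^ (j + N')) \<le> 1"
  proof -
    have "norm (\<Sum>j. (real (j + N') + 1) * x ^ (j + N')) < 1" by (rule N0) (simp add: N'_def)
    then show ?thesis unfolding real_norm_def by linarith
  qed
  moreover have "N < N'" by (simp add: N'_def)
  ultimately show ?thesis using x unfolding y_def by blast
qed

lemma conv_radius_linear_growth: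
  fixes F :: "complex fps"
  assumes C: "C > 0" "\<And>j. cmod (fps_nth F j) \<le> C * (real j + 1)"
  shows "fps_conv_radius F \<ge> 1"
  unfolding fps_conv_radius_def
proof (rule conv_radius_geI_ex)
  fix r :: real assume r: "0 < r" "ereal r < 1"
  then have "r < 1" by simp
  have "summable (\<lambda>n. fps_nth F n * of_real r ^ n)"
  proof (rule summable_comparison_test'[where N = 0])
    show "summable (\<lambda>j. C * ((real j + 1) * r ^ j))"
      using r \<open>r < 1\<close> by (intro summable_mult summable_linear_powers) auto
    show "norm (fps_nth F n * of_real r ^ n) \<le> C * ((real n + 1) * r ^ n)" for n
      using mult_right_mono[OF C(2)[of n], of "r ^ n"] r by (simp add: norm_mult norm_power mult.assoc)
  qed
  then show "\<exists>z. norm z = r \<and> summable (\<lambda>n. fps_nth F n * z ^ n)"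
    using r by (intro exI[of _ "of_real r"]) auto
qed

section \<open>The rate at which the radii approach 1\<close>

lemma (in disc_series) zero_radius_asymptotics:
  assumes C: "C > 0" "\<And>j. cmod (fps_nth F j) \<le> C * (real j + 1)" and R1: "\<And>m. R m < 1"
  shows "(\<lambda>m. 1 - R m) \<in> O(\<lambda>m. ln (real m) / real m)"
proof (rule bigoI[where c = 4])
  have fbd: "cmod (f z) \<le> C / (1 - s)\<^sup>2" if z: "cmod z = s" and s: "s < 1" for z s
  proof -
    have s0: "0 \<le> s" using z by auto
    have le: "norm (fps_nth F j * z ^ j) \<le> C * ((real j + 1) * s ^ j)" for j
      using mult_right_mono[OF C(2)[of j], of "s ^ j"] z s0 by (simp add: norm_mult norm_power mult.assoc)
    have sm: "summable (\<lambda>j. C * ((real j + 1) * s ^ j))"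
      using s s0 by (intro summable_mult summable_linear_powers) auto
    have "cmod (f z) \<le> (\<Sum>j. C * ((real j + 1) * s ^ j))"
      unfolding eval_fps_def by (rule norm_suminf_le[OF le sm])
    also have "\<dots> = C * (1 / (1 - s)\<^sup>2)"
      using summable_linear_powers[OF s0 s] by (simp add: suminf_mult)
    finally show ?thesis by simp
  qed
  have f0: "cmod (f 0) > 0" using f_0 by simp
  have "eventually (\<lambda>m::nat. C / (4 * (ln (real m))\<^sup>2) < cmod (f 0)) sequentially" using f0 C(1) by real_asymp
  moreover have "eventually (\<lambda>m::nat. 4 * ln (real m) / real m < 1) sequentially" by real_asymp
  moreover have "eventually (\<lambda>m::nat. m \<ge> 2) sequentially" by (rule eventually_ge_at_top)
  ultimately show "eventually (\<lambda>m. norm (1 - R m) \<le> 4 * norm (ln (real m) / real m)) sequentially"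
  proof eventually_elim
    case (elim m)
    \<comment> \<open>With r = 1 - \<delta> and s = 1 - \<delta>/2, \<open>(r / s) ^ m\<close> is at
      most \<open>exp (- \<delta> * m / 2) = 1 / m^2\<close>. The 4 is chosen for this square, which
      cancels the growth of \<open>U = C * m^2 / (4 * (ln m)^2)\<close>; the remaining
      \<open>1 / (ln m)^2\<close> tends to 0.\<close>
    define \<delta> where "\<delta> = 4 * ln (real m) / real m"
    have \<delta>: "0 < \<delta>" "\<delta> < 1" using elim by (auto simp: \<delta>_def)
    have m\<delta>: "\<delta> / 2 * real m = 2 * ln (real m)" using elim by (simp add: \<delta>_def)
    have "1 - \<delta> \<le> R m"
    proof (rule R_lower_bound[where s = "1 - \<delta> / 2" and U = "C / (\<delta> / 2)\<^sup>2"])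
      show "cmod (f z) \<le> C / (\<delta> / 2)\<^sup>2" if "cmod z = 1 - \<delta> / 2" for z
        using fbd[OF that] \<delta> by simp
      have q: "0 \<le> (1 - \<delta>) / (1 - \<delta> / 2)" "(1 - \<delta>) / (1 - \<delta> / 2) \<le> 1" using \<delta> by auto
      have "(1 - \<delta>) / (1 - \<delta> / 2) \<le> 1 - \<delta> / 2" using \<delta> by (simp add: field_simps)
      also have "\<dots> \<le> exp (- (\<delta> / 2))" using exp_ge_add_one_self[of "- (\<delta> / 2)"] by simp
      finally have q2: "(1 - \<delta>) / (1 - \<delta> / 2) \<le> exp (- (\<delta> / 2))" .
      have "((1 - \<delta>) / (1 - \<delta> / 2)) ^ Suc m \<le> ((1 - \<delta>) / (1 - \<delta> / 2)) ^ m"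
        using q by (intro power_decreasing) auto
      also have "\<dots> \<le> exp (- (\<delta> / 2)) ^ m" using q q2 by (intro power_mono)
      also have "\<dots> = exp (- (\<delta> / 2 * real m))" by (simp add: exp_of_nat2_mult[symmetric])
      also have "\<dots> = exp (- (ln (real m) + ln (real m)))" unfolding m\<delta> by simp
      also have "\<dots> = 1 / (real m)\<^sup>2"
      proof -
        have "exp (ln (real m) + ln (real m)) = (real m)\<^sup>2"
          unfolding exp_add power2_eq_square using elim by simp
        then show ?thesis by (simp only: exp_minus inverse_eq_divide)
      qed
      finally have "C / (\<delta> / 2)\<^sup>2 * ((1 - \<delta>) / (1 - \<delta> / 2)) ^ Suc m \<le> C / (\<delta> / 2)\<^sup>2 * (1 / (real m)\<^sup>2)"
        using C by (intro mult_left_mono) auto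
      also have "\<dots> = C / (\<delta> / 2 * real m)\<^sup>2"
        unfolding power_mult_distrib[of "\<delta> / 2"] by simp
      also have "\<dots> = C / (4 * (ln (real m))\<^sup>2)" unfolding m\<delta> by (simp add: power_mult_distrib)
      also have "\<dots> < cmod (f 0)" by (rule elim)
      finally show "C / (\<delta> / 2)\<^sup>2 * ((1 - \<delta>) / (1 - \<delta> / 2)) ^ Suc m < cmod (f 0)" .
    qed (use \<delta> in auto)
    then show ?case using R1[of m] elim \<delta> by (simp add: \<delta>_def)
  qed
qed

text \<open>At the points \<open>x k\<close> the sign of the series is that of its dominant block.\<close>

lemma infinitely_many_zeros:
  fixes \<alpha> x \<sigma> :: "nat \<Rightarrow> real" and N :: "nat \<Rightarrow> nat"
  assumes C: "C > 0" "\<And>j. \<bar>\<alpha> j\<bar> \<le> C * (real j + 1)" and "\<delta> > 0"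
    and x: "\<And>k. 1 - 1 / (real k + 2) < x k" "\<And>k. x k < 1"
    and N: "\<And>k. N k \<le> N (Suc k)"
    and tail: "\<And>k. (\<Sum>j. (real (j + N (Suc k)) + 1) * x k ^ (j + N (Suc k))) \<le> 1"
    and \<sigma>: "\<And>k. (real k + 1) * ((real (N k))\<^sup>2 + 1) \<le> \<sigma> k"
    and pos: "infinite {k. (\<Sum>j=N k..<N (Suc k). x k ^ j * \<alpha> j) > \<delta> * \<sigma> k}"
    and neg: "infinite {k. (\<Sum>j=N k..<N (Suc k). - (x k ^ j) * \<alpha> j) > \<delta> * \<sigma> k}"
  shows "infinite {z \<in> ball 0 1. eval_fps (Abs_fps (\<lambda>j. complex_of_real (\<alpha> j))) z = 0}"
proof
  define F where "F = Abs_fps (\<lambda>j. complex_of_real (\<alpha> j))"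
  assume fin: "finite {z \<in> ball 0 1. eval_fps (Abs_fps (\<lambda>j. complex_of_real (\<alpha> j))) z = 0}"
  define Z where "Z = {z \<in> ball 0 1. eval_fps F z = 0}"
  have fin: "finite Z" using fin by (simp add: Z_def F_def)
  have conv: "fps_conv_radius F \<ge> 1"
    using C by (intro conv_radius_linear_growth[of C]) (auto simp: F_def)
  define g where "g = (\<lambda>x. \<Sum>j. \<alpha> j * x ^ j)"
  have sm: "summable (\<lambda>j. \<alpha> j * t ^ j)" if "0 \<le> t" "t < 1" for t
  proof (rule summable_comparison_test'[where N = 0])
    show "summable (\<lambda>j. C * ((real j + 1) * t ^ j))"
      using that by (intro summable_mult summable_linear_powers)
    show "norm (\<alpha> n * t ^ n) \<le> C * ((real n + 1) * t ^ n)" for n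
      using mult_right_mono[OF C(2)[of n], of "t ^ n"] that by (simp add: abs_mult mult.assoc)
  qed
  have gF: "complex_of_real (g t) = eval_fps F (of_real t)" if "0 \<le> t" "t < 1" for t
    using suminf_of_real[OF sm[OF that], where 'a = complex] by (simp add: g_def eval_fps_def F_def)
  have contF: "continuous_on (ball 0 1) (eval_fps F)"
  proof (intro holomorphic_on_imp_continuous_on holomorphic_intros subsetI)
    fix z :: complex assume "z \<in> ball 0 1"
    then show "z \<in> eball 0 (fps_conv_radius F)" using less_le_trans[OF _ conv] by simp
  qed
  have contg: "continuous_on {u..v} g" if "0 \<le> u" "v < 1" for u v
  proof -
    have "continuous_on {u..v} (\<lambda>t. Re (eval_fps F (of_real t)))"
      using that by (intro continuous_intros continuous_on_compose2[OF contF]) auto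
    moreover have "Re (eval_fps F (of_real t)) = g t" if "t \<in> {u..v}" for t
      using gF[of t] that \<open>0 \<le> u\<close> \<open>v < 1\<close> by (metis Re_complex_of_real atLeastAtMost_iff order_trans le_less_trans)
    ultimately show ?thesis by (rule continuous_on_eq)
  qed
  have x0: "0 < x k" for k
  proof -
    have "1 / (real k + 2) \<le> 1" by simp
    then show ?thesis using x(1)[of k] by linarith
  qed
  \<comment> \<open>The N k terms before the block are at most \<open>C * N k\<close> each, and the
    tail is at most C.\<close>
  have close: "\<bar>g (x k) - (\<Sum>j=N k..<N (Suc k). x k ^ j * \<alpha> j)\<bar> \<le> C * ((real (N k))\<^sup>2 + 1)" for k
  proof -
    let ?h = "\<lambda>j. \<alpha> j * x k ^ j"
    have xk: "0 \<le> x k" "x k < 1" using x0[of k] x(2)[of k] by auto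
    have "g (x k) = (\<Sum>j. ?h (j + N (Suc k))) + (\<Sum>j<N (Suc k). ?h j)"
      unfolding g_def by (rule suminf_split_initial_segment[OF sm[OF xk]])
    also have "(\<Sum>j<N (Suc k). ?h j) = (\<Sum>j<N k. ?h j) + (\<Sum>j=N k..<N (Suc k). ?h j)"
      using N[of k] by (simp add: lessThan_atLeast0 sum.atLeastLessThan_concat)
    finally have eq: "g (x k) - (\<Sum>j=N k..<N (Suc k). x k ^ j * \<alpha> j) = (\<Sum>j. ?h (j + N (Suc k))) + (\<Sum>j<N k. ?h j)"
      by (simp add: mult.commute)
    have t1: "\<bar>\<Sum>j. ?h (j + N (Suc k))\<bar> \<le> C"
    proof -
      have sm': "summable (\<lambda>j. (real (j + N (Suc k)) + 1) * x k ^ (j + N (Suc k)))"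
        using summable_linear_powers(1)[OF xk] by (rule summable_ignore_initial_segment)
      have "norm (\<Sum>j. ?h (j + N (Suc k))) \<le> (\<Sum>j. C * ((real (j + N (Suc k)) + 1) * x k ^ (j + N (Suc k))))"
      proof (rule norm_suminf_le)
        show "norm (?h (j + N (Suc k))) \<le> C * ((real (j + N (Suc k)) + 1) * x k ^ (j + N (Suc k)))" for j
          using mult_right_mono[OF C(2)[of "j + N (Suc k)"], of "x k ^ (j + N (Suc k))"] xk
          by (simp add: abs_mult mult.assoc)
        show "summable (\<lambda>j. C * ((real (j + N (Suc k)) + 1) * x k ^ (j + N (Suc k))))"
          using sm' by (rule summable_mult)
      qed
      also have "\<dots> = C * (\<Sum>j. (real (j + N (Suc k)) + 1) * x k ^ (j + N (Suc k)))"
        using sm' by (rule suminf_mult)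
      also have "\<dots> \<le> C * 1" using tail[of k] C(1) by (intro mult_left_mono) auto
      finally show ?thesis by simp
    qed
    have t2: "\<bar>\<Sum>j<N k. ?h j\<bar> \<le> C * (real (N k))\<^sup>2"
    proof -
      have "\<bar>\<Sum>j<N k. ?h j\<bar> \<le> (\<Sum>j<N k. \<bar>?h j\<bar>)" by (rule sum_abs)
      also have "\<dots> \<le> (\<Sum>j<N k. C * real (N k))"
      proof (rule sum_mono)
        fix j assume j: "j \<in> {..<N k}"
        have "\<bar>?h j\<bar> \<le> \<bar>\<alpha> j\<bar> * 1"
          unfolding abs_mult using xk by (intro mult_left_mono) (auto simp: power_le_one)
        also have "\<dots> \<le> C * (real j + 1)" using C(2)[of j] by simp
        also have "\<dots> \<le> C * real (N k)" using j C(1) by (intro mult_left_mono) auto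
        finally show "\<bar>?h j\<bar> \<le> C * real (N k)" .
      qed
      finally show ?thesis by (simp add: power2_eq_square mult_ac)
    qed
    have "C * ((real (N k))\<^sup>2 + 1) = C * (real (N k))\<^sup>2 + C" by (simp add: algebra_simps)
    then show ?thesis unfolding eq using t1 t2 by linarith
  qed
  define z0 where "z0 = Max (insert 0 (cmod ` Z))"
  have "z0 \<in> insert 0 (cmod ` Z)" unfolding z0_def using fin by (intro Max_in) auto
  then have z0: "0 \<le> z0" "z0 < 1" by (auto simp: Z_def)
  \<comment> \<open>Beyond \<open>C / \<delta>\<close> the block outweighs the other terms; beyond
    \<open>1 / (1 - z0)\<close> the point x k lies to the right of every zero.\<close>
  obtain k0 :: nat where k0: "max (C / \<delta>) (1 / (1 - z0)) < real k0" using reals_Archimedean2 by blast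
  have large: "z0 < x k" "C * ((real (N k))\<^sup>2 + 1) \<le> \<delta> * \<sigma> k" if "k > k0" for k
  proof -
    have k: "C / \<delta> < real k" "1 / (1 - z0) < real k" using k0 that by auto
    have "1 / (real k + 2) \<le> 1 - z0" using k(2) z0 by (simp add: field_simps)
    then show "z0 < x k" using x(1)[of k] by linarith
    have "C \<le> \<delta> * (real k + 1)" using k(1) \<open>\<delta> > 0\<close> by (simp add: field_simps)
    then have "C * ((real (N k))\<^sup>2 + 1) \<le> \<delta> * (real k + 1) * ((real (N k))\<^sup>2 + 1)"
      by (rule mult_right_mono) simp
    also have "\<dots> \<le> \<delta> * \<sigma> k" using \<sigma>[of k] \<open>\<delta> > 0\<close> by (simp add: mult.assoc)
    finally show "C * ((real (N k))\<^sup>2 + 1) \<le> \<delta> * \<sigma> k" .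
  qed
  obtain k where k: "k > k0" "(\<Sum>j=N k..<N (Suc k). x k ^ j * \<alpha> j) > \<delta> * \<sigma> k"
    using pos unfolding infinite_nat_iff_unbounded by blast
  have gp: "g (x k) > 0" using close[of k] large(2)[OF k(1)] k(2) by linarith
  obtain l where l: "l > k0" "(\<Sum>j=N l..<N (Suc l). - (x l ^ j) * \<alpha> j) > \<delta> * \<sigma> l"
    using neg unfolding infinite_nat_iff_unbounded by blast
  have gn: "g (x l) < 0" using close[of l] large(2)[OF l(1)] l(2) by (simp add: sum_negf)
  have "\<exists>t. min (x k) (x l) \<le> t \<and> t \<le> max (x k) (x l) \<and> g t = 0"
  proof (cases "x k \<le> x l")
    case True
    then show ?thesis using IVT2'[of g "x l" 0 "x k"] gp gn contg[of "x k" "x l"] x0[of k] x(2)[of l] by auto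
  next
    case False
    then show ?thesis using IVT'[of g "x l" 0 "x k"] gp gn contg[of "x l" "x k"] x0[of l] x(2)[of k] by auto
  qed
  then obtain t where t: "min (x k) (x l) \<le> t" "t \<le> max (x k) (x l)" "g t = 0" by blast
  have tz: "z0 < t" "t < 1" using t large(1)[OF k(1)] large(1)[OF l(1)] x(2)[of k] x(2)[of l] by auto
  have "of_real t \<in> Z" using gF[of t] t(3) tz z0 by (auto simp: Z_def)
  then have "cmod (of_real t) \<in> insert 0 (cmod ` Z)" by blast
  then have "cmod (of_real t) \<le> z0" unfolding z0_def using fin by (intro Max_ge) simp_all
  then show False using tz z0 by simp
qed

text \<open>Blocks and points are deterministic and chosen recursively, each block starting where
  the previous one ends. This gives the independence, and both signs use the same blocks, so
  positive and negative values of f occur along one sequence of points.\<close>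

lemma (in random_coefficients) AE_infinitely_many_zeros:
  "AE \<omega> in M. infinite {z \<in> ball 0 1. eval_fps (random_series a \<omega>) z = 0}"
proof -
  define G where "G k n x n' \<longleftrightarrow> n < n' \<and> 1 - 1 / (real k + 2) < x \<and> x < 1 \<and>
    ((real k + 1) * ((real n)\<^sup>2 + 1))\<^sup>2 \<le> (\<Sum>j=n..<n'. (x ^ j)\<^sup>2) \<and>
    (\<Sum>j. (real (j + n') + 1) * x ^ (j + n')) \<le> 1" for k n n' :: nat and x :: real
  have "\<forall>k n. \<exists>x n'. G k n x n'" unfolding G_def by (intro allI exists_dominant_block)
  then obtain X N' where XN: "\<And>k n. G k n (X k n) (N' k n)" by metis
  define N where "N = rec_nat 0 N'"
  define x where "x = (\<lambda>k. X k (N k))"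
  define \<sigma> where "\<sigma> = (\<lambda>k. sqrt (\<Sum>j=N k..<N (Suc k). (x k ^ j)\<^sup>2))"
  have NS: "N (Suc k) = N' k (N k)" for k by (simp add: N_def)
  have P: "N k < N (Suc k) \<and> 1 - 1 / (real k + 2) < x k \<and> x k < 1 \<and>
    ((real k + 1) * ((real (N k))\<^sup>2 + 1))\<^sup>2 \<le> (\<Sum>j=N k..<N (Suc k). (x k ^ j)\<^sup>2) \<and>
    (\<Sum>j. (real (j + N (Suc k)) + 1) * x k ^ (j + N (Suc k))) \<le> 1" for k
    using XN[of k "N k"] unfolding G_def NS x_def .
  have mono: "strict_mono N" using P by (simp add: strict_mono_Suc_iff)
  have \<sigma>_sq: "(\<sigma> k)\<^sup>2 = (\<Sum>j=N k..<N (Suc k). (x k ^ j)\<^sup>2)" for k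
    unfolding \<sigma>_def by (intro real_sqrt_pow2 sum_nonneg) simp
  have \<sigma>_ge: "(real k + 1) * ((real (N k))\<^sup>2 + 1) \<le> \<sigma> k" for k
    unfolding \<sigma>_def using P[of k] by (intro real_le_rsqrt) blast
  have \<sigma>_pos: "\<sigma> k > 0" for k
  proof -
    have "0 < (real k + 1) * ((real (N k))\<^sup>2 + 1)" by (intro mult_pos_pos add_nonneg_pos) auto
    then show ?thesis using \<sigma>_ge[of k] by linarith
  qed
  have pos: "AE \<omega> in M. infinite {k. (\<Sum>j=N k..<N (Suc k). x k ^ j * a j \<omega>) > exp (-2) * \<gamma> / 8 * \<sigma> k}"
    by (rule AE_infinitely_often_large[OF mono \<sigma>_pos \<sigma>_sq])
  have neg: "AE \<omega> in M. infinite {k. (\<Sum>j=N k..<N (Suc k). - (x k ^ j) * a j \<omega>) > exp (-2) * \<gamma> / 8 * \<sigma> k}"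
    by (rule AE_infinitely_often_large[OF mono \<sigma>_pos]) (simp add: \<sigma>_sq)
  from AE_linear_growth pos neg show ?thesis
  proof eventually_elim
    case (elim \<omega>)
    then obtain C where C: "C > 0" "\<And>j. \<bar>a j \<omega>\<bar> \<le> C * (real j + 1)" by blast
    have "exp (-2) * \<gamma> / 8 > 0" using \<gamma>_pos by simp
    from infinitely_many_zeros[OF C this _ _ _ _ \<sigma>_ge elim(2,3)] show ?case
      unfolding random_series_def using P mono by (auto simp: strict_mono_less_eq)
  qed
qed

theorem theorem4p16:
  fixes M :: "'w measure" and a :: "nat \<Rightarrow> 'w \<Rightarrow> real" and K :: real
  assumes "prob_space M"
    and "prob_space.indep_vars M (\<lambda>_. borel) a UNIV"
    and "\<And>j. integrable M (a j)"
    and "\<And>j. integral\<^sup>L M (a j) = 0"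
    and "\<And>j. integrable M (\<lambda>\<omega>. (a j \<omega>)\<^sup>2)"
    and "\<And>j. integral\<^sup>L M (\<lambda>\<omega>. (a j \<omega>)\<^sup>2) = 1"
    and "\<And>j \<epsilon>. \<epsilon> > 0 \<Longrightarrow> levy_conc M (a j) \<epsilon> \<le> K * \<epsilon>"
  shows "AE \<omega> in M.
      (\<forall>m. zero_radius m (random_series a \<omega>) < 1) \<and>
      (\<forall>m. \<exists>s :: nat \<Rightarrow> nat. strict_mono s \<and>
        (\<forall>Q. (\<forall>l. pade_denominator (random_series a \<omega>) m (s l) (Q l)) \<longrightarrow>
          zeros_cluster Q (zero_radius m (random_series a \<omega>)))) \<and>
      (\<lambda>m. 1 - zero_radius m (random_series a \<omega>)) \<in> O(\<lambda>m. ln (real m) / real m)"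
proof -
  interpret prob_space M by fact
  interpret random_coefficients M a K by unfold_locales (fact assms)+
  \<comment> \<open>Three almost sure properties suffice and none refers to m: linear growth gives
    convergence on the disc and the rate, a nonzero first coefficient gives \<open>nz0\<close>, and
    infinitely many zeros give \<open>R m < 1\<close>. The rest is deterministic.\<close>
  from AE_linear_growth AE_nonzero[of 0] AE_infinitely_many_zeros show ?thesis
  proof eventually_elim
    case (elim \<omega>)
    then obtain C where C: "C > 0" "\<And>j. cmod (fps_nth (random_series a \<omega>) j) \<le> C * (real j + 1)"
      by (auto simp: random_series_def)
    interpret disc_series "random_series a \<omega>"
      using conv_radius_linear_growth[OF C] elim(2) by unfold_locales (auto simp: random_series_def)
    have R1: "zero_radius m (random_series a \<omega>) < 1" for m using elim(3) by (rule R_less_1)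
    show ?case using R1 pade_zeros_cluster[OF R1] zero_radius_asymptotics[OF C R1] by blast
  qed
qed

end
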